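(* As $n\to\infty$, the degrees of the algebras of joint invariants and covariants of $n$ linear forms satisfy $$\deg(\mathcal{I}_{n})\sim \frac{1}{2\sqrt{\pi n^3}}\qquad\text{and}\qquad \deg(\mathcal{C}_{n})\sim\frac{1}{\sqrt{\pi n}},$$ where $a_n\sim b_n$ means $\lim_{n\to\infty}a_n/b_n=1$.
   Context: Let $V_1$ be the (two-dimensional) complex vector space of linear binary forms with the natural action of $SL_2=SL_2(\mathbb{C})$, and let $nV_1=V_1\oplus\cdots\oplus V_1$ ($n$ copies). $SL_2$ acts on $\mathbb{C}^2$ by the standard representation, and hence on the algebras of polynomial functions $\mathbb{C}[nV_1]$ and $\mathbb{C}[nV_1\oplus\mathbb{C}^2]$. The algebra of joint invariants of $n$ linear forms is $\mathcal{I}_n=\mathbb{C}[nV_1]^{SL_2}$, and the algebra of joint covariants of $n$ linear forms is $\mathcal{C}_n=\mathbb{C}[nV_1\oplus\mathbb{C}^2]^{SL_2}$ (the subalgebras of $SL_2$-invariant polynomial functions). Both algebras are graded by the degree in the coefficients of the forms: $(\mathcal{I}_n)_j$ (respectively $(\mathcal{C}_n)_j$) is the space of elements that are homogeneous of degree $j$ in the coordinates of $nV_1$; for $\mathcal{C}_n$ the degree in the coordinates of $\mathbb{C}^2$ is not counted. These spaces are finite-dimensional. For a finitely generated graded complex algebra $R=R_0\oplus R_1\oplus\cdots$ with $R_0=\mathbb{C}$, its Poincaré series is $\mathcal{P}(R,z)=\sum_{j\ge0}\dim R_j\,z^j$ (a rational function of $z$). If $r$ is the transcendence degree over $\mathbb{C}$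 of the quotient field of $R$, the degree of the algebra $R$ is the number $\deg(R):=\lim_{z\to1}(1-z)^r\,\mathcal{P}(R,z)$. *)

theory Defs
  imports
    "HOL-Analysis.Analysis"
    "HOL-Library.Poly_Mapping"
    "HOL-Library.Landau_Symbols"
    "HOL-Computational_Algebra.Fraction_Field"
begin

section \<open>Polynomials\<close>

text \<open>Polynomials with coefficients in \<open>'c\<close> and indeterminates in \<open>'v\<close> are finitely supported
  maps from monomials to coefficients, monomials being finitely supported maps from
  indeterminates to exponents.\<close>

type_synonym ('v, 'c) mpoly = "('v \<Rightarrow>\<^sub>0 nat) \<Rightarrow>\<^sub>0 'c"

definition mpoly_vars :: "('v, 'c::zero) mpoly \<Rightarrow> 'v set" where
  "mpoly_vars p = (\<Union>m\<in>Poly_Mapping.keys p. Poly_Mapping.keys m)"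

definition mpoly_const :: "'c::zero \<Rightarrow> ('v, 'c) mpoly" where
  "mpoly_const c = Poly_Mapping.single 0 c"

definition mpoly_eval :: "('c::zero \<Rightarrow> 'a::comm_semiring_1) \<Rightarrow> ('v \<Rightarrow> 'a) \<Rightarrow> ('v, 'c) mpoly \<Rightarrow> 'a" where
  "mpoly_eval \<iota> x p =
     (\<Sum>m\<in>Poly_Mapping.keys p. \<iota> (Poly_Mapping.lookup p m) *
        (\<Prod>v\<in>Poly_Mapping.keys m. x v ^ Poly_Mapping.lookup m v))"

definition mpoly_scale :: "'c::comm_semiring_1 \<Rightarrow> ('v, 'c) mpoly \<Rightarrow> ('v, 'c) mpoly" where
  "mpoly_scale c p = mpoly_const c * p"

global_interpretation mpoly: vector_space "mpoly_scale :: 'c::field \<Rightarrow> ('v, 'c) mpoly \<Rightarrow> ('v, 'c) mpoly"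
  by unfold_locales
    (simp_all add: mpoly_scale_def mpoly_const_def distrib_left distrib_right single_add mult_single
       flip: mult.assoc)


section \<open>Coordinates on n linear forms and a vector\<close>

text \<open>\<open>coefA i\<close> and \<open>coefB i\<close> are the two coefficients of the \<open>i\<close>-th linear form
  \<open>a x + b y\<close>, and \<open>vecX\<close>, \<open>vecY\<close> are the coordinates on the plane. The linear order on
  coordinates is arbitrary; it only serves to obtain the library's integral domain instance
  for polynomials.\<close>

datatype coord = vecX | vecY | coefA nat | coefB nat

fun coord_code :: "coord \<Rightarrow> nat" where
  "coord_code vecX = 0"
| "coord_code vecY = 1"
| "coord_code (coefA i) = 2 * i + 2"
| "coord_code (coefB i) = 2 * i + 3"

lemma coord_code_inject: "coord_code u = coord_code v \<Longrightarrow> u = v"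
  by (cases u; cases v; simp; presburger)

instantiation coord :: linorder
begin

definition "u \<le> v \<longleftrightarrow> coord_code u \<le> coord_code v"
definition "u < v \<longleftrightarrow> coord_code u < coord_code v"

instance
  by standard (auto simp: less_eq_coord_def less_coord_def intro: coord_code_inject)

end

type_synonym cpoly = "(coord, complex) mpoly"

definition form_coords :: "nat \<Rightarrow> coord set" where
  "form_coords n = coefA ` {..<n} \<union> coefB ` {..<n}"

text \<open>A point consists of a sequence of linear forms, each given by its vector of
  coefficients, and a vector. Polynomial functions on the sum of \<open>n\<close> copies of the space of
  linear forms are polynomials in the coordinates \<open>form_coords n\<close>; they do not depend on the
  forms with index \<open>\<ge> n\<close>.\<close>

type_synonym point = "(nat \<Rightarrow> complex ^ 2) \<times> (complex ^ 2)"

fun coord_value :: "point \<Rightarrow> coord \<Rightarrow> complex" where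
  "coord_value (l, w) vecX = w $ 1"
| "coord_value (l, w) vecY = w $ 2"
| "coord_value (l, w) (coefA i) = l i $ 1"
| "coord_value (l, w) (coefB i) = l i $ 2"

definition cpoly_fun :: "cpoly \<Rightarrow> point \<Rightarrow> complex" where
  "cpoly_fun p u = mpoly_eval (\<lambda>c. c) (coord_value u) p"


section \<open>Joint invariants and covariants\<close>

definition SL2 :: "(complex ^ 2 ^ 2) set" where
  "SL2 = {g. det g = 1}"

text \<open>A group element \<open>g\<close> maps a linear form \<open>f\<close> to the form \<open>v \<mapsto> f (g\<^sup>-\<^sup>1 v)\<close>, so it acts on the
  row vector of coefficients by right multiplication with the inverse matrix.\<close>

definition SL2_act :: "complex ^ 2 ^ 2 \<Rightarrow> point \<Rightarrow> point" where
  "SL2_act g u = ((\<lambda>i. fst u i v* matrix_inv g), g *v snd u)"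

definition SL2_invariant :: "cpoly \<Rightarrow> bool" where
  "SL2_invariant p \<longleftrightarrow> (\<forall>g\<in>SL2. \<forall>u. cpoly_fun p (SL2_act g u) = cpoly_fun p u)"

definition joint_invariants :: "nat \<Rightarrow> cpoly set" where
  "joint_invariants n = {p. mpoly_vars p \<subseteq> form_coords n \<and> SL2_invariant p}"

definition joint_covariants :: "nat \<Rightarrow> cpoly set" where
  "joint_covariants n = {p. mpoly_vars p \<subseteq> form_coords n \<union> {vecX, vecY} \<and> SL2_invariant p}"


section \<open>Degree of a graded algebra\<close>

definition form_degree :: "(coord \<Rightarrow>\<^sub>0 nat) \<Rightarrow> nat" where
  "form_degree m = (\<Sum>v\<in>Poly_Mapping.keys m - {vecX, vecY}. Poly_Mapping.lookup m v)"

definition graded_part :: "cpoly set \<Rightarrow> nat \<Rightarrow> cpoly set" where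
  "graded_part R j = {p \<in> R. \<forall>m\<in>Poly_Mapping.keys p. form_degree m = j}"

definition poincare_series :: "cpoly set \<Rightarrow> real \<Rightarrow> real" where
  "poincare_series R z = suminf (\<lambda>j. real (mpoly.dim (graded_part R j)) * z ^ j)"

definition quotient_field :: "'a::idom set \<Rightarrow> 'a fract set" where
  "quotient_field R = {Fract a b | a b. a \<in> R \<and> b \<in> R \<and> b \<noteq> 0}"

text \<open>The indeterminates of the polynomials below are the elements of the set \<open>S\<close> themselves,
  and evaluation substitutes each element for itself.\<close>

definition alg_independent :: "('c::zero \<Rightarrow> 'a::comm_semiring_1) \<Rightarrow> 'a set \<Rightarrow> bool" where
  "alg_independent \<iota> S \<longleftrightarrow>
     (\<forall>p :: ('a, 'c) mpoly. mpoly_vars p \<subseteq> S \<and> mpoly_eval \<iota> (\<lambda>s. s) p = 0 \<longrightarrow> p = 0)"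

definition trdeg :: "('c::zero \<Rightarrow> 'a::comm_semiring_1) \<Rightarrow> 'a set \<Rightarrow> nat" where
  "trdeg \<iota> K = (GREATEST r. \<exists>S\<subseteq>K. finite S \<and> card S = r \<and> alg_independent \<iota> S)"

definition const_fract :: "complex \<Rightarrow> cpoly fract" where
  "const_fract c = Fract (mpoly_const c) 1"

text \<open>The Poincare series of a finitely generated graded algebra converges for
  \<open>\<bar>z\<bar> < 1\<close> to a rational function, so the limit of the latter at 1 is computed from the left.\<close>

definition algebra_degree :: "cpoly set \<Rightarrow> real" where
  "algebra_degree R =
     Lim (at_left 1) (\<lambda>z. (1 - z) ^ trdeg const_fract (quotient_field R) * poincare_series R z)"

end

theory Submission
  imports Defs "HOL-Real_Asymp.Real_Asymp"
begin

text \<open>A polynomial is invariant iff it is annihilated by the raising operator \<open>E\<close> and the lowering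
  operator \<open>F\<close> of the Lie algebra. These are adjoint for the Bombieri scalar product, so with
  \<open>[E, F] = H\<close> an element of weight \<open>0\<close> is invariant as soon as \<open>E\<close> kills it, and \<open>E\<close> maps
  weight \<open>0\<close> onto weight \<open>2\<close>. Hence the dimension of the invariants supported on a set of
  monomials stable under polarization is the number of its monomials of weight \<open>0\<close> minus that of
  weight \<open>2\<close>. With \<open>N k = (n + k - 1) choose k\<close> this gives
  \<open>(N k)\<^sup>2 - N (k + 1) * N (k - 1)\<close> for the invariants of degree \<open>2 k\<close>, and
  \<open>N \<lfloor>j/2\<rfloor> * N \<lceil>j/2\<rceil>\<close> for the covariants of degree \<open>j\<close>. The growth of these
  dimensions bounds the transcendence degrees by \<open>2 n - 3\<close> and \<open>2 n - 1\<close>, which brackets and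
  values of the forms attain. Abel's theorem evaluates the degrees as
  \<open>((2 n - 4) choose (n - 2)) / ((n - 1) 2 ^ (2 n - 3))\<close> and
  \<open>((2 n - 2) choose (n - 1)) / 4 ^ (n - 1)\<close>, and Wallis' product gives their asymptotics.\<close>


section \<open>Evaluation of polynomials\<close>

text \<open>E is onto because on weight 2 the commutator gives \<open>E F = F E + 2\<close>, which
  is positive definite for the scalar product, so already \<open>E F\<close> is invertible there.
  The covariants pose an obstacle: their grading ignores the degree in the vector, so a graded part
  is not visibly finite-dimensional. The vector is therefore treated as one more linear form and its
  degree is cut off at \<open>D\<close>. The dimension count turns out not to depend on
  \<open>D\<close> from \<open>D = j\<close> on, and this forces every covariant of degree
  \<open>j\<close> to respect the cutoff. For the invariants the leading terms of the two monomial
  counts cancel, which lowers the growth exponent from \<open>2 n - 2\<close> to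
  \<open>2 n - 4\<close>. The asymptotics of \<open>N k\<close> alone would not determine the
  degree, so the quotient of the two counts is computed exactly. Moreover only even degrees occur,
  so the coefficients of the Poincare series do not grow regularly; the limit at 1 is taken through
  the variable \<open>z ^ 2\<close>, which is the source of the powers of 2 in the degrees.\<close>

definition monom_val :: "('v \<Rightarrow> 'a::comm_semiring_1) \<Rightarrow> ('v \<Rightarrow>\<^sub>0 nat) \<Rightarrow> 'a" where
  "monom_val x m = (\<Prod>v\<in>Poly_Mapping.keys m. x v ^ Poly_Mapping.lookup m v)"

lemma monom_val_superset:
  assumes "finite V" "Poly_Mapping.keys m \<subseteq> V"
  shows "monom_val x m = (\<Prod>v\<in>V. x v ^ Poly_Mapping.lookup m v)"
  unfolding monom_val_def using assms by (intro prod.mono_neutral_left) (auto simp: in_keys_iff)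

lemma monom_val_0 [simp]: "monom_val x 0 = 1"
  by (simp add: monom_val_def)

lemma monom_val_add: "monom_val x (m + m') = monom_val x m * monom_val x m'"
proof -
  let ?V = "Poly_Mapping.keys m \<union> Poly_Mapping.keys m'"
  have "Poly_Mapping.keys (m + m') \<subseteq> ?V" by (rule keys_add)
  then show ?thesis
    by (simp add: monom_val_superset[of ?V] lookup_add power_add prod.distrib)
qed

lemma monom_val_single [simp]: "monom_val x (Poly_Mapping.single v k) = x v ^ k"
  by (simp add: monom_val_def)

lemma mpoly_eval_superset:
  assumes "finite K" "Poly_Mapping.keys p \<subseteq> K" "\<iota> 0 = 0"
  shows "mpoly_eval \<iota> x p = (\<Sum>m\<in>K. \<iota> (Poly_Mapping.lookup p m) * monom_val x m)"
  unfolding mpoly_eval_def monom_val_def using assms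
  by (intro sum.mono_neutral_left) (auto simp: in_keys_iff)

lemma poly_mapping_sum_singles:
  "(\<Sum>m\<in>Poly_Mapping.keys p. Poly_Mapping.single m (Poly_Mapping.lookup p m)) = p"
proof (rule poly_mapping_eqI)
  fix k
  show "Poly_Mapping.lookup (\<Sum>m\<in>Poly_Mapping.keys p. Poly_Mapping.single m (Poly_Mapping.lookup p m)) k
      = Poly_Mapping.lookup p k"
    by (auto simp: lookup_sum lookup_single when_def in_keys_iff sum.delta)
qed

text \<open>There are no side conditions on supports, so an additive identity only has to be checked
  on single monomials.\<close>

lemma poly_mapping_additive_induct [case_names zero add single]:
  fixes p :: "'m \<Rightarrow>\<^sub>0 'c::comm_monoid_add"
  assumes "P 0" "\<And>p q. P p \<Longrightarrow> P q \<Longrightarrow> P (p + q)" "\<And>m c. P (Poly_Mapping.single m c)"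
  shows "P p"
proof -
  have "P (\<Sum>m\<in>K. Poly_Mapping.single m (f m))" if "finite K" for K and f :: "'m \<Rightarrow> 'c"
    using that by induction (auto intro: assms)
  from this[OF finite_keys[of p], of "Poly_Mapping.lookup p"] show ?thesis
    by (simp add: poly_mapping_sum_singles)
qed

abbreviation peval :: "('v \<Rightarrow> 'c::comm_semiring_1) \<Rightarrow> ('v, 'c) mpoly \<Rightarrow> 'c" where
  "peval x p \<equiv> mpoly_eval (\<lambda>c. c) x p"

lemma peval_0 [simp]: "peval x 0 = 0"
  by (simp add: mpoly_eval_def)

lemma peval_single [simp]: "peval x (Poly_Mapping.single m c) = c * monom_val x m"
  by (simp add: mpoly_eval_def monom_val_def)

lemma peval_1 [simp]: "peval x 1 = 1"
  by (simp flip: single_one)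

lemma peval_const [simp]: "peval x (mpoly_const c) = c"
  by (simp add: mpoly_const_def)

lemma peval_add: "peval x (p + q) = peval x p + peval x q"
proof -
  let ?K = "Poly_Mapping.keys p \<union> Poly_Mapping.keys q"
  have "Poly_Mapping.keys (p + q) \<subseteq> ?K" by (rule keys_add)
  then show ?thesis
    by (simp add: mpoly_eval_superset[of ?K] lookup_add distrib_right sum.distrib)
qed

lemma peval_mult: "peval x (p * q) = peval x p * peval x q"
proof (induction p rule: poly_mapping_additive_induct)
  case (single m c)
  show ?case
    by (induction q rule: poly_mapping_additive_induct)
       (simp_all add: peval_add distrib_left mult_single monom_val_add algebra_simps)
qed (simp_all add: peval_add distrib_right)

lemma peval_scale: "peval x (mpoly_scale c p) = c * peval x p"
  by (simp add: mpoly_scale_def peval_mult)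

lemma peval_sum: "peval x (sum f A) = (\<Sum>a\<in>A. peval x (f a))"
  by (induction A rule: infinite_finite_induct) (auto simp: peval_add)

lemma peval_power: "peval x (p ^ k) = peval x p ^ k"
  by (induction k) (auto simp: peval_mult)

lemma peval_prod: "peval x (prod f A) = (\<Prod>a\<in>A. peval x (f a))"
  by (induction A rule: infinite_finite_induct) (auto simp: peval_mult)

lemma peval_cong:
  assumes "\<And>v. v \<in> mpoly_vars p \<Longrightarrow> x v = y v"
  shows "peval x p = peval y p"
  unfolding mpoly_eval_def
proof (intro sum.cong refl arg_cong2[where f = "(*)"] prod.cong)
  fix m v assume "m \<in> Poly_Mapping.keys p" "v \<in> Poly_Mapping.keys m"
  then show "x v ^ Poly_Mapping.lookup m v = y v ^ Poly_Mapping.lookup m v"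
    using assms[of v] unfolding mpoly_vars_def by (metis UN_I)
qed

lemma lookup_scale [simp]:
  "Poly_Mapping.lookup (mpoly_scale c p) m = c * Poly_Mapping.lookup p m"
  by (induction p rule: poly_mapping_additive_induct)
     (simp_all add: mpoly_scale_def mpoly_const_def distrib_left lookup_add mult_single
        lookup_single when_def)

text \<open>Distinct monomials are distinct characters of the torus of nonvanishing points, and the
  proof is Artin's argument for the independence of characters. Testing only at nonvanishing points
  is what later allows witnesses that divide by prescribed values.\<close>

lemma monomials_independent:
  fixes c :: "('v \<Rightarrow>\<^sub>0 nat) \<Rightarrow> complex"
  assumes "finite M" "\<And>x :: 'v \<Rightarrow> complex. (\<forall>v. x v \<noteq> 0) \<Longrightarrow> (\<Sum>m\<in>M. c m * monom_val x m) = 0" "m \<in> M"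
  shows "c m = 0"
  using assms
proof (induction "card M" arbitrary: M c m rule: less_induct)
  case less
  have *: "c m' = 0" if m': "m' \<in> M" and m1: "m1 \<in> M" "m1 \<noteq> m'" for m' m1
  proof -
    from m1(2) obtain v where v: "Poly_Mapping.lookup m1 v \<noteq> Poly_Mapping.lookup m' v"
      by (meson poly_mapping_eqI)
    \<comment> \<open>Doubling the coordinate \<open>v\<close> and subtracting eliminates \<open>m1\<close> but not \<open>m'\<close>.\<close>
    define d where "d k = c k * (2 ^ Poly_Mapping.lookup k v - 2 ^ Poly_Mapping.lookup m1 v)" for k
    have "d m' = 0"
    proof (rule less.hyps[of "M - {m1}"])
      show "card (M - {m1}) < card M" using m1 less.prems(1) by (meson card_Diff1_less)
      show "finite (M - {m1})" "m' \<in> M - {m1}" using less.prems m' m1 by auto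
      fix x :: "'v \<Rightarrow> complex" assume x: "\<forall>v. x v \<noteq> 0"
      define y where "y = x(v := 2 * x v)"
      have y: "monom_val y k = 2 ^ Poly_Mapping.lookup k v * monom_val x k" for k
      proof -
        have f: "finite (insert v (Poly_Mapping.keys k))" by simp
        have "monom_val y k = y v ^ Poly_Mapping.lookup k v *
            (\<Prod>u\<in>Poly_Mapping.keys k - {v}. y u ^ Poly_Mapping.lookup k u)"
          by (subst monom_val_superset[OF f]) (auto simp: prod.insert_remove)
        also have "(\<Prod>u\<in>Poly_Mapping.keys k - {v}. y u ^ Poly_Mapping.lookup k u) =
            (\<Prod>u\<in>Poly_Mapping.keys k - {v}. x u ^ Poly_Mapping.lookup k u)"
          by (intro prod.cong) (auto simp: y_def)
        also have "y v ^ Poly_Mapping.lookup k v * \<dots> = 2 ^ Poly_Mapping.lookup k v * monom_val x k"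
          by (subst monom_val_superset[OF f]) (auto simp: y_def power_mult_distrib prod.insert_remove)
        finally show ?thesis .
      qed
      have "(\<Sum>k\<in>M. d k * monom_val x k) = (\<Sum>k\<in>M. c k * monom_val y k)
          - 2 ^ Poly_Mapping.lookup m1 v * (\<Sum>k\<in>M. c k * monom_val x k)"
        by (simp add: y d_def algebra_simps sum_subtractf sum_distrib_left)
      also have "\<dots> = 0"
        using less.prems(2)[of x] less.prems(2)[of y] x by (simp add: y_def)
      finally show "(\<Sum>k\<in>M - {m1}. d k * monom_val x k) = 0"
        using m1 less.prems(1) by (simp add: sum_diff1 d_def)
    qed
    \<comment> \<open>2 is not a root of unity, so its powers separate the exponents of
      \<open>v\<close>.\<close>
    moreover have "(2::complex) ^ Poly_Mapping.lookup m' v \<noteq> 2 ^ Poly_Mapping.lookup m1 v"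
    proof
      assume "(2::complex) ^ Poly_Mapping.lookup m' v = 2 ^ Poly_Mapping.lookup m1 v"
      then have "of_nat (2 ^ Poly_Mapping.lookup m' v) = (of_nat (2 ^ Poly_Mapping.lookup m1 v) :: complex)"
        by simp
      then have "(2::nat) ^ Poly_Mapping.lookup m' v = 2 ^ Poly_Mapping.lookup m1 v"
        by (simp only: of_nat_eq_iff)
      then show False using v by simp
    qed
    ultimately show ?thesis by (simp add: d_def)
  qed
  show ?case
  proof (cases "\<exists>m1\<in>M. m1 \<noteq> m")
    case True
    then show ?thesis using * less.prems(3) by blast
  next
    case False
    then have M: "M = {m}" using less.prems(3) by blast
    have "(\<Sum>k\<in>M. c k * monom_val (\<lambda>_. 1) k) = 0"
      by (rule less.prems(2)) simp
    then show ?thesis by (simp add: M monom_val_def)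
  qed
qed

lemma peval_eq_0_imp_0:
  fixes p :: "('v, complex) mpoly"
  assumes "\<And>x. (\<forall>v. x v \<noteq> 0) \<Longrightarrow> peval x p = 0"
  shows "p = 0"
proof -
  have "Poly_Mapping.lookup p m = 0" if m: "m \<in> Poly_Mapping.keys p" for m
  proof (rule monomials_independent[OF finite_keys[of p] _ m])
    fix x :: "'v \<Rightarrow> complex" assume "\<forall>v. x v \<noteq> 0"
    from assms[OF this] show "(\<Sum>m\<in>Poly_Mapping.keys p. Poly_Mapping.lookup p m * monom_val x m) = 0"
      by (simp only: mpoly_eval_def monom_val_def)
  qed
  then show ?thesis by (intro poly_mapping_eqI) (auto simp: in_keys_iff)
qed

section \<open>Polarization operators\<close>

abbreviation emon :: "'v \<Rightarrow> 'v \<Rightarrow>\<^sub>0 nat" where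
  "emon v \<equiv> Poly_Mapping.single v 1"

definition var_mult :: "'v \<Rightarrow> ('v, 'c::comm_semiring_1) mpoly \<Rightarrow> ('v, 'c) mpoly" where
  "var_mult v p = Poly_Mapping.single (emon v) 1 * p"

lift_definition var_deriv :: "'v \<Rightarrow> ('v, 'c::comm_semiring_1) mpoly \<Rightarrow> ('v, 'c) mpoly"
  is "\<lambda>v c m. of_nat (Poly_Mapping.lookup m v + 1) * c (m + emon v)"
proof -
  fix v and c :: "('v \<Rightarrow>\<^sub>0 nat) \<Rightarrow> 'c"
  assume "finite {m. c m \<noteq> 0}"
  then have "finite ((\<lambda>m. m + emon v) -` {m. c m \<noteq> 0})"
    by (rule finite_vimageI) (auto intro: injI)
  then show "finite {m. of_nat (Poly_Mapping.lookup m v + 1) * c (m + emon v) \<noteq> 0}"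
    by (rule finite_subset[rotated]) auto
qed

lemma lookup_var_deriv:
  "Poly_Mapping.lookup (var_deriv v p) m
     = of_nat (Poly_Mapping.lookup m v + 1) * Poly_Mapping.lookup p (m + emon v)"
  by (simp add: var_deriv.rep_eq)

lemma emon_diff_add:
  "Poly_Mapping.lookup m v \<noteq> 0 \<Longrightarrow> m - emon v + emon v = (m :: 'v \<Rightarrow>\<^sub>0 nat)"
  by (rule poly_mapping_eqI) (auto simp: lookup_add lookup_minus lookup_single when_def)

lemma lookup_var_mult:
  "Poly_Mapping.lookup (var_mult v p) m
     = (if Poly_Mapping.lookup m v = 0 then 0 else Poly_Mapping.lookup p (m - emon v))"
proof (induction p rule: poly_mapping_additive_induct)
  case (single m0 c)
  have "emon v + m0 = m \<longleftrightarrow> Poly_Mapping.lookup m v \<noteq> 0 \<and> m0 = m - emon v"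
    using emon_diff_add[of m v] by (auto simp: lookup_add add.commute)
  then show ?case
    by (auto simp: var_mult_def mult_single lookup_single when_def)
qed (auto simp: var_mult_def distrib_left lookup_add)

lemma var_mult_add: "var_mult v (p + q) = var_mult v p + var_mult v q"
  by (simp add: var_mult_def distrib_left)

lemma var_mult_scale: "var_mult v (mpoly_scale c p) = mpoly_scale c (var_mult v p)"
  by (simp add: var_mult_def mpoly_scale_def mult.left_commute)

lemma var_mult_0 [simp]: "var_mult v 0 = 0"
  by (simp add: var_mult_def)

lemma var_mult_sum: "var_mult v (sum f A) = (\<Sum>a\<in>A. var_mult v (f a))"
  by (simp add: var_mult_def sum_distrib_left)

lemma var_mult_commute: "var_mult u (var_mult v p) = var_mult v (var_mult u p)"
  by (simp add: var_mult_def mult.left_commute)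

lemma peval_var_mult: "peval x (var_mult v p) = x v * peval x p"
  by (simp add: var_mult_def peval_mult)

lemma var_deriv_add: "var_deriv v (p + q) = var_deriv v p + var_deriv v q"
  by (rule poly_mapping_eqI) (simp add: lookup_var_deriv lookup_add distrib_left)

lemma var_deriv_0 [simp]: "var_deriv v 0 = 0"
  by (rule poly_mapping_eqI) (simp add: lookup_var_deriv)

lemma var_deriv_sum: "var_deriv v (sum f A) = (\<Sum>a\<in>A. var_deriv v (f a))"
  by (induction A rule: infinite_finite_induct) (auto simp: var_deriv_add)

lemma var_deriv_scale: "var_deriv v (mpoly_scale c p) = mpoly_scale c (var_deriv v p)"
  by (rule poly_mapping_eqI) (simp add: lookup_var_deriv mult.left_commute)

lemma var_deriv_commute: "var_deriv u (var_deriv v p) = var_deriv v (var_deriv u p)"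
  by (rule poly_mapping_eqI)
     (cases "u = v"; simp add: lookup_var_deriv lookup_add lookup_single when_def algebra_simps)

text \<open>The commutation relation of the Weyl algebra, to which the commutator of the raising and
  lowering operators reduces.\<close>

lemma var_deriv_var_mult:
  "var_deriv u (var_mult v p) = var_mult v (var_deriv u p) + (if u = v then p else 0)"
proof (rule poly_mapping_eqI)
  fix m
  have "m + emon u - emon v = m - emon v + emon u" if "u \<noteq> v" "Poly_Mapping.lookup m v \<noteq> 0"
    using that by (intro poly_mapping_eqI) (auto simp: lookup_add lookup_minus lookup_single when_def)
  then show "Poly_Mapping.lookup (var_deriv u (var_mult v p)) m =
      Poly_Mapping.lookup (var_mult v (var_deriv u p) + (if u = v then p else 0)) m"
    using emon_diff_add[of m v]
    by (cases "Poly_Mapping.lookup m v")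
       (auto simp: lookup_var_deriv lookup_var_mult lookup_add lookup_minus lookup_single
        algebra_simps)
qed

lemma var_deriv_single:
  "var_deriv v (Poly_Mapping.single m c) =
     (if Poly_Mapping.lookup m v = 0 then 0
      else Poly_Mapping.single (m - emon v) (of_nat (Poly_Mapping.lookup m v) * c))"
proof (rule poly_mapping_eqI)
  fix k
  have "m = k + emon v \<longleftrightarrow> Poly_Mapping.lookup m v \<noteq> 0 \<and> m - emon v = k"
    using emon_diff_add[of m v] by (auto simp: lookup_add)
  then show "Poly_Mapping.lookup (var_deriv v (Poly_Mapping.single m c)) k = Poly_Mapping.lookup
      (if Poly_Mapping.lookup m v = 0 then 0
      else Poly_Mapping.single (m - emon v) (of_nat (Poly_Mapping.lookup m v) * c)) k"
    by (cases "Poly_Mapping.lookup m v")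
       (auto simp: lookup_var_deriv lookup_single when_def lookup_add lookup_minus)
qed

lemma monom_val_has_field_derivative:
  fixes x :: "complex \<Rightarrow> 'v \<Rightarrow> complex"
  assumes V: "finite V" "Poly_Mapping.keys m \<subseteq> V"
    and d: "\<And>v. v \<in> V \<Longrightarrow> ((\<lambda>t. x t v) has_field_derivative x' v) (at s)"
  shows "((\<lambda>t. monom_val (x t) m) has_field_derivative
           (\<Sum>v\<in>V. x' v * peval (x s) (var_deriv v (Poly_Mapping.single m 1)))) (at s)"
proof -
  let ?f = "\<lambda>v t. x t v ^ Poly_Mapping.lookup m v"
  let ?f' = "\<lambda>v. of_nat (Poly_Mapping.lookup m v) * (x' v * x s v ^ (Poly_Mapping.lookup m v - 1))"
  have "((\<lambda>t. \<Prod>v\<in>V. ?f v t) has_field_derivative (\<Sum>v\<in>V. ?f' v * (\<Prod>u\<in>V - {v}. ?f u s))) (at s)"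
    by (rule has_field_derivative_prod) (auto intro!: derivative_eq_intros d)
  moreover have "?f' v * (\<Prod>u\<in>V - {v}. ?f u s) =
      x' v * peval (x s) (var_deriv v (Poly_Mapping.single m 1))" if v: "v \<in> V" for v
  proof (cases "Poly_Mapping.lookup m v = 0")
    case True
    then show ?thesis by (simp add: var_deriv_single)
  next
    case False
    have k: "Poly_Mapping.keys (m - emon v) \<subseteq> V"
      using V(2) by (auto simp: in_keys_iff lookup_minus)
    have "monom_val (x s) (m - emon v) =
        x s v ^ (Poly_Mapping.lookup m v - 1) * (\<Prod>u\<in>V - {v}. ?f u s)"
      unfolding monom_val_superset[OF V(1) k] prod.remove[OF V(1) v]
      by (intro arg_cong2[where f = "(*)"] prod.cong)
         (auto simp: lookup_minus lookup_single when_def)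
    with False show ?thesis by (simp add: var_deriv_single)
  qed
  then have "(\<Sum>v\<in>V. ?f' v * (\<Prod>u\<in>V - {v}. ?f u s)) =
      (\<Sum>v\<in>V. x' v * peval (x s) (var_deriv v (Poly_Mapping.single m 1)))"
    by (rule sum.cong[OF refl])
  ultimately show ?thesis unfolding monom_val_superset[OF V] by (simp only:)
qed

text \<open>The chain rule along a curve. It connects invariance under a one-parameter group with
  the formal derivatives.\<close>

lemma peval_has_field_derivative:
  fixes p :: "('v, complex) mpoly" and x :: "complex \<Rightarrow> 'v \<Rightarrow> complex"
  assumes V: "finite V" "mpoly_vars p \<subseteq> V"
    and d: "\<And>v. v \<in> V \<Longrightarrow> ((\<lambda>t. x t v) has_field_derivative x' v) (at s)"
  shows "((\<lambda>t. peval (x t) p) has_field_derivative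
           (\<Sum>v\<in>V. x' v * peval (x s) (var_deriv v p))) (at s)"
proof -
  let ?l = "Poly_Mapping.lookup p"
  have sc: "Poly_Mapping.single m (?l m) = mpoly_scale (?l m) (Poly_Mapping.single m 1)" for m
    by (simp add: mpoly_scale_def mpoly_const_def mult_single)
  have e: "var_deriv v p = (\<Sum>m\<in>Poly_Mapping.keys p. mpoly_scale (?l m) (var_deriv v (Poly_Mapping.single m 1)))" for v
    by (subst (1) poly_mapping_sum_singles[of p, symmetric])
       (simp add: var_deriv_sum sc var_deriv_scale)
  have "((\<lambda>t. \<Sum>m\<in>Poly_Mapping.keys p. ?l m * monom_val (x t) m) has_field_derivative
     (\<Sum>m\<in>Poly_Mapping.keys p. ?l m * (\<Sum>v\<in>V. x' v * peval (x s) (var_deriv v (Poly_Mapping.single m 1))))) (at s)"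
    using V(2)
    by (intro DERIV_sum DERIV_cmult monom_val_has_field_derivative V d) (auto simp: mpoly_vars_def)
  also have "(\<lambda>t. \<Sum>m\<in>Poly_Mapping.keys p. ?l m * monom_val (x t) m) = (\<lambda>t. peval (x t) p)"
    by (simp add: mpoly_eval_def monom_val_def)
  also have "(\<Sum>m\<in>Poly_Mapping.keys p. ?l m * (\<Sum>v\<in>V. x' v * peval (x s) (var_deriv v (Poly_Mapping.single m 1))))
     = (\<Sum>v\<in>V. x' v * peval (x s) (var_deriv v p))"
    unfolding e
    by (simp add: peval_sum peval_scale sum_distrib_left mult.left_commute sum.swap[of _ V])
  finally show ?thesis .
qed


section \<open>The action of the Lie algebra\<close>

fun partner :: "coord \<Rightarrow> coord" where
  "partner vecX = vecY"
| "partner vecY = vecX"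
| "partner (coefA i) = coefB i"
| "partner (coefB i) = coefA i"

text \<open>The coordinates of the vector transform dually to those of a form; the sign turns
  \<open>(- y, x)\<close> into one more pair of form coordinates.\<close>

fun csign :: "coord \<Rightarrow> complex" where
  "csign vecX = -1"
| "csign vecY = -1"
| "csign (coefA i) = 1"
| "csign (coefB i) = 1"

text \<open>The diagonal torus scales \<open>vecX\<close> like the \<open>coefB i\<close> and
  \<open>vecY\<close> like the \<open>coefA i\<close>, because the vector transforms dually to the
  forms.\<close>

definition lower :: "nat \<Rightarrow> coord set" where "lower n = insert vecX (coefB ` {..<n})"

definition upper :: "nat \<Rightarrow> coord set" where "upper n = insert vecY (coefA ` {..<n})"

lemma partner_partner [simp]: "partner (partner v) = v"
  by (cases v) auto

lemma partner_neq [simp]: "partner v \<noteq> v" "v \<noteq> partner v"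
  by (cases v; auto)+

lemma csign_partner [simp]: "csign (partner v) = csign v"
  by (cases v) auto

lemma csign_square [simp]: "csign v * csign v = 1"
  by (cases v) auto

lemma cnj_csign [simp]: "cnj (csign v) = csign v"
  by (cases v) auto

lemma finite_lower [simp]: "finite (lower n)" and finite_upper [simp]: "finite (upper n)"
  by (auto simp: lower_def upper_def)

lemma upper_eq: "upper n = partner ` lower n"
  by (auto simp: lower_def upper_def image_image)

lemma lower_Int_upper: "lower n \<inter> upper n = {}"
  by (auto simp: lower_def upper_def)

lemma inj_on_partner: "inj_on partner A"
  by (metis inj_onI partner_partner)

lemma partner_notin_lower: "r \<in> lower n \<Longrightarrow> partner r \<notin> lower n"
  using lower_Int_upper[of n] upper_eq[of n] by blast

lemma partner_notin_upper: "r \<in> upper n \<Longrightarrow> partner r \<notin> upper n"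
  using lower_Int_upper[of n] upper_eq[of n] by force

abbreviation all_coords :: "nat \<Rightarrow> coord set" where
  "all_coords n \<equiv> form_coords n \<union> {vecX, vecY}"

lemma all_coords_eq: "all_coords n = lower n \<union> upper n"
  by (auto simp: form_coords_def lower_def upper_def)

lemma finite_form_coords [simp]: "finite (form_coords n)"
  by (simp add: form_coords_def)

text \<open>For \<open>S = lower n\<close> this is the raising operator E, for
  \<open>S = upper n\<close> the lowering operator F.\<close>

definition polarize :: "coord set \<Rightarrow> cpoly \<Rightarrow> cpoly" where
  "polarize S p = (\<Sum>s\<in>S. mpoly_scale (csign s) (var_mult (partner s) (var_deriv s p)))"

text \<open>The eigenvalue of H on the monomial \<open>m\<close>: coordinates in
  \<open>upper n\<close> count 1, those in \<open>lower n\<close> count -1.\<close>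

definition weight :: "nat \<Rightarrow> (coord \<Rightarrow>\<^sub>0 nat) \<Rightarrow> int" where
  "weight n m = (\<Sum>s\<in>lower n. int (Poly_Mapping.lookup m (partner s)) - int (Poly_Mapping.lookup m s))"

lemma polarize_add: "polarize S (p + q) = polarize S p + polarize S q"
  by (simp add: polarize_def var_deriv_add var_mult_add mpoly.scale_right_distrib sum.distrib)

lemma polarize_scale: "polarize S (mpoly_scale c p) = mpoly_scale c (polarize S p)"
  by (simp add: polarize_def var_deriv_scale var_mult_scale mpoly.scale_sum_right mult.commute)

lemma polarize_linear: "Vector_Spaces.linear mpoly_scale mpoly_scale (polarize S)"
  by (intro Vector_Spaces.linear.intro module_hom.intro module_hom_axioms.intro
      mpoly.vector_space_axioms mpoly.module_axioms polarize_add polarize_scale)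

lemma polarize_0 [simp]: "polarize S 0 = 0"
  by (simp add: polarize_def)

lemma lookup_var_mult_var_deriv_same:
  "Poly_Mapping.lookup (var_mult v (var_deriv v p)) m
     = of_nat (Poly_Mapping.lookup m v) * Poly_Mapping.lookup p m"
  using emon_diff_add[of m v]
  by (cases "Poly_Mapping.lookup m v")
     (auto simp: lookup_var_mult lookup_var_deriv lookup_minus)

lemma lookup_swap:
  assumes "s \<noteq> t"
  shows "Poly_Mapping.lookup (var_mult t (var_deriv s p)) m =
    (if Poly_Mapping.lookup m t = 0 then 0
     else of_nat (Poly_Mapping.lookup m s + 1) * Poly_Mapping.lookup p (m - emon t + emon s))"
  using assms by (simp add: lookup_var_mult lookup_var_deriv lookup_minus lookup_single)

text \<open>The relation \<open>[E, F] = H\<close> of the Lie algebra of \<open>SL\<^sub>2\<close>.\<close>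

lemma polarize_commutator:
  "polarize (lower n) (polarize (upper n) p) = polarize (upper n) (polarize (lower n) p)
     + (\<Sum>s\<in>lower n. var_mult (partner s) (var_deriv (partner s) p) - var_mult s (var_deriv s p))"
proof -
  let ?L = "lower n"
  let ?D = "\<lambda>s r. mpoly_scale (csign s * csign r)
    (var_mult (partner s) (var_mult r (var_deriv s (var_deriv (partner r) p))))"
  have F: "polarize (upper n) q =
      (\<Sum>r\<in>?L. mpoly_scale (csign r) (var_mult r (var_deriv (partner r) q)))" for q
    by (simp add: polarize_def upper_eq sum.reindex[OF inj_on_partner])
  \<comment> \<open>The second-order terms \<open>?D s r\<close> are the same in both orders of
    composition and cancel. Only for \<open>r = s\<close> does a derivative hit the coordinate just
    multiplied in, and there the two signs multiply to 1.\<close>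
  have 1: "mpoly_scale (csign s) (var_mult (partner s) (var_deriv s (mpoly_scale (csign r)
        (var_mult r (var_deriv (partner r) p))))) =
      ?D s r + (if r = s then var_mult (partner s) (var_deriv (partner s) p) else 0)" for s r
    by (auto simp: var_deriv_var_mult var_mult_add var_deriv_scale var_mult_scale
        mpoly.scale_right_distrib)
  have 2: "mpoly_scale (csign r) (var_mult r (var_deriv (partner r) (mpoly_scale (csign s)
        (var_mult (partner s) (var_deriv s p))))) =
      ?D s r + (if r = s then var_mult s (var_deriv s p) else 0)" for s r
    by (auto simp: var_deriv_var_mult var_mult_add var_deriv_scale var_mult_scale
        mpoly.scale_right_distrib var_mult_commute[of r] var_deriv_commute[of "partner r"] mult.commute
        dest: arg_cong[of "partner r" _ partner])
  have "polarize ?L (polarize (upper n) p) = (\<Sum>s\<in>?L. \<Sum>r\<in>?L. ?D s r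
      + (if r = s then var_mult (partner s) (var_deriv (partner s) p) else 0))"
    unfolding F unfolding polarize_def
    by (simp add: var_deriv_sum var_mult_sum mpoly.scale_sum_right 1 cong: sum.cong del: mpoly.scale_scale)
  moreover have "polarize (upper n) (polarize ?L p) = (\<Sum>r\<in>?L. \<Sum>s\<in>?L. ?D s r
      + (if r = s then var_mult s (var_deriv s p) else 0))"
    unfolding F unfolding polarize_def
    by (simp add: var_deriv_sum var_mult_sum mpoly.scale_sum_right 2 cong: sum.cong del: mpoly.scale_scale)
  then have "polarize (upper n) (polarize ?L p) = (\<Sum>s\<in>?L. \<Sum>r\<in>?L. ?D s r
      + (if r = s then var_mult s (var_deriv s p) else 0))"
    by (subst sum.swap)
  ultimately show ?thesis
    by (simp add: sum.distrib sum_subtractf sum.delta)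
qed

lemma lookup_polarize_commutator:
  "Poly_Mapping.lookup (polarize (lower n) (polarize (upper n) p)) m =
     Poly_Mapping.lookup (polarize (upper n) (polarize (lower n) p)) m
     + of_int (weight n m) * Poly_Mapping.lookup p m"
  by (simp add: polarize_commutator lookup_add lookup_sum lookup_minus
      lookup_var_mult_var_deriv_same weight_def sum_distrib_right left_diff_distrib)


section \<open>Invariance in terms of the Lie algebra\<close>

text \<open>The two unipotent one-parameter subgroups in coordinates; \<open>polarize S\<close> is
  the infinitesimal generator.\<close>

definition shear :: "coord set \<Rightarrow> complex \<Rightarrow> (coord \<Rightarrow> complex) \<Rightarrow> coord \<Rightarrow> complex" where
  "shear S t x v = (if v \<in> S then x v + t * csign v * x (partner v) else x v)"

text \<open>No partner of a coordinate in \<open>S\<close> lies in \<open>S\<close>, so the shear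
  leaves the speed \<open>csign v * x (partner v)\<close> unchanged. Hence the derivative is the
  generator evaluated at the sheared point for every \<open>t\<close>, not only at
  \<open>t = 0\<close>.\<close>

lemma peval_shear_derivative:
  assumes S: "S = lower n \<or> S = upper n" and p: "mpoly_vars p \<subseteq> all_coords n"
  shows "((\<lambda>t. peval (shear S t x) p) has_field_derivative
           peval (shear S t x) (polarize S p)) (at t)"
proof -
  have S': "S \<subseteq> all_coords n" "\<And>s. s \<in> S \<Longrightarrow> partner s \<notin> S"
    using S partner_notin_lower partner_notin_upper unfolding all_coords_eq by blast+
  have "((\<lambda>t. peval (shear S t x) p) has_field_derivative
     (\<Sum>v\<in>all_coords n. (if v \<in> S then csign v * x (partner v) else 0) *
         peval (shear S t x) (var_deriv v p))) (at t)"
    using p by (intro peval_has_field_derivative)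
      (auto simp: shear_def intro!: derivative_eq_intros)
  also have "(\<Sum>v\<in>all_coords n. (if v \<in> S then csign v * x (partner v) else 0) *
         peval (shear S t x) (var_deriv v p)) =
      (\<Sum>v\<in>S. csign v * x (partner v) * peval (shear S t x) (var_deriv v p))"
    using S'(1) by (intro sum.mono_neutral_cong_right) auto
  also have "\<dots> = peval (shear S t x) (polarize S p)"
    using S'(2) by (simp add: polarize_def peval_sum peval_scale peval_var_mult shear_def mult.assoc)
  finally show ?thesis .
qed

lemma shear_0 [simp]: "shear S 0 x = x"
  by (auto simp: shear_def)

text \<open>One direction differentiates at \<open>t = 0\<close>. In the other the derivative
  vanishes for all \<open>t\<close>, so the value is constant along the shear.\<close>

lemma shear_invariant_iff:
  assumes S: "S = lower n \<or> S = upper n" and p: "mpoly_vars p \<subseteq> all_coords n"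
  shows "(\<forall>t x. peval (shear S t x) p = peval x p) \<longleftrightarrow> polarize S p = 0"
proof
  assume inv: "\<forall>t x. peval (shear S t x) p = peval x p"
  have "peval x (polarize S p) = 0" for x
    using peval_shear_derivative[OF assms, of x 0] inv DERIV_unique[OF _ DERIV_const] by simp
  then show "polarize S p = 0" by (rule peval_eq_0_imp_0)
next
  assume z: "polarize S p = 0"
  have "peval (shear S t x) p = peval (shear S 0 x) p" for t x
  proof -
    have "\<exists>c. \<forall>t\<in>UNIV. peval (shear S t x) p = c"
      using peval_shear_derivative[OF assms, of x] z
      by (intro has_field_derivative_zero_constant) auto
    then show ?thesis by (metis UNIV_I)
  qed
  then show "\<forall>t x. peval (shear S t x) p = peval x p" by simp
qed

text \<open>The group action in coordinates, with the adjugate in place of the inverse matrix, so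
  that the composition law holds without a condition on the determinant.\<close>

fun mat_act :: "complex \<Rightarrow> complex \<Rightarrow> complex \<Rightarrow> complex \<Rightarrow> (coord \<Rightarrow> complex) \<Rightarrow> coord \<Rightarrow> complex" where
  "mat_act a b c d x vecX = a * x vecX + b * x vecY"
| "mat_act a b c d x vecY = c * x vecX + d * x vecY"
| "mat_act a b c d x (coefA i) = d * x (coefA i) - c * x (coefB i)"
| "mat_act a b c d x (coefB i) = a * x (coefB i) - b * x (coefA i)"

lemma mat_act_mat_act:
  "mat_act a b c d (mat_act a' b' c' d' x) =
     mat_act (a * a' + b * c') (a * b' + b * d') (c * a' + d * c') (c * b' + d * d') x"
proof
  fix v show "mat_act a b c d (mat_act a' b' c' d' x) v =
     mat_act (a * a' + b * c') (a * b' + b * d') (c * a' + d * c') (c * b' + d * d') x v"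
    by (cases v) (auto simp: algebra_simps)
qed

lemma matrix_inv_2:
  fixes g :: "complex ^ 2 ^ 2"
  assumes "det g = 1"
  shows "matrix_inv g = vector [vector [g$2$2, - g$1$2], vector [- g$2$1, g$1$1]]"
proof -
  let ?B = "vector [vector [g$2$2, - g$1$2], vector [- g$2$1, g$1$1]] :: complex ^ 2 ^ 2"
  have d: "g$1$1 * g$2$2 - g$1$2 * g$2$1 = 1" using assms by (simp add: det_2)
  have 1: "g ** ?B = mat 1"
    using d by (simp add: vec_eq_iff matrix_matrix_mult_def mat_def forall_2 sum_2 algebra_simps)
  have 2: "?B ** g = mat 1"
    using d by (simp add: vec_eq_iff matrix_matrix_mult_def mat_def forall_2 sum_2 algebra_simps)
  have "matrix_inv g ** g = mat 1"
    unfolding matrix_inv_def by (rule someI2[of _ ?B]) (use 1 2 in auto)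
  then have "matrix_inv g ** (g ** ?B) = ?B"
    by (simp add: matrix_mul_assoc)
  then show ?thesis by (simp add: 1)
qed

lemma coord_value_SL2_act:
  assumes "det g = 1"
  shows "coord_value (SL2_act g u) = mat_act (g$1$1) (g$1$2) (g$2$1) (g$2$2) (coord_value u)"
proof
  fix v show "coord_value (SL2_act g u) v = mat_act (g$1$1) (g$1$2) (g$2$1) (g$2$2) (coord_value u) v"
    by (cases u; cases v)
       (simp_all add: SL2_act_def matrix_inv_2[OF assms] matrix_vector_mult_def
          vector_matrix_mult_def sum_2)
qed

lemma coord_value_surj: "\<exists>u. coord_value u = x"
proof
  show "coord_value (\<lambda>i. vector [x (coefA i), x (coefB i)], vector [x vecX, x vecY]) = x"
  proof
    fix v show "coord_value (\<lambda>i. vector [x (coefA i), x (coefB i)], vector [x vecX, x vecY]) v = x v"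
      by (cases v) auto
  qed
qed

lemma SL2_invariant_mat_act:
  "SL2_invariant p \<longleftrightarrow>
     (\<forall>a b c d x. a * d - b * c = 1 \<longrightarrow> peval (mat_act a b c d x) p = peval x p)"
proof safe
  fix a b c d :: complex and x
  assume inv: "SL2_invariant p" and d: "a * d - b * c = 1"
  obtain u where u: "coord_value u = x" using coord_value_surj by blast
  let ?g = "vector [vector [a, b], vector [c, d]] :: complex ^ 2 ^ 2"
  have g: "det ?g = 1" using d by (simp add: det_2)
  have "cpoly_fun p (SL2_act ?g u) = cpoly_fun p u"
    using inv g unfolding SL2_invariant_def SL2_def by blast
  then show "peval (mat_act a b c d x) p = peval x p"
    by (simp add: cpoly_fun_def coord_value_SL2_act[OF g] u)
next
  assume *: "\<forall>a b c d x. a * d - b * c = 1 \<longrightarrow> peval (mat_act a b c d x) p = peval x p"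
  show "SL2_invariant p"
    unfolding SL2_invariant_def SL2_def cpoly_fun_def
    using * by (auto simp: coord_value_SL2_act det_2)
qed

lemma SL2_invariant_iff:
  assumes p: "mpoly_vars p \<subseteq> all_coords n"
  shows "SL2_invariant p \<longleftrightarrow> polarize (lower n) p = 0 \<and> polarize (upper n) p = 0"
proof -
  let ?inv = "\<lambda>a b c d. \<forall>x. peval (mat_act a b c d x) p = peval x p"
  \<comment> \<open>The matrix adds \<open>t * x vecY\<close> to \<open>x vecX\<close> and subtracts
    \<open>t * x (coefA i)\<close> from \<open>x (coefB i)\<close>. The signs \<open>csign\<close>
    make both of them a shear with parameter \<open>- t\<close>.\<close>
  have U: "peval (mat_act 1 t 0 1 x) p = peval (shear (lower n) (- t) x) p" for t x
  proof (rule peval_cong)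
    fix v assume "v \<in> mpoly_vars p"
    then show "mat_act 1 t 0 1 x v = shear (lower n) (- t) x v"
      using p by (cases v) (auto simp: shear_def lower_def form_coords_def)
  qed
  have L: "peval (mat_act 1 0 t 1 x) p = peval (shear (upper n) (- t) x) p" for t x
  proof (rule peval_cong)
    fix v assume "v \<in> mpoly_vars p"
    then show "mat_act 1 0 t 1 x v = shear (upper n) (- t) x v"
      using p by (cases v) (auto simp: shear_def upper_def form_coords_def)
  qed
  have U': "polarize (lower n) p = 0 \<longleftrightarrow> (\<forall>t. ?inv 1 t 0 1)"
    unfolding shear_invariant_iff[OF disjI1[OF refl] p, symmetric] U
    by (metis minus_minus)
  have L': "polarize (upper n) p = 0 \<longleftrightarrow> (\<forall>t. ?inv 1 0 t 1)"
    unfolding shear_invariant_iff[OF disjI2[OF refl] p, symmetric] L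
    by (metis minus_minus)
  have comp: "?inv (a * a' + b * c') (a * b' + b * d') (c * a' + d * c') (c * b' + d * d')"
    if "?inv a b c d" "?inv a' b' c' d'" for a b c d a' b' c' d'
    using that by (simp flip: mat_act_mat_act)
  show ?thesis
    unfolding U' L' SL2_invariant_mat_act
  proof safe
    fix a b c d :: complex and x
    assume inv: "\<forall>t. ?inv 1 t 0 1" "\<forall>t. ?inv 1 0 t 1" and det: "a * d - b * c = 1"
    \<comment> \<open>\<open>SL\<^sub>2\<close> is generated by the shears: for \<open>c \<noteq> 0\<close> three of them suffice, and a fourth
      reduces \<open>c = 0\<close> to this case.\<close>
    have *: "?inv a b c d" if "c \<noteq> 0" and det: "a * d - b * c = 1" for a b c d
    proof -
      \<comment> \<open>The determinant forces this \<open>b\<close>. The matrix is the product of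
        the upper shear by \<open>(a - 1) / c\<close>, the lower shear by \<open>c\<close> and the
        upper shear by \<open>(d - 1) / c\<close>.\<close>
      have "b = a * (d - 1) / c + (a - 1) / c" using that by (simp add: field_simps)
      moreover have "?inv (1 * 1 + (a - 1) / c * c) (1 * 0 + (a - 1) / c * 1)
          (0 * 1 + 1 * c) (0 * 0 + 1 * 1)"
        by (rule comp) (use inv in blast)+
      then have "?inv a ((a - 1) / c) c 1" using that by simp
      then have "?inv (a * 1 + (a - 1) / c * 0) (a * ((d - 1) / c) + (a - 1) / c * 1)
          (c * 1 + 1 * 0) (c * ((d - 1) / c) + 1 * 1)"
        by (rule comp) (use inv in blast)
      ultimately show ?thesis using that by simp
    qed
    show "peval (mat_act a b c d x) p = peval x p"
    proof (cases "c = 0")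
      case True
      with det have ad: "a * d = 1" by simp
      \<comment> \<open>Multiplying on the right by the lower shear with parameter 1 makes the lower
        left entry \<open>d\<close>, which is nonzero; the shear with parameter -1 undoes
        this.\<close>
      then have "?inv (a + b) b d d"
        by (intro *) (auto simp: algebra_simps)
      then have "?inv ((a + b) * 1 + b * - 1) ((a + b) * 0 + b * 1) (d * 1 + d * - 1) (d * 0 + d * 1)"
        by (rule comp) (use inv in blast)
      then show ?thesis using True by simp
    next
      case False
      with * det show ?thesis by blast
    qed
  qed simp_all
qed


section \<open>Dimensions of spaces of invariants\<close>

context vector_space
begin

text \<open>Rank and nullity for subspaces of an ambient space of any dimension, by two
  inequalities. A basis \<open>C\<close> of the kernel together with preimages of \<open>B'\<close>
  spans \<open>span B\<close>, which bounds \<open>card B\<close>. If \<open>C\<close> is extended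
  to a basis \<open>D\<close> of \<open>span B\<close>, the images of \<open>D - C\<close> span
  everything in the image, which bounds \<open>card B'\<close>.\<close>

lemma dim_kernel_plus_card:
  assumes f: "Vector_Spaces.linear scale scale f"
    and B: "finite B" "independent B" and B': "finite B'" "independent B'"
    and into: "\<And>b. b \<in> B \<Longrightarrow> f b \<in> span B'" and onto: "B' \<subseteq> f ` span B"
  shows "dim {v \<in> span B. f v = 0} + card B' = card B"
proof -
  interpret f: Vector_Spaces.linear scale scale f by (fact f)
  let ?K = "{v \<in> span B. f v = 0}"
  have subK: "subspace ?K"
    by (rule subspaceI) (auto simp: f.add f.scale span_add span_scale span_zero)
  obtain C where C: "C \<subseteq> ?K" "independent C" "?K \<subseteq> span C"
    using maximal_independent_subset by blast
  have finC: "finite C" and dimC: "dim ?K = card C"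
    using independent_span_bound[OF B(1) C(2)] C(1) basis_card_eq_dim[OF C(1,3,2)] by auto
  have "\<forall>b\<in>B'. \<exists>v. v \<in> span B \<and> f v = b" using onto by blast
  then obtain g where "\<forall>b\<in>B'. g b \<in> span B \<and> f (g b) = b"
    by (rule bchoice[THEN exE])
  then have g: "g b \<in> span B" "f (g b) = b" if "b \<in> B'" for b
    using that by auto
  have "B \<subseteq> span (C \<union> g ` B')"
  proof
    fix v assume v: "v \<in> B"
    then obtain u where u: "(\<Sum>b\<in>B'. scale (u b) b) = f v"
      using into[OF v] span_finite[OF B'(1)] by auto
    define w where "w = (\<Sum>b\<in>B'. scale (u b) (g b))"
    have "f w = f v" by (simp add: w_def f.sum f.scale g flip: u cong: sum.cong)
    moreover have "w \<in> span B" unfolding w_def by (intro span_sum span_scale) (use g in auto)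
    ultimately have "v - w \<in> ?K" using v by (auto simp: f.diff intro: span_diff span_base)
    then have "v - w \<in> span (C \<union> g ` B')"
      using C(3) span_mono[of C "C \<union> g ` B'"] by auto
    moreover have "w \<in> span (C \<union> g ` B')"
      unfolding w_def by (intro span_sum span_scale span_base) auto
    ultimately show "v \<in> span (C \<union> g ` B')" using span_add by fastforce
  qed
  from independent_span_bound[OF _ B(2) this] finC B'(1)
  have "card B \<le> card (C \<union> g ` B')" by auto
  also have "\<dots> \<le> card C + card B'"
    using card_Un_le[of C "g ` B'"] card_image_le[OF B'(1), of g] by linarith
  finally have 1: "card B \<le> dim ?K + card B'" by (simp add: dimC)
  obtain D where D: "C \<subseteq> D" "D \<subseteq> span B" "independent D" "span B \<subseteq> span D"
    using maximal_independent_subset_extend[of C "span B"] C(1,2) by blast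
  have finD: "finite D" "card D \<le> card B"
    using independent_span_bound[OF B(1) D(3,2)] by auto
  have "f ` span B \<subseteq> span (f ` (D - C))"
  proof safe
    fix v assume "v \<in> span B"
    then have "f v \<in> span (f ` D)" using D(4) f.span_image[of D] by blast
    also have "span (f ` D) \<subseteq> span (f ` (D - C))"
    proof (rule span_minimal)
      show "f ` D \<subseteq> span (f ` (D - C))"
      proof safe
        fix d assume "d \<in> D"
        then show "f d \<in> span (f ` (D - C))"
          using C(1) by (cases "d \<in> C") (auto intro: span_base simp: span_zero)
      qed
    qed simp
    finally show "f v \<in> span (f ` (D - C))" .
  qed
  with onto have "B' \<subseteq> span (f ` (D - C))" by blast
  from independent_span_bound[OF _ B'(2) this] finD
  have "card B' \<le> card (f ` (D - C))" by auto
  also have "\<dots> \<le> card (D - C)" using finD by (intro card_image_le) auto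
  also have "\<dots> = card D - card C" using D(1) finC by (intro card_Diff_subset)
  finally have "card C + card B' \<le> card B"
    using finD D(1) card_mono[OF finD(1) D(1)] by linarith
  with 1 show ?thesis by (simp add: dimC)
qed

text \<open>The image of \<open>B\<close> is independent and as large as \<open>B\<close>, so a
  vector of \<open>B\<close> outside its span would give one independent vector too many.\<close>

lemma injective_on_span_imp_surjective:
  assumes f: "Vector_Spaces.linear scale scale f"
    and B: "finite B" "independent B"
    and into: "\<And>b. b \<in> B \<Longrightarrow> f b \<in> span B" and inj: "\<And>v. v \<in> span B \<Longrightarrow> f v = 0 \<Longrightarrow> v = 0"
  shows "B \<subseteq> f ` span B"
proof -
  interpret f: Vector_Spaces.linear scale scale f by (fact f)
  have inj': "inj_on f (span B)"
    by (rule inj_onI) (metis f.diff inj right_minus_eq span_diff)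
  have ind: "independent (f ` B)"
    using f.independent_injective_image[OF B(2) inj'] .
  have card: "card (f ` B) = card B"
    by (rule card_image[OF inj_on_subset[OF inj' span_superset]])
  have "b \<in> span (f ` B)" if "b \<in> B" for b
  proof (rule ccontr)
    assume n: "b \<notin> span (f ` B)"
    then have "independent (insert b (f ` B))" using ind by (intro independent_insertI)
    moreover have "insert b (f ` B) \<subseteq> span B" using into that by (auto intro: span_base)
    ultimately have "card (insert b (f ` B)) \<le> card B"
      using independent_span_bound[OF B(1)] by blast
    moreover have "b \<notin> f ` B" using n span_base by blast
    ultimately show False using B(1) card by simp
  qed
  then show ?thesis using f.span_image by blast
qed

end


section \<open>The scalar product and the adjointness of the two operators\<close>

definition mfact :: "('v \<Rightarrow>\<^sub>0 nat) \<Rightarrow> real" where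
  "mfact m = (\<Prod>v\<in>Poly_Mapping.keys m. fact (Poly_Mapping.lookup m v))"

lemma mfact_pos: "mfact m > 0"
  by (simp add: mfact_def prod_pos)

lemma mfact_superset:
  assumes "finite V" "Poly_Mapping.keys m \<subseteq> V"
  shows "mfact m = (\<Prod>v\<in>V. fact (Poly_Mapping.lookup m v))"
  unfolding mfact_def using assms by (intro prod.mono_neutral_left) (auto simp: in_keys_iff)

text \<open>This recursion is why factorial weights work: it offsets the factor by which
  \<open>var_deriv\<close> scales a coefficient.\<close>

lemma mfact_add_emon: "mfact (m + emon v) = real (Poly_Mapping.lookup m v + 1) * mfact m"
proof -
  let ?V = "insert v (Poly_Mapping.keys m)"
  have "Poly_Mapping.keys (m + emon v) \<subseteq> ?V" using keys_add[of m "emon v"] by auto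
  then have "mfact (m + emon v) = (\<Prod>u\<in>?V. fact (Poly_Mapping.lookup (m + emon v) u))"
    by (intro mfact_superset) auto
  also have "\<dots> = fact (Poly_Mapping.lookup (m + emon v) v) *
      (\<Prod>u\<in>?V - {v}. fact (Poly_Mapping.lookup (m + emon v) u))"
    by (rule prod.remove) auto
  also have "(\<Prod>u\<in>?V - {v}. fact (Poly_Mapping.lookup (m + emon v) u)) =
      (\<Prod>u\<in>?V - {v}. fact (Poly_Mapping.lookup m u) :: real)"
    by (intro prod.cong) (auto simp: lookup_add lookup_single when_def)
  also have "fact (Poly_Mapping.lookup (m + emon v) v) * \<dots> = real (Poly_Mapping.lookup m v + 1) *
      (fact (Poly_Mapping.lookup m v) * \<dots>)"
    by (simp add: lookup_add algebra_simps)
  also have "fact (Poly_Mapping.lookup m v) * (\<Prod>u\<in>?V - {v}. fact (Poly_Mapping.lookup m u)) =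
      (\<Prod>u\<in>?V. fact (Poly_Mapping.lookup m u) :: real)"
    by (rule prod.remove[symmetric]) auto
  also have "(\<Prod>u\<in>?V. fact (Poly_Mapping.lookup m u)) = mfact m"
    by (intro mfact_superset[symmetric]) auto
  finally show ?thesis .
qed

text \<open>The Bombieri scalar product, for which multiplication by a variable is adjoint to the
  derivation with respect to it; hence raising and lowering operators are adjoint.\<close>

definition bombieri :: "(coord \<Rightarrow>\<^sub>0 nat) set \<Rightarrow> cpoly \<Rightarrow> cpoly \<Rightarrow> complex" where
  "bombieri A p q = (\<Sum>m\<in>A. of_real (mfact m) * Poly_Mapping.lookup p m * cnj (Poly_Mapping.lookup q m))"

text \<open>Both operators preserve the span of such a set, so the scalar product may be truncated
  to \<open>A\<close> without breaking adjointness.\<close>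

definition swap_closed :: "nat \<Rightarrow> (coord \<Rightarrow>\<^sub>0 nat) set \<Rightarrow> bool" where
  "swap_closed n A \<longleftrightarrow> (\<forall>m\<in>A. \<forall>s\<in>all_coords n.
      Poly_Mapping.lookup m s \<noteq> 0 \<longrightarrow> m - emon s + emon (partner s) \<in> A)"

text \<open>Both sides run over the same pairs of monomials, namely those that differ by exchanging
  one \<open>s\<close> for its partner. The left side is indexed by one member of the pair and the
  right side by the other.\<close>

lemma bombieri_swap:
  assumes A: "finite A" "swap_closed n A" and s: "s \<in> all_coords n"
  shows "bombieri A (var_mult (partner s) (var_deriv s p)) q =
         bombieri A p (var_mult s (var_deriv (partner s) q))"
proof -
  let ?t = "partner s"
  let ?l = "Poly_Mapping.lookup"
  have t: "?t \<in> all_coords n" using s by (cases s) (auto simp: form_coords_def)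
  have cl: "m - emon r + emon (partner r) \<in> A" if "m \<in> A" "?l m r \<noteq> 0" "r = s \<or> r = ?t" for m r
    using A(2) s t that by (auto simp: swap_closed_def)
  have inv: "m - emon u + emon v - emon v + emon u = m" if "?l m u \<noteq> 0" for m u v
    using emon_diff_add[OF that] by simp
  \<comment> \<open>With \<open>m = k + emon ?t\<close> both sides equal \<open>mfact k\<close>
    times the exponents of \<open>s\<close> and \<open>?t\<close> in \<open>k\<close>, each
    increased by 1.\<close>
  have fac: "mfact m * real (?l m s + 1) =
      mfact (m - emon ?t + emon s) * real (?l (m - emon ?t + emon s) ?t + 1)"
    if "?l m ?t \<noteq> 0" for m
  proof -
    define k where "k = m - emon ?t"
    have m: "m = k + emon ?t" using emon_diff_add[OF that] by (simp add: k_def)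
    show ?thesis
      by (simp add: m mfact_add_emon[simplified] lookup_add lookup_single when_def)
  qed
  have "bombieri A (var_mult ?t (var_deriv s p)) q =
     (\<Sum>m\<in>{m\<in>A. ?l m ?t \<noteq> 0}. of_real (mfact m * real (?l m s + 1)) * ?l p (m - emon ?t + emon s) * cnj (?l q m))"
    unfolding bombieri_def using A(1)
    by (intro sum.mono_neutral_cong_right) (auto simp: lookup_swap algebra_simps)
  also have "\<dots> = (\<Sum>m\<in>{m\<in>A. ?l m s \<noteq> 0}. of_real (mfact m * real (?l m ?t + 1)) * ?l p m * cnj (?l q (m - emon s + emon ?t)))"
  proof (rule sum.reindex_bij_witness[where i = "\<lambda>m. m - emon s + emon ?t" and j = "\<lambda>m. m - emon ?t + emon s"])
    fix m assume m: "m \<in> {m\<in>A. ?l m ?t \<noteq> 0}"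
    show "m - emon ?t + emon s - emon s + emon ?t = m"
      using inv[of m ?t s] m by simp
    show "m - emon ?t + emon s \<in> {m\<in>A. ?l m s \<noteq> 0}"
      using cl[of m ?t] m by (auto simp: lookup_add)
    show "of_real (mfact (m - emon ?t + emon s) * real (?l (m - emon ?t + emon s) ?t + 1)) *
        ?l p (m - emon ?t + emon s) * cnj (?l q (m - emon ?t + emon s - emon s + emon ?t)) =
        of_real (mfact m * real (?l m s + 1)) * ?l p (m - emon ?t + emon s) * cnj (?l q m)"
      using fac[of m] inv[of m ?t s] m by simp
  next
    fix m assume m: "m \<in> {m\<in>A. ?l m s \<noteq> 0}"
    show "m - emon s + emon ?t - emon ?t + emon s = m"
      using inv[of m s ?t] m by simp
    show "m - emon s + emon ?t \<in> {m\<in>A. ?l m ?t \<noteq> 0}"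
      using cl[of m s] m by (auto simp: lookup_add)
  qed
  also have "\<dots> = bombieri A p (var_mult s (var_deriv ?t q))"
    unfolding bombieri_def using A(1)
    by (intro sum.mono_neutral_cong_left) (auto simp: lookup_swap algebra_simps)
  finally show ?thesis .
qed

lemma bombieri_sum_left: "bombieri A (sum f S) q = (\<Sum>s\<in>S. bombieri A (f s) q)"
  unfolding bombieri_def by (subst sum.swap) (simp add: lookup_sum sum_distrib_left sum_distrib_right)

lemma bombieri_sum_right: "bombieri A p (sum f S) = (\<Sum>s\<in>S. bombieri A p (f s))"
  unfolding bombieri_def by (subst sum.swap) (simp add: lookup_sum sum_distrib_left)

lemma bombieri_add_left: "bombieri A (p + p') q = bombieri A p q + bombieri A p' q"
  by (simp add: bombieri_def lookup_add algebra_simps sum.distrib)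

lemma bombieri_scale_left: "bombieri A (mpoly_scale c p) q = c * bombieri A p q"
  by (simp add: bombieri_def sum_distrib_left algebra_simps)

lemma bombieri_scale_right: "bombieri A p (mpoly_scale c q) = cnj c * bombieri A p q"
  by (simp add: bombieri_def sum_distrib_left algebra_simps)

lemma bombieri_polarize:
  assumes A: "finite A" "swap_closed n A" and S: "S \<subseteq> all_coords n"
  shows "bombieri A (polarize S p) q = bombieri A p (polarize (partner ` S) q)"
  unfolding polarize_def bombieri_sum_left bombieri_sum_right sum.reindex[OF inj_on_partner] o_def
proof (rule sum.cong[OF refl])
  fix s assume "s \<in> S"
  with S have "s \<in> all_coords n" by blast
  from bombieri_swap[OF A this]
  show "bombieri A (mpoly_scale (csign s) (var_mult (partner s) (var_deriv s p))) q =
      bombieri A p (mpoly_scale (csign (partner s)) (var_mult (partner (partner s)) (var_deriv (partner s) q)))"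
    by (simp add: bombieri_scale_left bombieri_scale_right)
qed

lemma bombieri_self:
  "bombieri A p p = of_real (\<Sum>m\<in>A. mfact m * (cmod (Poly_Mapping.lookup p m))\<^sup>2)"
  unfolding bombieri_def of_real_sum
  by (intro sum.cong refl) (metis complex_norm_square mult.assoc of_real_mult of_real_power)

lemma bombieri_self_Re: "Re (bombieri A p p) \<ge> 0"
  by (simp add: bombieri_self less_imp_le[OF mfact_pos] sum_nonneg)

lemma bombieri_self_eq_0:
  assumes A: "finite A" "Poly_Mapping.keys p \<subseteq> A" and z: "Re (bombieri A p p) = 0"
  shows "p = 0"
proof (rule poly_mapping_eqI)
  fix m :: "coord \<Rightarrow>\<^sub>0 nat"
  have "mfact m * (cmod (Poly_Mapping.lookup p m))\<^sup>2 = 0" if "m \<in> A" for m :: "coord \<Rightarrow>\<^sub>0 nat"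
    using z that A(1)
    by (simp add: bombieri_self less_imp_le[OF mfact_pos] sum_nonneg_eq_0_iff)
  moreover have "mfact m \<noteq> 0" using mfact_pos[of m] by simp
  ultimately show "Poly_Mapping.lookup p m = Poly_Mapping.lookup 0 m"
    using A(2) by (cases "m \<in> A") (auto simp: in_keys_iff)
qed


section \<open>Weight spaces and the dimension formula\<close>

lemma lower_subset: "lower n \<subseteq> all_coords n" and upper_subset: "upper n \<subseteq> all_coords n"
  by (simp_all only: all_coords_eq Un_upper1 Un_upper2)

lemma lower_eq: "lower n = partner ` upper n"
  by (simp add: upper_eq image_image)

lemma weight_add: "weight n (m + m') = weight n m + weight n m'"
  by (simp add: weight_def lookup_add sum.distrib sum_subtractf)

lemma weight_emon:
  assumes "s \<in> lower n"
  shows "weight n (emon s) = -1" "weight n (emon (partner s)) = 1"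
proof -
  have "partner r = s \<longleftrightarrow> False" if "r \<in> lower n" for r
    using partner_notin_lower[OF that] assms by auto
  then have *: "s = partner r \<longleftrightarrow> False" if "r \<in> lower n" for r
    using that by blast
  have **: "partner s = r \<longleftrightarrow> False" if "r \<in> lower n" for r
    using partner_notin_lower[OF assms] that by auto
  have ***: "partner s = partner r \<longleftrightarrow> s = r" for r
    by (metis partner_partner)
  show "weight n (emon s) = -1"
    using assms by (simp add: weight_def lookup_single when_def sum_subtractf * sum_negf flip: of_nat_sum cong: sum.cong)
  show "weight n (emon (partner s)) = 1"
    using assms by (simp add: weight_def lookup_single when_def sum_subtractf ** *** flip: of_nat_sum cong: sum.cong)
qed

lemma weight_swap:
  assumes "s \<in> lower n"
  shows "Poly_Mapping.lookup m (partner s) \<noteq> 0 \<Longrightarrow> weight n (m - emon (partner s) + emon s) = weight n m - 2"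
    and "Poly_Mapping.lookup m s \<noteq> 0 \<Longrightarrow> weight n (m - emon s + emon (partner s)) = weight n m + 2"
proof -
  assume "Poly_Mapping.lookup m (partner s) \<noteq> 0"
  from emon_diff_add[OF this] have "weight n m = weight n (m - emon (partner s)) + weight n (emon (partner s))"
    by (metis weight_add)
  then show "weight n (m - emon (partner s) + emon s) = weight n m - 2"
    by (simp only: weight_add weight_emon[OF assms])
next
  assume "Poly_Mapping.lookup m s \<noteq> 0"
  from emon_diff_add[OF this] have "weight n m = weight n (m - emon s) + weight n (emon s)"
    by (metis weight_add)
  then show "weight n (m - emon s + emon (partner s)) = weight n m + 2"
    by (simp only: weight_add weight_emon[OF assms])
qed

definition weight_part :: "nat \<Rightarrow> (coord \<Rightarrow>\<^sub>0 nat) set \<Rightarrow> int \<Rightarrow> (coord \<Rightarrow>\<^sub>0 nat) set" where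
  "weight_part n A w = {m \<in> A. weight n m = w}"

lemma keys_polarize:
  assumes A: "swap_closed n A" and m: "m \<in> Poly_Mapping.keys (polarize S p)"
    and S: "S \<subseteq> all_coords n" and p: "Poly_Mapping.keys p \<subseteq> A"
  shows "\<exists>s\<in>S. \<exists>k\<in>Poly_Mapping.keys p. Poly_Mapping.lookup k s \<noteq> 0 \<and> m = k - emon s + emon (partner s) \<and> m \<in> A"
proof -
  from m obtain s where s: "s \<in> S" "Poly_Mapping.lookup (var_mult (partner s) (var_deriv s p)) m \<noteq> 0"
    unfolding in_keys_iff polarize_def lookup_sum lookup_scale
    by (metis (no_types, lifting) mult_zero_right sum.neutral)
  then have t: "Poly_Mapping.lookup m (partner s) \<noteq> 0"
    and k: "m - emon (partner s) + emon s \<in> Poly_Mapping.keys p"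
    by (auto simp: lookup_swap in_keys_iff split: if_splits)
  let ?k = "m - emon (partner s) + emon s"
  have l: "Poly_Mapping.lookup ?k s \<noteq> 0" by (simp add: lookup_add)
  have e: "m = ?k - emon s + emon (partner s)" using emon_diff_add[OF t] by simp
  have "?k - emon s + emon (partner s) \<in> A"
    using A S s(1) k p l unfolding swap_closed_def by blast
  with e have "m \<in> A" by simp
  with s(1) k l e show ?thesis by blast
qed

lemma keys_polarize_lower:
  assumes A: "swap_closed n A" and p: "Poly_Mapping.keys p \<subseteq> weight_part n A w"
  shows "Poly_Mapping.keys (polarize (lower n) p) \<subseteq> weight_part n A (w + 2)"
proof
  fix m assume "m \<in> Poly_Mapping.keys (polarize (lower n) p)"
  from keys_polarize[OF A this] p obtain s k where "s \<in> lower n" "k \<in> Poly_Mapping.keys p"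
    "Poly_Mapping.lookup k s \<noteq> 0" "m = k - emon s + emon (partner s)" "m \<in> A"
    unfolding all_coords_eq weight_part_def by blast
  then show "m \<in> weight_part n A (w + 2)"
    using weight_swap(2)[of s n k] p by (auto simp: weight_part_def)
qed

lemma keys_polarize_upper:
  assumes A: "swap_closed n A" and p: "Poly_Mapping.keys p \<subseteq> weight_part n A w"
  shows "Poly_Mapping.keys (polarize (upper n) p) \<subseteq> weight_part n A (w - 2)"
proof
  fix m assume "m \<in> Poly_Mapping.keys (polarize (upper n) p)"
  from keys_polarize[OF A this] p obtain s k where s: "s \<in> upper n" "k \<in> Poly_Mapping.keys p"
    "Poly_Mapping.lookup k s \<noteq> 0" "m = k - emon s + emon (partner s)" "m \<in> A"
    unfolding all_coords_eq weight_part_def by blast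
  moreover from s(1) have "partner s \<in> lower n" by (auto simp: upper_eq)
  ultimately show "m \<in> weight_part n A (w - 2)"
    using weight_swap(1)[of "partner s" n k] p by (auto simp: weight_part_def)
qed

definition poly_span :: "(coord \<Rightarrow>\<^sub>0 nat) set \<Rightarrow> cpoly set" where
  "poly_span A = {p. Poly_Mapping.keys p \<subseteq> A}"

lemma poly_span_eq: "mpoly.span ((\<lambda>m. Poly_Mapping.single m 1) ` A) = poly_span A"
proof
  show "mpoly.span ((\<lambda>m. Poly_Mapping.single m 1) ` A) \<subseteq> poly_span A"
  proof (rule mpoly.span_minimal)
    show "mpoly.subspace (poly_span A)"
    proof (rule mpoly.subspaceI)
      fix x y assume "x \<in> poly_span A" "y \<in> poly_span A"
      then show "x + y \<in> poly_span A"
        using keys_add[of x y] by (auto simp: poly_span_def)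
    next
      fix c x assume "x \<in> poly_span A"
      then show "mpoly_scale c x \<in> poly_span A"
        by (auto simp: poly_span_def in_keys_iff)
    qed (simp add: poly_span_def)
  qed (auto simp: poly_span_def)
  show "poly_span A \<subseteq> mpoly.span ((\<lambda>m. Poly_Mapping.single m 1) ` A)"
  proof
    fix p assume p: "p \<in> poly_span A"
    have "Poly_Mapping.single m c \<in> mpoly.span ((\<lambda>m. Poly_Mapping.single m 1) ` A)"
      if "m \<in> A" for m and c :: complex
    proof -
      have "Poly_Mapping.single m c = mpoly_scale c (Poly_Mapping.single m 1)"
        by (simp add: mpoly_scale_def mpoly_const_def mult_single)
      then show ?thesis using that by (auto intro: mpoly.span_scale mpoly.span_base)
    qed
    then have "(\<Sum>m\<in>Poly_Mapping.keys p. Poly_Mapping.single m (Poly_Mapping.lookup p m))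
        \<in> mpoly.span ((\<lambda>m. Poly_Mapping.single m 1) ` A)"
      using p by (intro mpoly.span_sum) (auto simp: poly_span_def)
    then show "p \<in> mpoly.span ((\<lambda>m. Poly_Mapping.single m 1) ` A)"
      by (simp only: poly_mapping_sum_singles)
  qed
qed

lemma inj_single_1: "inj_on (\<lambda>m. Poly_Mapping.single m (1 :: complex)) A"
  by (rule inj_onI) (metis keys_single singleton_inject zero_neq_one)

lemma independent_singles:
  "mpoly.independent ((\<lambda>m :: coord \<Rightarrow>\<^sub>0 nat. Poly_Mapping.single m (1::complex)) ` A)"
  unfolding mpoly.independent_explicit_finite_subsets
proof (intro allI impI ballI)
  fix T and u :: "cpoly \<Rightarrow> complex" and v
  assume T: "T \<subseteq> (\<lambda>m. Poly_Mapping.single m 1) ` A" "finite T"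
    and z: "(\<Sum>v\<in>T. mpoly_scale (u v) v) = 0" and v: "v \<in> T"
  obtain m where m: "v = Poly_Mapping.single m 1" using T(1) v by auto
  have "0 = (\<Sum>w\<in>T. u w * Poly_Mapping.lookup w m)"
    using arg_cong[OF z, of "\<lambda>p. Poly_Mapping.lookup p m"] by (simp add: lookup_sum)
  also have "\<dots> = (\<Sum>w\<in>T. if w = v then u v else 0)"
  proof (intro sum.cong refl)
    fix w assume "w \<in> T"
    then obtain k where k: "w = Poly_Mapping.single k 1" using T(1) by auto
    show "u w * Poly_Mapping.lookup w m = (if w = v then u v else 0)"
      by (cases "k = m") (auto simp: k m lookup_single dest: inj_onD[OF inj_single_1])
  qed
  also have "\<dots> = u v" using T(2) v by simp
  finally show "u v = 0" by simp
qed

text \<open>On weight 0 the commutator vanishes, so \<open>E F p = F E p = 0\<close>. By adjointness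
  the squared norm of \<open>F p\<close> is the product of \<open>E F p\<close> with
  \<open>p\<close>, hence 0.\<close>

lemma polarize_weight_0:
  assumes A: "finite A" "swap_closed n A" and p: "Poly_Mapping.keys p \<subseteq> weight_part n A 0"
    and z: "polarize (lower n) p = 0"
  shows "polarize (upper n) p = 0"
proof -
  let ?E = "polarize (lower n)" and ?F = "polarize (upper n)"
  have "Poly_Mapping.lookup (?E (?F p)) m = 0" for m
    using p by (cases "m \<in> Poly_Mapping.keys p")
      (auto simp: lookup_polarize_commutator z weight_part_def in_keys_iff)
  then have "?E (?F p) = 0" by (intro poly_mapping_eqI) simp
  moreover have "bombieri A (?F p) (?F p) = bombieri A (?E (?F p)) p"
    using bombieri_polarize[OF A lower_subset, of "?F p" p] by (simp flip: upper_eq)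
  ultimately have "bombieri A (?F p) (?F p) = 0" by (simp add: bombieri_def)
  moreover have "Poly_Mapping.keys (?F p) \<subseteq> A"
    using keys_polarize_upper[OF A(2) p] by (auto simp: weight_part_def)
  ultimately show ?thesis using bombieri_self_eq_0[OF A(1)] by simp
qed

text \<open>Pairing \<open>E F p = F E p + 2 p\<close> with \<open>p\<close> gives the squared norm
  of \<open>E p\<close> plus twice that of \<open>p\<close>. Both are nonnegative, so a vanishing
  sum kills \<open>p\<close>.\<close>

lemma polarize_weight_2_inj:
  assumes A: "finite A" "swap_closed n A" and p: "Poly_Mapping.keys p \<subseteq> weight_part n A 2"
    and z: "polarize (lower n) (polarize (upper n) p) = 0"
  shows "p = 0"
proof -
  let ?E = "polarize (lower n)" and ?F = "polarize (upper n)"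
  have "?F (?E p) + mpoly_scale 2 p = ?E (?F p)"
  proof (rule poly_mapping_eqI)
    fix m
    show "Poly_Mapping.lookup (?F (?E p) + mpoly_scale 2 p) m = Poly_Mapping.lookup (?E (?F p)) m"
      using p by (cases "m \<in> Poly_Mapping.keys p")
        (auto simp: lookup_polarize_commutator weight_part_def in_keys_iff lookup_add)
  qed
  then have "0 = bombieri A (?F (?E p)) p + 2 * bombieri A p p"
    using z by (metis bombieri_add_left bombieri_scale_left mult_zero_left mpoly.scale_zero_left)
  also have "bombieri A (?F (?E p)) p = bombieri A (?E p) (?E p)"
    using bombieri_polarize[OF A upper_subset, of "?E p" p] by (simp flip: lower_eq)
  finally have "Re (bombieri A (?E p) (?E p)) + 2 * Re (bombieri A p p) = 0"
    by (metis Re_complex_of_real of_real_numeral plus_complex.sel(1) zero_complex.sel(1) mult_2)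
  then have "Re (bombieri A p p) = 0"
    using bombieri_self_Re[of A p] bombieri_self_Re[of A "?E p"] by linarith
  then show ?thesis using p bombieri_self_eq_0[OF A(1)] by (auto simp: weight_part_def)
qed

text \<open>The multiplicity of the trivial representation as a difference of weight multiplicities,
  stated as a sum to keep natural subtraction out.\<close>

lemma dim_invariants:
  assumes A: "finite A" "swap_closed n A"
    and vars: "\<And>m. m \<in> A \<Longrightarrow> Poly_Mapping.keys m \<subseteq> all_coords n"
  shows "mpoly.dim {p. Poly_Mapping.keys p \<subseteq> A \<and> SL2_invariant p} + card (weight_part n A 2)
       = card (weight_part n A 0)"
proof -
  let ?E = "polarize (lower n)" and ?F = "polarize (upper n)"
  let ?b = "\<lambda>w. (\<lambda>m. Poly_Mapping.single m (1::complex)) ` weight_part n A w"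
  have inv: "SL2_invariant p \<longleftrightarrow> ?E p = 0 \<and> ?F p = 0" if "Poly_Mapping.keys p \<subseteq> A" for p
    using that vars by (intro SL2_invariant_iff) (auto simp: mpoly_vars_def)
  have fin: "finite (?b w)" for w using A(1) by (simp add: weight_part_def)
  have sp: "mpoly.span (?b w) = poly_span (weight_part n A w)" for w
    by (rule poly_span_eq)
  have into0: "?E b \<in> mpoly.span (?b 2)" if "b \<in> mpoly.span (?b 0)" for b
    using keys_polarize_lower[OF A(2), of b 0] that unfolding sp by (simp add: poly_span_def)
  have into2: "?F b \<in> mpoly.span (?b 0)" if "b \<in> mpoly.span (?b 2)" for b
    using keys_polarize_upper[OF A(2), of b 2] that unfolding sp by (simp add: poly_span_def)
  have "{p. Poly_Mapping.keys p \<subseteq> A \<and> SL2_invariant p} = {p \<in> mpoly.span (?b 0). ?E p = 0}"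
  proof (intro equalityI subsetI; clarsimp)
    fix p assume p: "Poly_Mapping.keys p \<subseteq> A" "SL2_invariant p"
    \<comment> \<open>If E and F kill \<open>p\<close>, so does their commutator, which multiplies
      the coefficient at \<open>m\<close> by the weight of \<open>m\<close>.\<close>
    have "weight n m = 0" if "m \<in> Poly_Mapping.keys p" for m
      using lookup_polarize_commutator[of n p m] inv[OF p(1)] p(2) that
      by (simp add: in_keys_iff)
    with p(1) have "Poly_Mapping.keys p \<subseteq> weight_part n A 0" by (auto simp: weight_part_def)
    with p inv[OF p(1)] show "p \<in> mpoly.span (?b 0) \<and> ?E p = 0"
      unfolding sp poly_span_def by blast
  next
    fix p assume p: "p \<in> mpoly.span (?b 0)" "?E p = 0"
    then have k: "Poly_Mapping.keys p \<subseteq> weight_part n A 0" by (simp add: sp poly_span_def)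
    then have k': "Poly_Mapping.keys p \<subseteq> A" by (auto simp: weight_part_def)
    show "Poly_Mapping.keys p \<subseteq> A \<and> SL2_invariant p"
      using k' inv[OF k'] p(2) polarize_weight_0[OF A k p(2)] by blast
  qed
  moreover have "mpoly.dim {p \<in> mpoly.span (?b 0). ?E p = 0} + card (?b 2) = card (?b 0)"
  proof (rule mpoly.dim_kernel_plus_card[OF polarize_linear fin independent_singles fin independent_singles])
    show "?E b \<in> mpoly.span (?b 2)" if "b \<in> ?b 0" for b
      using that by (intro into0 mpoly.span_base)
    \<comment> \<open>E is onto weight 2 because the endomorphism \<open>?E \<circ> ?F\<close> of
      that finite-dimensional space is injective; F supplies the preimages in weight 0.\<close>
    have "?b 2 \<subseteq> (?E \<circ> ?F) ` mpoly.span (?b 2)"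
    proof (rule mpoly.injective_on_span_imp_surjective[OF _ fin independent_singles])
      show "Vector_Spaces.linear mpoly_scale mpoly_scale (?E \<circ> ?F)"
        by (rule Vector_Spaces.linear_compose[OF polarize_linear polarize_linear])
      show "(?E \<circ> ?F) b \<in> mpoly.span (?b 2)" if "b \<in> ?b 2" for b
        using that by (auto intro!: into0 into2 intro: mpoly.span_base)
      show "v = 0" if "v \<in> mpoly.span (?b 2)" "(?E \<circ> ?F) v = 0" for v
        using that polarize_weight_2_inj[OF A, of v] by (simp add: sp poly_span_def)
    qed
    then show "?b 2 \<subseteq> ?E ` mpoly.span (?b 0)"
      using into2 by fastforce
  qed
  ultimately show ?thesis by (simp add: card_image[OF inj_single_1])
qed

section \<open>Counting monomials\<close>

definition degA :: "nat \<Rightarrow> (coord \<Rightarrow>\<^sub>0 nat) \<Rightarrow> nat" where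
  "degA n m = (\<Sum>i<n. Poly_Mapping.lookup m (coefA i))"

definition degB :: "nat \<Rightarrow> (coord \<Rightarrow>\<^sub>0 nat) \<Rightarrow> nat" where
  "degB n m = (\<Sum>i<n. Poly_Mapping.lookup m (coefB i))"

definition multideg :: "nat \<Rightarrow> (coord \<Rightarrow>\<^sub>0 nat) \<Rightarrow> nat \<times> nat \<times> nat \<times> nat" where
  "multideg n m = (degA n m, degB n m, Poly_Mapping.lookup m vecX, Poly_Mapping.lookup m vecY)"

definition mons :: "nat \<Rightarrow> (nat \<times> nat \<times> nat \<times> nat) set \<Rightarrow> (coord \<Rightarrow>\<^sub>0 nat) set" where
  "mons n T = {m. Poly_Mapping.keys m \<subseteq> all_coords n \<and> multideg n m \<in> T}"

lemma lookup_mons: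
  assumes "m \<in> mons n T" "v \<notin> all_coords n"
  shows "Poly_Mapping.lookup m v = 0"
  using assms unfolding mons_def in_keys_iff[symmetric] by (metis (no_types, lifting) in_keys_iff mem_Collect_eq subsetD)

text \<open>The number of monomials of degree \<open>k\<close> in \<open>n\<close> variables. The
  truncated subtraction is right also for \<open>n = 0\<close>: it gives 1 at \<open>k = 0\<close>
  and 0 otherwise.\<close>

definition num_mons :: "nat \<Rightarrow> nat \<Rightarrow> nat" where
  "num_mons n k = (k + n - 1) choose k"

lemma card_mons_single:
  "card (mons n {(P, Q, X, Y)}) = num_mons n P * num_mons n Q"
proof -
  let ?L = "\<lambda>k. {l :: nat list. length l = n \<and> sum_list l = k}"
  let ?l = "Poly_Mapping.lookup"
  let ?f = "\<lambda>m. (map (\<lambda>i. ?l m (coefA i)) [0..<n], map (\<lambda>i. ?l m (coefB i)) [0..<n])"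
  have sum: "sum_list (map g [0..<n]) = (\<Sum>i<n. g i)" for g :: "nat \<Rightarrow> nat"
    by (simp add: interv_sum_list_conv_sum_set_nat atLeast0LessThan)
  have "bij_betw ?f (mons n {(P, Q, X, Y)}) (?L P \<times> ?L Q)"
    unfolding bij_betw_def
  proof
    show "inj_on ?f (mons n {(P, Q, X, Y)})"
    proof (rule inj_onI)
      fix m m' assume m: "m \<in> mons n {(P, Q, X, Y)}" "m' \<in> mons n {(P, Q, X, Y)}" and e: "?f m = ?f m'"
      show "m = m'"
      proof (rule poly_mapping_eqI)
        fix v
        show "?l m v = ?l m' v"
        proof (cases "v \<in> form_coords n")
          case True
          then show ?thesis using e by (auto simp: form_coords_def)
        next
          case False
          then show ?thesis using m lookup_mons[OF m(1), of v] lookup_mons[OF m(2), of v]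
            by (cases "v \<in> {vecX, vecY}") (auto simp: mons_def multideg_def)
        qed
      qed
    qed
    show "?f ` mons n {(P, Q, X, Y)} = ?L P \<times> ?L Q"
    proof (intro equalityI subsetI)
      fix x assume "x \<in> ?f ` mons n {(P, Q, X, Y)}"
      then show "x \<in> ?L P \<times> ?L Q"
        by (auto simp: mons_def multideg_def sum degA_def degB_def)
    next
      fix x assume "x \<in> ?L P \<times> ?L Q"
      then obtain a b where x: "x = (a, b)" "length a = n" "length b = n" "sum_list a = P" "sum_list b = Q"
        by auto
      define g where "g v = (case v of vecX \<Rightarrow> X | vecY \<Rightarrow> Y
        | coefA i \<Rightarrow> if i < n then a ! i else 0 | coefB i \<Rightarrow> if i < n then b ! i else 0)" for v
      have sub: "{v. g v \<noteq> 0} \<subseteq> all_coords n"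
      proof
        fix v assume "v \<in> {v. g v \<noteq> 0}"
        then show "v \<in> all_coords n"
          by (cases v) (auto simp: g_def form_coords_def split: if_splits)
      qed
      then have "finite {v. g v \<noteq> 0}" by (rule finite_subset) simp
      then have l: "?l (Abs_poly_mapping g) = g" by simp
      have "map (\<lambda>i. g (coefA i)) [0..<n] = a" "map (\<lambda>i. g (coefB i)) [0..<n] = b"
        using x by (auto intro!: nth_equalityI simp: g_def)
      then have "?f (Abs_poly_mapping g) = (a, b)" "degA n (Abs_poly_mapping g) = P"
        "degB n (Abs_poly_mapping g) = Q"
        using x by (auto simp: l degA_def degB_def simp flip: sum)
      moreover have "Poly_Mapping.keys (Abs_poly_mapping g) \<subseteq> all_coords n"
        using sub by (auto simp: in_keys_iff l)
      ultimately show "x \<in> ?f ` mons n {(P, Q, X, Y)}"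
        using x by (intro image_eqI[of _ _ "Abs_poly_mapping g"])
          (auto simp: mons_def multideg_def l g_def)
    qed
  qed
  then have "card (mons n {(P, Q, X, Y)}) = card (?L P \<times> ?L Q)"
    by (rule bij_betw_same_card)
  then show ?thesis
    by (simp add: card_cartesian_product card_length_sum_list num_mons_def)
qed

lemma finite_mons_single: "finite (mons n {(P, Q, X, Y)})"
proof -
  let ?l = "Poly_Mapping.lookup"
  have "finite {f. (\<forall>v. f v \<noteq> (0::nat) \<longrightarrow> v \<in> all_coords n) \<and> (\<forall>v. f v \<le> P + Q + X + Y)}"
  proof -
    have "finite {f. \<forall>v. (v \<in> all_coords n \<longrightarrow> f v \<in> {..P + Q + X + Y}) \<and> (v \<notin> all_coords n \<longrightarrow> f v = 0)}"
      by (rule finite_set_of_finite_funs) auto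
    then show ?thesis by (rule finite_subset[rotated]) auto
  qed
  moreover have "?l ` mons n {(P, Q, X, Y)} \<subseteq>
      {f. (\<forall>v. f v \<noteq> (0::nat) \<longrightarrow> v \<in> all_coords n) \<and> (\<forall>v. f v \<le> P + Q + X + Y)}"
  proof (rule image_subsetI)
    fix m assume m: "m \<in> mons n {(P, Q, X, Y)}"
    have A: "?l m (coefA i) \<le> P" if "i < n" for i
      using m member_le_sum[of i "{..<n}" "\<lambda>i. ?l m (coefA i)"] that
      by (auto simp: mons_def multideg_def degA_def)
    have B: "?l m (coefB i) \<le> Q" if "i < n" for i
      using m member_le_sum[of i "{..<n}" "\<lambda>i. ?l m (coefB i)"] that
      by (auto simp: mons_def multideg_def degB_def)
    have "?l m v \<le> P + Q + X + Y" for v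
    proof (cases "v \<in> all_coords n")
      case True
      then consider "v = vecX" | "v = vecY" | i where "i < n" "v = coefA i" | i where "i < n" "v = coefB i"
        by (auto simp: form_coords_def)
      then show ?thesis
      proof cases
        case 3 then show ?thesis using A[of i] by simp
      next
        case 4 then show ?thesis using B[of i] by simp
      qed (use m in \<open>auto simp: mons_def multideg_def\<close>)
    next
      case False
      then show ?thesis using lookup_mons[OF m] by simp
    qed
    then have "\<forall>v. ?l m v \<le> P + Q + X + Y" by (rule allI)
    moreover have "\<forall>v. ?l m v \<noteq> 0 \<longrightarrow> v \<in> all_coords n"
      using lookup_mons[OF m] by metis
    ultimately show "?l m \<in> {f. (\<forall>v. f v \<noteq> 0 \<longrightarrow> v \<in> all_coords n) \<and> (\<forall>v. f v \<le> P + Q + X + Y)}"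
      by (intro CollectI conjI)
  qed
  ultimately have "finite (?l ` mons n {(P, Q, X, Y)})" by (rule rev_finite_subset)
  then show ?thesis
    by (rule finite_imageD) (auto intro!: inj_onI poly_mapping_eqI)
qed

lemma mons_UN: "mons n T = (\<Union>t\<in>T. mons n {t})"
  by (auto simp: mons_def)

lemma finite_mons: "finite T \<Longrightarrow> finite (mons n T)"
  unfolding mons_UN[of n T] by (rule finite_UN_I) (auto simp: finite_mons_single)

lemma card_mons:
  assumes "finite T"
  shows "card (mons n T) = (\<Sum>(P, Q, X, Y)\<in>T. num_mons n P * num_mons n Q)"
proof -
  have "card (mons n T) = (\<Sum>t\<in>T. card (mons n {t}))"
    unfolding mons_UN[of n T]
  proof (rule card_UN_disjoint)
    show "\<forall>i\<in>T. finite (mons n {i})" by (auto simp: finite_mons_single)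
  qed (use assms in \<open>auto simp: mons_def\<close>)
  also have "\<dots> = (\<Sum>(P, Q, X, Y)\<in>T. num_mons n P * num_mons n Q)"
    by (intro sum.cong) (auto simp: card_mons_single)
  finally show ?thesis .
qed

lemma weight_multideg:
  "weight n m = int (degA n m) - int (degB n m) + int (Poly_Mapping.lookup m vecY) - int (Poly_Mapping.lookup m vecX)"
proof -
  have "vecX \<notin> coefB ` {..<n}" by auto
  moreover have "inj_on coefB {..<n}" by (auto intro: inj_onI)
  ultimately show ?thesis
    by (simp add: weight_def lower_def sum.reindex degA_def degB_def sum_subtractf)
qed

lemma form_degree_multideg:
  assumes "Poly_Mapping.keys m \<subseteq> all_coords n"
  shows "form_degree m = degA n m + degB n m"
proof -
  have "form_degree m = (\<Sum>v\<in>form_coords n. Poly_Mapping.lookup m v)"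
    unfolding form_degree_def using assms
    by (intro sum.mono_neutral_left) (auto simp: in_keys_iff form_coords_def)
  also have "\<dots> = degA n m + degB n m"
  proof -
    have "coefA ` {..<n} \<inter> coefB ` {..<n} = {}" by auto
    moreover have "inj_on coefA {..<n}" "inj_on coefB {..<n}" by (auto intro: inj_onI)
    ultimately show ?thesis
      by (simp add: form_coords_def sum.union_disjoint sum.reindex degA_def degB_def)
  qed
  finally show ?thesis .
qed

text \<open>The form degree is prescribed, the degree in the vector only bounded:
  \<open>D = 0\<close> yields the invariants, and for covariants no bound is known beforehand. A set
  \<open>J\<close> of form degrees instead of a single one also serves the growth estimates, which
  concern inhomogeneous elements.\<close>

definition bidegs :: "nat set \<Rightarrow> nat \<Rightarrow> (nat \<times> nat \<times> nat \<times> nat) set" where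
  "bidegs J D = {(P, Q, X, Y). P + Q \<in> J \<and> X + Y \<le> D}"

lemma finite_bidegs:
  assumes "finite J"
  shows "finite (bidegs J D)"
proof (rule finite_subset)
  have "P + Q \<in> J \<Longrightarrow> P \<le> Max J \<and> Q \<le> Max J" for P Q
    using Max_ge[OF assms, of "P + Q"] by auto
  then show "bidegs J D \<subseteq> {..Max J} \<times> {..Max J} \<times> {..D} \<times> {..D}"
    by (auto simp: bidegs_def)
qed simp

lemma degA_add: "degA n (m + m') = degA n m + degA n m'"
  by (simp add: degA_def lookup_add sum.distrib)

lemma degB_add: "degB n (m + m') = degB n m + degB n m'"
  by (simp add: degB_def lookup_add sum.distrib)

lemma multideg_emon:
  "degA n (emon s) = (if s \<in> coefA ` {..<n} then 1 else 0)"
  "degB n (emon s) = (if s \<in> coefB ` {..<n} then 1 else 0)"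
  by (cases s; force simp: degA_def degB_def lookup_single when_def)+

text \<open>A swap stays within the coordinates of one form or within those of the vector, so
  \<open>P + Q\<close> and \<open>X + Y\<close> do not change.\<close>

lemma swap_closed_mons: "swap_closed n (mons n (bidegs J D))"
  unfolding swap_closed_def
proof (intro ballI impI)
  fix m s
  assume m: "m \<in> mons n (bidegs J D)" and s: "s \<in> all_coords n" "Poly_Mapping.lookup m s \<noteq> 0"
  define k where "k = m - emon s"
  have mk: "m = k + emon s" using emon_diff_add[OF s(2)] by (simp add: k_def)
  have "Poly_Mapping.keys k \<subseteq> Poly_Mapping.keys m"
    by (auto simp: k_def in_keys_iff lookup_minus)
  moreover have "partner s \<in> all_coords n" using s(1) by (cases s) (auto simp: form_coords_def)
  ultimately have "Poly_Mapping.keys (k + emon (partner s)) \<subseteq> all_coords n"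
    using m keys_add[of k "emon (partner s)"] by (auto simp: mons_def)
  moreover have "multideg n (k + emon (partner s)) \<in> bidegs J D"
    using m s(1) unfolding mk
    by (cases s) (auto simp: mons_def multideg_def bidegs_def degA_add degB_add
        multideg_emon[simplified] lookup_add lookup_single when_def form_coords_def image_iff)
  ultimately show "m - emon s + emon (partner s) \<in> mons n (bidegs J D)"
    by (simp add: mons_def k_def)
qed

lemma weight_part_mons:
  "weight_part n (mons n T) w = mons n {(P, Q, X, Y) \<in> T. int P + int Y = int Q + int X + w}"
  by (auto simp: weight_part_def mons_def multideg_def weight_multideg)

text \<open>Counts monomials of form degree \<open>j\<close>, vector degree at most \<open>D\<close>
  and weight \<open>w\<close>; the weight condition is arranged without subtraction.\<close>

definition weight_count :: "nat \<Rightarrow> nat \<Rightarrow> nat \<Rightarrow> nat \<Rightarrow> nat" where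
  "weight_count n j D w = (\<Sum>(P, Q, X, Y)\<in>{(P, Q, X, Y). P + Q = j \<and> X + Y \<le> D \<and> P + Y = Q + X + w}.
      num_mons n P * num_mons n Q)"

lemma card_weight_part_mons:
  assumes J: "finite J"
  shows "card (weight_part n (mons n (bidegs J D)) (int w)) = (\<Sum>j\<in>J. weight_count n j D w)"
proof -
  let ?T = "\<lambda>j. {(P, Q, X, Y). P + Q = j \<and> X + Y \<le> D \<and> P + Y = Q + X + w}"
  have T: "{(P, Q, X, Y) \<in> bidegs J D. int P + int Y = int Q + int X + int w} = (\<Union>j\<in>J. ?T j)"
    by (auto simp: bidegs_def)
  have fin: "finite (?T j)" for j
    by (rule finite_subset[OF _ finite_bidegs[of "{j}" D]]) (auto simp: bidegs_def)
  have "card (weight_part n (mons n (bidegs J D)) (int w)) =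
      (\<Sum>(P, Q, X, Y)\<in>(\<Union>j\<in>J. ?T j). num_mons n P * num_mons n Q)"
    unfolding weight_part_mons T using J fin by (intro card_mons) auto
  also have "\<dots> = (\<Sum>j\<in>J. weight_count n j D w)"
    unfolding weight_count_def using J fin by (intro sum.UNION_disjoint) auto
  finally show ?thesis .
qed

definition inv_space :: "nat \<Rightarrow> nat set \<Rightarrow> nat \<Rightarrow> cpoly set" where
  "inv_space n J D = {p. Poly_Mapping.keys p \<subseteq> mons n (bidegs J D) \<and> SL2_invariant p}"

lemma dim_inv_space:
  assumes "finite J"
  shows "mpoly.dim (inv_space n J D) + (\<Sum>j\<in>J. weight_count n j D 2) = (\<Sum>j\<in>J. weight_count n j D 0)"
  using dim_invariants[OF finite_mons[OF finite_bidegs[OF assms]] swap_closed_mons, of n D]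
    card_weight_part_mons[OF assms, of n D 2] card_weight_part_mons[OF assms, of n D 0]
  by (simp add: inv_space_def mons_def)

text \<open>The Jacobi-Trudi determinant of the two-row shape \<open>(k, k)\<close> at
  \<open>n\<close> ones, with \<open>k = j div 2\<close>. At \<open>j = 0\<close> the truncated
  \<open>j div 2 - 1\<close> would contribute a spurious product, hence the separate case.\<close>

definition inv_dim :: "nat \<Rightarrow> nat \<Rightarrow> nat" where
  "inv_dim n j = (if odd j then 0 else num_mons n (j div 2) ^ 2 -
      (if j = 0 then 0 else num_mons n (j div 2 + 1) * num_mons n (j div 2 - 1)))"

definition cov_dim :: "nat \<Rightarrow> nat \<Rightarrow> nat" where
  "cov_dim n j = num_mons n (j div 2) * num_mons n (j - j div 2)"

lemma weight_count_invariants: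
  "weight_count n j 0 0 = (if odd j then 0 else num_mons n (j div 2) ^ 2)"
  "weight_count n j 0 2 = (if odd j \<or> j = 0 then 0 else num_mons n (j div 2 + 1) * num_mons n (j div 2 - 1))"
proof -
  have "{(P, Q, X, Y). P + Q = j \<and> X + Y \<le> 0 \<and> P + Y = Q + X + (0::nat)} =
      (if odd j then {} else {(j div 2, j div 2, 0, 0)})"
    by (auto; presburger)
  then show "weight_count n j 0 0 = (if odd j then 0 else num_mons n (j div 2) ^ 2)"
    unfolding weight_count_def by (simp add: power2_eq_square)
  have "{(P, Q, X, Y). P + Q = j \<and> X + Y \<le> 0 \<and> P + Y = Q + X + (2::nat)} =
      (if odd j \<or> j = 0 then {} else {(j div 2 + 1, j div 2 - 1, 0, 0)})"
    by (auto; presburger)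
  then show "weight_count n j 0 2 = (if odd j \<or> j = 0 then 0 else num_mons n (j div 2 + 1) * num_mons n (j div 2 - 1))"
    unfolding weight_count_def by simp
qed

text \<open>Trading a factor \<open>vecX\<close> for \<open>vecY\<close> matches the weight 0
  monomials containing \<open>vecX\<close> with the weight 2 monomials containing
  \<open>vecY\<close>. In the remaining ones the other vector exponent is determined by
  \<open>P\<close> and \<open>Q\<close> and is at most \<open>j\<close>, so a bound \<open>D\<close>
  with \<open>j \<le> D\<close> does not cut them off. The two remaining sums differ only in the
  term at \<open>j div 2\<close>.\<close>

lemma weight_count_covariants:
  assumes "j \<le> D"
  shows "weight_count n j D 0 = cov_dim n j + weight_count n j D 2"
proof -
  let ?g = "\<lambda>(P, Q, X :: nat, Y :: nat). num_mons n P * num_mons n Q"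
  let ?h = "\<lambda>P. num_mons n P * num_mons n (j - P)"
  let ?T = "\<lambda>w. {(P, Q, X, Y). P + Q = j \<and> X + Y \<le> D \<and> P + Y = Q + X + w}"
  have fin: "finite (?T w)" for w
    by (rule finite_subset[OF _ finite_bidegs[of "{j}" D]]) (auto simp: bidegs_def)
  have split: "sum ?g (?T w) = sum ?g {t \<in> ?T w. R t} + sum ?g {t \<in> ?T w. \<not> R t}" for w R
  proof -
    have "sum ?g (?T w) = sum ?g ({t \<in> ?T w. R t} \<union> {t \<in> ?T w. \<not> R t})"
      by (rule sum.cong) auto
    also have "\<dots> = sum ?g {t \<in> ?T w. R t} + sum ?g {t \<in> ?T w. \<not> R t}"
      by (intro sum.union_disjoint finite_subset[OF _ fin[of w]]) auto
    finally show ?thesis .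
  qed
  note s0 = split[of 0 "\<lambda>(P, Q, X, Y). X = 0", folded weight_count_def]
  note s2 = split[of 2 "\<lambda>(P, Q, X, Y). Y = 0", folded weight_count_def]
  have 1: "sum ?g {t \<in> ?T 0. \<not> (case t of (P, Q, X, Y) \<Rightarrow> X = 0)} = sum ?g {t \<in> ?T 2. \<not> (case t of (P, Q, X, Y) \<Rightarrow> Y = 0)}"
    by (rule sum.reindex_bij_witness[where i = "\<lambda>(P, Q, X, Y). (P, Q, X + 1, Y - 1)"
          and j = "\<lambda>(P, Q, X, Y). (P, Q, X - 1, Y + 1)"]) auto
  have 2: "sum ?g {t \<in> ?T 0. case t of (P, Q, X, Y) \<Rightarrow> X = 0} = sum ?h {P. 2 * P \<le> j}"
    by (rule sum.reindex_bij_witness[where i = "\<lambda>P. (P, j - P, 0, j - 2 * P)"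
          and j = "\<lambda>(P, Q, X, Y). P"]) (use assms in auto)
  have 3: "sum ?g {t \<in> ?T 2. case t of (P, Q, X, Y) \<Rightarrow> Y = 0} = sum ?h {P. 2 * P + 2 \<le> j}"
    by (rule sum.reindex_bij_witness[where i = "\<lambda>P. (j - P, P, j - 2 * P - 2, 0)"
          and j = "\<lambda>(P, Q, X, Y). Q"]) (use assms in \<open>auto simp: ac_simps\<close>)
  have "{P. 2 * P \<le> j} = insert (j div 2) {P. 2 * P + 2 \<le> j}" by auto
  moreover have "finite {P. 2 * P + 2 \<le> j}" by (rule finite_subset[of _ "{..j}"]) auto
  ultimately have 4: "sum ?h {P. 2 * P \<le> j} = ?h (j div 2) + sum ?h {P. 2 * P + 2 \<le> j}"
    by simp
  show ?thesis unfolding s0 s2 1 2 3 4 by (simp add: cov_dim_def)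
qed

lemma dim_inv_space_0:
  assumes "finite J" shows "mpoly.dim (inv_space n J 0) = (\<Sum>j\<in>J. inv_dim n j)"
proof -
  \<comment> \<open>The inequality is read off from the dimension identity for the single degree
    \<open>j\<close>; it makes the subtraction in \<open>inv_dim\<close> exact.\<close>
  have "weight_count n j 0 2 \<le> weight_count n j 0 0 \<and> inv_dim n j = weight_count n j 0 0 - weight_count n j 0 2" for j
    using dim_inv_space[of "{j}" n 0] by (auto simp: inv_dim_def weight_count_invariants)
  then have "(\<Sum>j\<in>J. inv_dim n j) + (\<Sum>j\<in>J. weight_count n j 0 2) = (\<Sum>j\<in>J. weight_count n j 0 0)"
    unfolding sum.distrib[symmetric] by (intro sum.cong) auto
  with dim_inv_space[OF assms, of n 0] show ?thesis by linarith
qed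

lemma dim_inv_space_large:
  assumes "finite J" "\<And>j. j \<in> J \<Longrightarrow> j \<le> D"
  shows "mpoly.dim (inv_space n J D) = (\<Sum>j\<in>J. cov_dim n j)"
  using dim_inv_space[OF assms(1), of n D] assms(2)
  by (simp add: weight_count_covariants sum.distrib)

section \<open>Dimensions of the graded parts\<close>

context vector_space
begin

lemma independent_card_le_dim':
  assumes "finite W" "V \<subseteq> span W" "B \<subseteq> V" "independent B"
  shows "finite B \<and> card B \<le> dim V"
proof -
  obtain C where C: "B \<subseteq> C" "C \<subseteq> V" "independent C" "V \<subseteq> span C"
    using maximal_independent_subset_extend[OF assms(3,4)] by blast
  have "finite C" using independent_span_bound[OF assms(1) C(3)] C(2) assms(2) by blast
  then show ?thesis
    using card_mono[OF _ C(1)] basis_card_eq_dim[OF C(2,4,3)] finite_subset[OF C(1)] by auto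
qed

lemma subspace_eq_if_dim_eq:
  assumes "finite W" "V \<subseteq> span W" "subspace U" "U \<subseteq> V" "dim U = dim V"
  shows "U = V"
proof (rule ccontr)
  assume "U \<noteq> V"
  then obtain v where v: "v \<in> V" "v \<notin> U" using assms(4) by blast
  obtain C where C: "C \<subseteq> U" "independent C" "U \<subseteq> span C"
    using maximal_independent_subset by blast
  then have "v \<notin> span C" using v(2) span_minimal[OF C(1) assms(3)] by blast
  then have "independent (insert v C)" using C(2) independent_insertI by blast
  moreover have "insert v C \<subseteq> V" using C(1) assms(4) v(1) by blast
  ultimately have "finite (insert v C) \<and> card (insert v C) \<le> dim V"
    by (intro independent_card_le_dim'[OF assms(1,2)])
  moreover have "v \<notin> C" using C(1) v(2) by blast
  ultimately show False using basis_card_eq_dim[OF C(1,3,2)] assms(5) by auto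
qed

text \<open>The hypothesis on indexed families also yields injectivity, through the coefficients 1
  and -1 at two indices with the same value.\<close>

lemma independent_family:
  assumes I: "finite I"
    and *: "\<And>c i. (\<Sum>i\<in>I. scale (c i) (h i)) = 0 \<Longrightarrow> i \<in> I \<Longrightarrow> c i = 0"
  shows "inj_on h I" "independent (h ` I)"
proof -
  show inj: "inj_on h I"
  proof (rule inj_onI, rule ccontr)
    fix i j assume ij: "i \<in> I" "j \<in> I" "h i = h j" "i \<noteq> j"
    let ?c = "\<lambda>k. if k = i then 1 else if k = j then -1 else 0"
    have "(\<Sum>k\<in>I. scale (?c k) (h k)) = (\<Sum>k\<in>{i, j}. scale (?c k) (h k))"
      using I ij by (intro sum.mono_neutral_right) auto
    also have "\<dots> = 0" using ij by simp
    finally show False using *[of ?c i] ij(1) by simp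
  qed
  show "independent (h ` I)"
    unfolding independent_explicit_finite_subsets
  proof (intro allI impI ballI)
    fix T u v assume T: "T \<subseteq> h ` I" "finite T" "(\<Sum>v\<in>T. scale (u v) v) = 0" "v \<in> T"
    let ?c = "\<lambda>i. if h i \<in> T then u (h i) else 0"
    have "(\<Sum>i\<in>I. scale (?c i) (h i)) = (\<Sum>i\<in>{i\<in>I. h i \<in> T}. scale (u (h i)) (h i))"
      using I by (intro sum.mono_neutral_cong_right) auto
    also have "\<dots> = (\<Sum>v\<in>h ` {i\<in>I. h i \<in> T}. scale (u v) v)"
      by (subst sum.reindex) (auto intro: inj_on_subset[OF inj])
    also have "h ` {i\<in>I. h i \<in> T} = T" using T(1) by auto
    finally have "(\<Sum>i\<in>I. scale (?c i) (h i)) = 0" using T(3) by simp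
    moreover obtain i where "i \<in> I" "v = h i" using T(1,4) by auto
    ultimately show "u v = 0" using *[of ?c i] T(4) by simp
  qed
qed

end

section \<open>Invariants and covariants of bounded degree\<close>

lemma cpoly_fun_eq: "cpoly_fun p u = peval (coord_value u) p"
  by (simp add: cpoly_fun_def)

lemma SL2_invariant_add: "SL2_invariant p \<Longrightarrow> SL2_invariant q \<Longrightarrow> SL2_invariant (p + q)"
  by (simp add: SL2_invariant_def cpoly_fun_eq peval_add)

lemma SL2_invariant_mult: "SL2_invariant p \<Longrightarrow> SL2_invariant q \<Longrightarrow> SL2_invariant (p * q)"
  by (simp add: SL2_invariant_def cpoly_fun_eq peval_mult)

lemma SL2_invariant_scale: "SL2_invariant p \<Longrightarrow> SL2_invariant (mpoly_scale c p)"
  by (simp add: SL2_invariant_def cpoly_fun_eq peval_scale)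

lemma SL2_invariant_1: "SL2_invariant 1"
  by (simp add: SL2_invariant_def cpoly_fun_eq)

lemma SL2_invariant_0: "SL2_invariant 0"
  by (simp add: SL2_invariant_def cpoly_fun_eq)

lemma subspace_inv_space: "mpoly.subspace (inv_space n J D)"
proof (rule mpoly.subspaceI)
  fix x y assume "x \<in> inv_space n J D" "y \<in> inv_space n J D"
  then show "x + y \<in> inv_space n J D"
    using keys_add[of x y] by (auto simp: inv_space_def SL2_invariant_add)
next
  fix c x assume "x \<in> inv_space n J D"
  then show "mpoly_scale c x \<in> inv_space n J D"
    by (auto simp: inv_space_def SL2_invariant_scale in_keys_iff)
qed (simp add: inv_space_def SL2_invariant_0)

lemma inv_space_subset_span:
  "inv_space n J D \<subseteq> mpoly.span ((\<lambda>m. Poly_Mapping.single m 1) ` mons n (bidegs J D))"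
  by (auto simp: poly_span_eq poly_span_def inv_space_def)

lemma finite_singles_mons:
  "finite J \<Longrightarrow> finite ((\<lambda>m. Poly_Mapping.single m (1::complex)) ` mons n (bidegs J D))"
  by (intro finite_imageI finite_mons finite_bidegs)

text \<open>The dimension does not depend on the cutoff once it exceeds all form degrees in
  \<open>J\<close>. So raising the cutoff adds no invariants: the order of a covariant is bounded by
  its form degree.\<close>

lemma inv_space_large_eq:
  assumes J: "finite J" "\<And>j. j \<in> J \<Longrightarrow> j \<le> D" and D: "D \<le> D'"
  shows "inv_space n J D' = inv_space n J D"
proof (rule mpoly.subspace_eq_if_dim_eq[symmetric, OF finite_singles_mons[OF J(1)] inv_space_subset_span subspace_inv_space])
  show "inv_space n J D \<subseteq> inv_space n J D'"
    using D by (auto simp: inv_space_def mons_def bidegs_def)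
  have "j \<le> D'" if "j \<in> J" for j using J(2)[OF that] D by simp
  then show "mpoly.dim (inv_space n J D) = mpoly.dim (inv_space n J D')"
    by (simp add: dim_inv_space_large J)
qed

lemma keys_subset_mons_iff:
  "Poly_Mapping.keys p \<subseteq> mons n (bidegs J D) \<longleftrightarrow> mpoly_vars p \<subseteq> all_coords n \<and>
     (\<forall>m\<in>Poly_Mapping.keys p. form_degree m \<in> J \<and>
        Poly_Mapping.lookup m vecX + Poly_Mapping.lookup m vecY \<le> D)"
  (is "?l \<longleftrightarrow> ?r")
proof -
  have *: "m \<in> mons n (bidegs J D) \<longleftrightarrow> Poly_Mapping.keys m \<subseteq> all_coords n \<and> form_degree m \<in> J \<and>
        Poly_Mapping.lookup m vecX + Poly_Mapping.lookup m vecY \<le> D" for m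
    by (auto simp: mons_def bidegs_def multideg_def form_degree_multideg)
  show ?thesis unfolding subset_iff[of "Poly_Mapping.keys p"] * mpoly_vars_def by blast
qed

lemma joint_invariants_degrees:
  "{p \<in> joint_invariants n. \<forall>m\<in>Poly_Mapping.keys p. form_degree m \<in> J} = inv_space n J 0"
proof -
  have "mpoly_vars p \<subseteq> form_coords n \<longleftrightarrow> mpoly_vars p \<subseteq> all_coords n \<and>
    (\<forall>m\<in>Poly_Mapping.keys p. Poly_Mapping.lookup m vecX + Poly_Mapping.lookup m vecY \<le> 0)" for p :: cpoly
  proof -
    have "Poly_Mapping.keys m \<subseteq> form_coords n \<longleftrightarrow> Poly_Mapping.keys m \<subseteq> all_coords n \<and>
        Poly_Mapping.lookup m vecX + Poly_Mapping.lookup m vecY \<le> 0" for m :: "coord \<Rightarrow>\<^sub>0 nat"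
    proof -
      have "Poly_Mapping.lookup m vecX + Poly_Mapping.lookup m vecY \<le> 0 \<longleftrightarrow>
          vecX \<notin> Poly_Mapping.keys m \<and> vecY \<notin> Poly_Mapping.keys m"
        by (auto simp: in_keys_iff)
      moreover have "vecX \<notin> form_coords n" "vecY \<notin> form_coords n" by (auto simp: form_coords_def)
      ultimately show ?thesis by blast
    qed
    then show ?thesis unfolding mpoly_vars_def by blast
  qed
  then show ?thesis
    unfolding joint_invariants_def inv_space_def keys_subset_mons_iff by blast
qed

lemma joint_covariants_degrees:
  assumes "finite J" "\<And>j. j \<in> J \<Longrightarrow> j \<le> D"
  shows "{p \<in> joint_covariants n. \<forall>m\<in>Poly_Mapping.keys p. form_degree m \<in> J} = inv_space n J D"
proof (intro equalityI subsetI)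
  fix p assume p: "p \<in> {p \<in> joint_covariants n. \<forall>m\<in>Poly_Mapping.keys p. form_degree m \<in> J}"
  \<comment> \<open>A single polynomial has some vector degree, so it satisfies a cutoff depending
    on it; stabilization then brings the cutoff down to \<open>D\<close>.\<close>
  define D' where "D' = D + (\<Sum>m\<in>Poly_Mapping.keys p. Poly_Mapping.lookup m vecX + Poly_Mapping.lookup m vecY)"
  have "Poly_Mapping.lookup m vecX + Poly_Mapping.lookup m vecY \<le> D'" if "m \<in> Poly_Mapping.keys p" for m
    using member_le_sum[OF that, of "\<lambda>m. Poly_Mapping.lookup m vecX + Poly_Mapping.lookup m vecY"]
    by (simp add: D'_def)
  then have "p \<in> inv_space n J D'"
    using p unfolding joint_covariants_def inv_space_def keys_subset_mons_iff by blast
  then show "p \<in> inv_space n J D"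
    using inv_space_large_eq[OF assms, of D'] by (simp add: D'_def)
qed (auto simp: joint_covariants_def inv_space_def keys_subset_mons_iff)

lemma dim_graded_invariants: "mpoly.dim (graded_part (joint_invariants n) j) = inv_dim n j"
proof -
  have "graded_part (joint_invariants n) j = inv_space n {j} 0"
    by (simp add: graded_part_def flip: joint_invariants_degrees)
  then show ?thesis by (simp add: dim_inv_space_0)
qed

lemma dim_graded_covariants: "mpoly.dim (graded_part (joint_covariants n) j) = cov_dim n j"
proof -
  have "graded_part (joint_covariants n) j = inv_space n {j} j"
    using joint_covariants_degrees[of "{j}" j n] by (simp add: graded_part_def)
  then show ?thesis using dim_inv_space_large[of "{j}" j n] by simp
qed

text \<open>Numerators and denominators of algebraically independent elements need not be
  homogeneous, so the whole part of degree at most \<open>M\<close> is bounded.\<close>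

lemma card_independent_invariants:
  assumes "mpoly.independent H" "H \<subseteq> joint_invariants n"
    "\<And>p m. p \<in> H \<Longrightarrow> m \<in> Poly_Mapping.keys p \<Longrightarrow> form_degree m \<le> M"
  shows "card H \<le> (\<Sum>j\<le>M. inv_dim n j)"
proof -
  have "H \<subseteq> inv_space n {..M} 0"
    using assms(2,3) by (auto simp flip: joint_invariants_degrees)
  from mpoly.independent_card_le_dim'[OF finite_singles_mons inv_space_subset_span this assms(1)]
  show ?thesis by (simp add: dim_inv_space_0)
qed

lemma card_independent_covariants:
  assumes "mpoly.independent H" "H \<subseteq> joint_covariants n"
    "\<And>p m. p \<in> H \<Longrightarrow> m \<in> Poly_Mapping.keys p \<Longrightarrow> form_degree m \<le> M"
  shows "card H \<le> (\<Sum>j\<le>M. cov_dim n j)"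
proof -
  have "H \<subseteq> inv_space n {..M} M"
    using assms(2,3) joint_covariants_degrees[of "{..M}" M n] by auto
  from mpoly.independent_card_le_dim'[OF finite_singles_mons inv_space_subset_span this assms(1)]
  show ?thesis using dim_inv_space_large[of "{..M}" M n] by simp
qed

section \<open>Transcendence degrees\<close>

definition emb :: "'a::idom \<Rightarrow> 'a fract" where "emb a = Fract a 1"

lemma emb_simps [simp]: "emb 0 = 0" "emb 1 = 1" "emb (a + b) = emb a + emb b" "emb (a * b) = emb a * emb b"
  by (simp_all add: emb_def Zero_fract_def One_fract_def)

lemma emb_power: "emb (a ^ k) = emb a ^ k"
  by (induction k) auto

lemma emb_sum: "emb (sum f A) = (\<Sum>x\<in>A. emb (f x))"
  by (induction A rule: infinite_finite_induct) auto

lemma emb_prod: "emb (prod f A) = (\<Prod>x\<in>A. emb (f x))"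
  by (induction A rule: infinite_finite_induct) auto

lemma emb_eq_iff [simp]: "emb a = emb b \<longleftrightarrow> a = b"
  by (simp add: emb_def eq_fract)

lemma emb_eq_0_iff [simp]: "emb a = 0 \<longleftrightarrow> a = 0"
  using emb_eq_iff[of a 0] by simp

lemma Fract_mult_emb: "b \<noteq> 0 \<Longrightarrow> Fract a b * emb b = emb a"
  by (simp add: emb_def eq_fract)

lemma const_fract_emb: "const_fract c = emb (mpoly_const c)"
  by (simp add: const_fract_def emb_def)

lemma form_degree_add: "form_degree (m + m') = form_degree m + form_degree m'"
proof -
  have *: "form_degree k = (\<Sum>v\<in>V. Poly_Mapping.lookup k v)"
    if "finite V" "Poly_Mapping.keys k - {vecX, vecY} \<subseteq> V" "V \<inter> {vecX, vecY} = {}" for k V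
    unfolding form_degree_def using that by (intro sum.mono_neutral_left) (auto simp: in_keys_iff)
  let ?V = "Poly_Mapping.keys m \<union> Poly_Mapping.keys m' - {vecX, vecY}"
  have "Poly_Mapping.keys (m + m') - {vecX, vecY} \<subseteq> ?V" using keys_add[of m m'] by auto
  then have "form_degree (m + m') = (\<Sum>v\<in>?V. Poly_Mapping.lookup (m + m') v)"
    by (intro *) auto
  also have "\<dots> = form_degree m + form_degree m'"
    by (simp add: lookup_add sum.distrib) (subst (1 2) *[of ?V], auto)
  finally show ?thesis .
qed

definition form_degree_le :: "cpoly \<Rightarrow> nat \<Rightarrow> bool" where
  "form_degree_le p d \<longleftrightarrow> (\<forall>m\<in>Poly_Mapping.keys p. form_degree m \<le> d)"

lemma form_degree_le_mult:
  assumes "form_degree_le p d" "form_degree_le q e"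
  shows "form_degree_le (p * q) (d + e)"
  unfolding form_degree_le_def
proof
  fix m assume "m \<in> Poly_Mapping.keys (p * q)"
  then obtain a b where "a \<in> Poly_Mapping.keys p" "b \<in> Poly_Mapping.keys q" "m = a + b"
    using keys_mult[of p q] by auto
  then show "form_degree m \<le> d + e"
    using assms by (auto simp: form_degree_le_def form_degree_add intro: add_mono)
qed

lemma form_degree_le_1: "form_degree_le 1 d"
  by (simp add: form_degree_le_def form_degree_def)

lemma form_degree_le_power: "form_degree_le p d \<Longrightarrow> form_degree_le (p ^ k) (k * d)"
  by (induction k) (auto simp: form_degree_le_1 form_degree_le_mult)

lemma form_degree_le_prod:
  "finite S \<Longrightarrow> (\<And>s. s \<in> S \<Longrightarrow> form_degree_le (f s) d) \<Longrightarrow> form_degree_le (prod f S) (card S * d)"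
  by (induction S rule: finite_induct) (auto simp: form_degree_le_1 form_degree_le_mult)

lemma form_degree_le_mono: "form_degree_le p d \<Longrightarrow> d \<le> e \<Longrightarrow> form_degree_le p e"
  by (auto simp: form_degree_le_def)

lemma ex_form_degree_le: "\<exists>d. form_degree_le p d"
  unfolding form_degree_le_def
  by (rule exI[of _ "\<Sum>m\<in>Poly_Mapping.keys p. form_degree m"]) (auto intro: member_le_sum)

text \<open>Otherwise the left side outgrows the right. The factor \<open>K\<close> only affects the
  constant, since \<open>K * N + 1\<close> is at most \<open>(K + 1) * (N + 1)\<close>.\<close>

lemma power_le_imp_le_exponent:
  fixes C :: real
  assumes "\<And>N :: nat. real (N + 1) ^ m \<le> C * real (K * N + 1) ^ r"
  shows "m \<le> r"
proof (rule ccontr)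
  assume "\<not> m \<le> r"
  then obtain d where m: "m = r + Suc d" using less_imp_Suc_add[of r m] by auto
  have C: "C \<ge> 0" using assms[of 0] by simp
  obtain N :: nat where N: "real N > C * real (K + 1) ^ r" using reals_Archimedean2 by blast
  have "real (N + 1) ^ r * real (N + 1) \<le> real (N + 1) ^ r * real (N + 1) ^ Suc d"
    by (intro mult_left_mono) auto
  also have "\<dots> = real (N + 1) ^ m" by (simp add: m power_add)
  also have "\<dots> \<le> C * real (K * N + 1) ^ r" by (rule assms)
  also have "\<dots> \<le> C * real ((K + 1) * (N + 1)) ^ r"
    by (intro mult_left_mono power_mono C) (auto simp: algebra_simps simp flip: of_nat_mult of_nat_add)
  also have "\<dots> = real (N + 1) ^ r * (C * real (K + 1) ^ r)"
    by (simp only: of_nat_mult power_mult_distrib mult_ac)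
  finally have "real (N + 1) \<le> C * real (K + 1) ^ r"
    by (subst (asm) mult_le_cancel_left_pos) auto
  with N show False by simp
qed

text \<open>For \<open>s = a s / b s\<close> the \<open>(N + 1) ^ card S\<close> products over \<open>S\<close> of the
  \<open>a s ^ \<mu> s * b s ^ (N - \<mu> s)\<close> with \<open>\<mu> s \<le> N\<close> are linearly independent, and their form degree grows only linearly in \<open>N\<close>.\<close>

lemma alg_independent_card_le:
  fixes R :: "cpoly set" and C :: real
  assumes R: "1 \<in> R" "\<And>p q. p \<in> R \<Longrightarrow> q \<in> R \<Longrightarrow> p * q \<in> R"
    and growth: "\<And>H M. mpoly.independent H \<Longrightarrow> H \<subseteq> R \<Longrightarrow> (\<And>p. p \<in> H \<Longrightarrow> form_degree_le p M) \<Longrightarrow>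
      real (card H) \<le> C * real (M + 1) ^ r"
    and S: "S \<subseteq> quotient_field R" "finite S" "alg_independent const_fract S"
  shows "card S \<le> r"
proof -
  have "\<forall>s\<in>S. \<exists>ab. fst ab \<in> R \<and> snd ab \<in> R \<and> snd ab \<noteq> 0 \<and> s = Fract (fst ab) (snd ab)"
    using S(1) by (fastforce simp: quotient_field_def)
  then obtain ab where ab: "\<forall>s\<in>S. fst (ab s) \<in> R \<and> snd (ab s) \<in> R \<and> snd (ab s) \<noteq> 0 \<and> s = Fract (fst (ab s)) (snd (ab s))"
    by (rule bchoice[THEN exE])
  define a b where "a s = fst (ab s)" and "b s = snd (ab s)" for s
  have aR: "a s \<in> R" and bR: "b s \<in> R" and b0: "b s \<noteq> 0" and s_eq: "s * emb (b s) = emb (a s)"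
    if "s \<in> S" for s
    using ab that Fract_mult_emb[of "b s" "a s"] by (auto simp: a_def b_def)
  have powR: "p ^ k \<in> R" if "p \<in> R" for p k
    using that by (induction k) (auto intro: R)
  have prodR: "prod f T \<in> R" if "finite T" "\<And>s. s \<in> T \<Longrightarrow> f s \<in> R" for f and T :: "cpoly fract set"
    using that by (induction T rule: finite_induct) (auto intro: R)
  obtain d where d: "form_degree_le (a s) d" "form_degree_le (b s) d" if "s \<in> S" for s
  proof -
    have "\<exists>e. \<forall>s. form_degree_le (a s) (e s)" "\<exists>e. \<forall>s. form_degree_le (b s) (e s)"
      by (intro choice allI ex_form_degree_le)+
    then obtain e e' where e: "\<And>s. form_degree_le (a s) (e s)" "\<And>s. form_degree_le (b s) (e' s)"
      by blast
    let ?d = "\<Sum>s\<in>S. e s + e' s"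
    have le: "e s \<le> ?d" "e' s \<le> ?d" if "s \<in> S" for s
      using member_le_sum[OF that, of "\<lambda>s. e s + e' s"] S(2) by auto
    show thesis
      by (rule that[of ?d]) (rule form_degree_le_mono[OF e(1) le(1)] form_degree_le_mono[OF e(2) le(2)], assumption)+
  qed
  have "real (N + 1) ^ card S \<le> C * real (card S * d * N + 1) ^ r" for N
  proof -
    define I where "I = PiE S (\<lambda>_. {..N})"
    define h where "h \<mu> = (\<Prod>s\<in>S. a s ^ \<mu> s * b s ^ (N - \<mu> s))" for \<mu>
    have finI: "finite I" using S(2) by (auto simp: I_def intro: finite_PiE)
    have \<mu>N: "\<mu> s \<le> N" if "\<mu> \<in> I" "s \<in> S" for \<mu> s
      using that by (auto simp: I_def)
    \<comment> \<open>Divided by the common denominator \<open>?B\<close>, a linear relation between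
      the \<open>h \<mu>\<close> becomes a polynomial relation between the elements of
      \<open>S\<close>, whose polynomial \<open>p\<close> has the \<open>c \<mu>\<close> as
      coefficients.\<close>
    have ind: "c \<mu>\<^sub>0 = 0" if z: "(\<Sum>\<mu>\<in>I. mpoly_scale (c \<mu>) (h \<mu>)) = 0" and \<mu>\<^sub>0: "\<mu>\<^sub>0 \<in> I" for c \<mu>\<^sub>0
    proof -
      define mo :: "(cpoly fract \<Rightarrow> nat) \<Rightarrow> cpoly fract \<Rightarrow>\<^sub>0 nat"
        where "mo \<mu> = Abs_poly_mapping (\<lambda>s. if s \<in> S then \<mu> s else 0)" for \<mu>
      have lmo: "Poly_Mapping.lookup (mo \<mu>) = (\<lambda>s. if s \<in> S then \<mu> s else 0)" for \<mu>
      proof -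
        have "finite {s. (if s \<in> S then \<mu> s else 0) \<noteq> 0}" by (rule finite_subset[OF _ S(2)]) auto
        then show ?thesis by (simp add: mo_def)
      qed
      have kmo: "Poly_Mapping.keys (mo \<mu>) \<subseteq> S" for \<mu>
        by (auto simp: in_keys_iff lmo split: if_splits)
      have inj: "inj_on mo I"
      proof (rule inj_onI)
        fix \<mu> \<nu> assume *: "\<mu> \<in> I" "\<nu> \<in> I" "mo \<mu> = mo \<nu>"
        show "\<mu> = \<nu>"
        proof (rule PiE_ext[of \<mu> S "\<lambda>_. {..N}" \<nu>])
          fix s assume "s \<in> S"
          then show "\<mu> s = \<nu> s" using lmo[of \<mu>] lmo[of \<nu>] *(3) by (metis (full_types))
        qed (use * in \<open>auto simp: I_def\<close>)
      qed
      define p where "p = (\<Sum>\<mu>\<in>I. Poly_Mapping.single (mo \<mu>) (c \<mu>))"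
      have lp: "Poly_Mapping.lookup p (mo \<mu>) = c \<mu>" if "\<mu> \<in> I" for \<mu>
      proof -
        have "Poly_Mapping.lookup p (mo \<mu>) = (\<Sum>\<nu>\<in>I. if \<nu> = \<mu> then c \<nu> else 0)"
          unfolding p_def lookup_sum
          using inj that by (intro sum.cong) (auto simp: lookup_single when_def dest: inj_onD)
        then show ?thesis using finI that by simp
      qed
      have kp: "Poly_Mapping.keys p \<subseteq> mo ` I"
      proof
        fix m assume "m \<in> Poly_Mapping.keys p"
        then obtain \<mu> where "\<mu> \<in> I" "Poly_Mapping.lookup (Poly_Mapping.single (mo \<mu>) (c \<mu>)) m \<noteq> 0"
          unfolding p_def in_keys_iff lookup_sum by (meson sum.neutral)
        then show "m \<in> mo ` I" by (auto simp: lookup_single when_def split: if_splits)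
      qed
      let ?B = "\<Prod>s\<in>S. b s ^ N"
      have mv: "monom_val (\<lambda>s. s) (mo \<mu>) * emb ?B = emb (h \<mu>)" if "\<mu> \<in> I" for \<mu>
      proof -
        have "monom_val (\<lambda>s. s) (mo \<mu>) * emb ?B = (\<Prod>s\<in>S. s ^ \<mu> s * emb (b s) ^ N)"
          by (simp add: monom_val_superset[OF S(2) kmo] lmo emb_prod emb_power prod.distrib)
        also have "\<dots> = (\<Prod>s\<in>S. emb (a s) ^ \<mu> s * emb (b s) ^ (N - \<mu> s))"
        proof (rule prod.cong[OF refl])
          fix s assume s: "s \<in> S"
          have "emb (b s) ^ N = emb (b s) ^ \<mu> s * emb (b s) ^ (N - \<mu> s)"
            using \<mu>N[OF that s] by (simp flip: power_add)
          then show "s ^ \<mu> s * emb (b s) ^ N = emb (a s) ^ \<mu> s * emb (b s) ^ (N - \<mu> s)"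
            by (simp add: power_mult_distrib flip: s_eq[OF s])
        qed
        also have "\<dots> = emb (h \<mu>)" by (simp add: h_def emb_prod emb_power)
        finally show ?thesis .
      qed
      have c0: "const_fract 0 = 0" by (simp add: const_fract_emb mpoly_const_def)
      have "mpoly_eval const_fract (\<lambda>s. s) p * emb ?B =
          (\<Sum>\<mu>\<in>I. const_fract (c \<mu>) * (monom_val (\<lambda>s. s) (mo \<mu>) * emb ?B))"
        by (subst mpoly_eval_superset[where \<iota> = const_fract and K = "mo ` I", OF _ kp c0])
           (simp_all add: finI sum.reindex[OF inj] lp sum_distrib_right mult.assoc cong: sum.cong)
      also have "\<dots> = (\<Sum>\<mu>\<in>I. const_fract (c \<mu>) * emb (h \<mu>))"
        by (simp add: mv cong: sum.cong)
      also have "\<dots> = emb (\<Sum>\<mu>\<in>I. mpoly_scale (c \<mu>) (h \<mu>))"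
        by (simp add: emb_sum const_fract_emb mpoly_scale_def)
      also have "\<dots> = 0" by (simp add: z)
      finally have "mpoly_eval const_fract (\<lambda>s. s) p = 0"
        using b0 S(2) by simp
      moreover have "mpoly_vars p \<subseteq> S"
        using kp kmo unfolding mpoly_vars_def by blast
      ultimately have "p = 0" using S(3) unfolding alg_independent_def by blast
      then show "c \<mu>\<^sub>0 = 0" using lp[OF \<mu>\<^sub>0] by simp
    qed
    have hd: "form_degree_le (h \<mu>) (card S * d * N)" if "\<mu> \<in> I" for \<mu>
    proof -
      have "form_degree_le (a s ^ \<mu> s * b s ^ (N - \<mu> s)) (d * N)" if s: "s \<in> S" for s
      proof (rule form_degree_le_mono)
        show "form_degree_le (a s ^ \<mu> s * b s ^ (N - \<mu> s)) (\<mu> s * d + (N - \<mu> s) * d)"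
          by (intro form_degree_le_mult form_degree_le_power d s)
        show "\<mu> s * d + (N - \<mu> s) * d \<le> d * N"
          using \<mu>N[OF \<open>\<mu> \<in> I\<close> s] by (simp flip: distrib_right)
      qed
      from form_degree_le_prod[OF S(2) this] show ?thesis by (simp add: h_def mult.assoc)
    qed
    have hR: "h \<mu> \<in> R" for \<mu>
      unfolding h_def using S(2) by (intro prodR R powR aR bR) auto
    have fam: "inj_on h I" "mpoly.independent (h ` I)"
      by (rule mpoly.independent_family[OF finI], erule (1) ind)+
    have "real (N + 1) ^ card S = real (card I)"
      using S(2) by (simp add: I_def card_PiE)
    also have "card I = card (h ` I)" using card_image[OF fam(1)] by simp
    also have "real \<dots> \<le> C * real (card S * d * N + 1) ^ r"
      using hd hR by (intro growth fam(2)) auto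
    finally show ?thesis .
  qed
  then show ?thesis by (rule power_le_imp_le_exponent)
qed

text \<open>If the \<open>g i\<close> jointly attain all nonvanishing tuples of values, a polynomial
  relation between them vanishes at every nonvanishing point and is therefore trivial.\<close>

lemma alg_independent_family:
  fixes g :: "'i \<Rightarrow> cpoly"
  assumes I: "finite I"
    and val: "\<And>c :: 'i \<Rightarrow> complex. (\<forall>i. c i \<noteq> 0) \<Longrightarrow> \<exists>x. \<forall>i\<in>I. peval x (g i) = c i"
  shows "inj_on (\<lambda>i. emb (g i)) I" "alg_independent const_fract ((\<lambda>i. emb (g i)) ` I)"
proof -
  show inj: "inj_on (\<lambda>i. emb (g i)) I"
  proof (rule inj_onI, rule ccontr)
    fix i j assume ij: "i \<in> I" "j \<in> I" "emb (g i) = emb (g j)" "i \<noteq> j"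
    have "\<forall>k. (if k = i then 1 else 2) \<noteq> (0 :: complex)" by simp
    from val[OF this] obtain x where x: "\<forall>k\<in>I. peval x (g k) = (if k = i then 1 else 2)" ..
    from ij have "g i = g j" by simp
    with ij x show False by (metis one_eq_numeral_iff semiring_norm(85))
  qed
  let ?S = "(\<lambda>i. emb (g i)) ` I"
  show "alg_independent const_fract ?S"
    unfolding alg_independent_def
  proof (intro allI impI; elim conjE)
    fix p :: "(cpoly fract, complex) mpoly"
    assume vars: "mpoly_vars p \<subseteq> ?S" and z: "mpoly_eval const_fract (\<lambda>s. s) p = 0"
    \<comment> \<open>The indeterminates of \<open>p\<close> are field elements; \<open>k\<close>
      returns to indices so that the relation can be pulled back to the polynomial \<open>q\<close>
      and evaluated.\<close>
    define k where "k = the_inv_into I (\<lambda>i. emb (g i))"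
    have k: "k s \<in> I" "emb (g (k s)) = s" if "s \<in> ?S" for s
      using that f_the_inv_into_f[OF inj that] the_inv_into_into[OF inj that subset_refl]
      by (auto simp: k_def)
    define q where "q = (\<Sum>m\<in>Poly_Mapping.keys p. mpoly_const (Poly_Mapping.lookup p m) *
      (\<Prod>s\<in>Poly_Mapping.keys m. g (k s) ^ Poly_Mapping.lookup m s))"
    have "emb q = mpoly_eval const_fract (\<lambda>s. s) p"
      unfolding q_def mpoly_eval_def emb_sum
    proof (rule sum.cong[OF refl])
      fix m assume m: "m \<in> Poly_Mapping.keys p"
      have "(\<Prod>s\<in>Poly_Mapping.keys m. emb (g (k s)) ^ Poly_Mapping.lookup m s) =
          (\<Prod>s\<in>Poly_Mapping.keys m. s ^ Poly_Mapping.lookup m s)"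
      proof (rule prod.cong[OF refl])
        fix s assume "s \<in> Poly_Mapping.keys m"
        then have "s \<in> ?S" using vars m by (auto simp: mpoly_vars_def)
        then show "emb (g (k s)) ^ Poly_Mapping.lookup m s = s ^ Poly_Mapping.lookup m s"
          by (simp only: k(2))
      qed
      then show "emb (mpoly_const (Poly_Mapping.lookup p m) *
            (\<Prod>s\<in>Poly_Mapping.keys m. g (k s) ^ Poly_Mapping.lookup m s)) =
          const_fract (Poly_Mapping.lookup p m) * (\<Prod>s\<in>Poly_Mapping.keys m. s ^ Poly_Mapping.lookup m s)"
        by (simp add: const_fract_emb emb_prod emb_power)
    qed
    with z have q0: "q = 0" by simp
    show "p = 0"
    proof (rule peval_eq_0_imp_0)
      fix y :: "cpoly fract \<Rightarrow> complex" assume "\<forall>v. y v \<noteq> 0"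
      then obtain x where x: "\<forall>i\<in>I. peval x (g i) = y (emb (g i))"
        using val[of "\<lambda>i. y (emb (g i))"] by auto
      have "peval y p = peval (\<lambda>s. peval x (g (k s))) p"
      proof (rule peval_cong)
        fix s assume "s \<in> mpoly_vars p"
        then have "s \<in> ?S" using vars by blast
        then show "y s = peval x (g (k s))" using x k[of s] by metis
      qed
      also have "\<dots> = peval x q"
        by (simp add: q_def peval_sum peval_mult peval_prod peval_power)
           (simp add: mpoly_eval_def)
      finally show "peval y p = 0" by (simp add: q0)
    qed
  qed
qed

text \<open>The growth exponent is \<open>card I\<close> itself: growth bounds every independent set
  by the size that the family attains.\<close>

lemma trdeg_eqI:
  fixes R :: "cpoly set" and C :: real and g :: "'i \<Rightarrow> cpoly"
  assumes R: "1 \<in> R" "\<And>p q. p \<in> R \<Longrightarrow> q \<in> R \<Longrightarrow> p * q \<in> R"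
    and growth: "\<And>H M. mpoly.independent H \<Longrightarrow> H \<subseteq> R \<Longrightarrow> (\<And>p. p \<in> H \<Longrightarrow> form_degree_le p M) \<Longrightarrow>
      real (card H) \<le> C * real (M + 1) ^ card I"
    and I: "finite I" "\<And>i. i \<in> I \<Longrightarrow> g i \<in> R"
    and val: "\<And>c :: 'i \<Rightarrow> complex. (\<forall>i. c i \<noteq> 0) \<Longrightarrow> \<exists>x. \<forall>i\<in>I. peval x (g i) = c i"
  shows "trdeg const_fract (quotient_field R) = card I"
  unfolding trdeg_def
proof (rule Greatest_equality)
  let ?S = "(\<lambda>i. emb (g i)) ` I"
  note fam = alg_independent_family[OF I(1) val]
  have "?S \<subseteq> quotient_field R"
    using I(2) R(1) by (force simp: quotient_field_def emb_def)
  then show "\<exists>S\<subseteq>quotient_field R. finite S \<and> card S = card I \<and> alg_independent const_fract S"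
    using fam I(1) card_image[OF fam(1)] by blast
next
  fix y assume "\<exists>S\<subseteq>quotient_field R. finite S \<and> card S = y \<and> alg_independent const_fract S"
  then show "y \<le> card I" using alg_independent_card_le[OF R growth] by blast
qed

section \<open>Brackets and values of forms as independent elements\<close>

definition cvar :: "coord \<Rightarrow> cpoly" where "cvar v = Poly_Mapping.single (emon v) 1"

lemma peval_cvar [simp]: "peval x (cvar v) = x v"
  by (simp add: cvar_def)

lemma mpoly_vars_mult: "mpoly_vars (p * q) \<subseteq> mpoly_vars p \<union> mpoly_vars q"
proof
  fix v assume "v \<in> mpoly_vars (p * q)"
  then obtain m where m: "m \<in> Poly_Mapping.keys (p * q)" "v \<in> Poly_Mapping.keys m" by (auto simp: mpoly_vars_def)
  then obtain a b where "a \<in> Poly_Mapping.keys p" "b \<in> Poly_Mapping.keys q" "m = a + b"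
    using keys_mult[of p q] by auto
  then show "v \<in> mpoly_vars p \<union> mpoly_vars q"
    using m(2) keys_add[of a b] by (auto simp: mpoly_vars_def)
qed

lemma mpoly_vars_add: "mpoly_vars (p + q) \<subseteq> mpoly_vars p \<union> mpoly_vars q"
  using keys_add[of p q] by (auto simp: mpoly_vars_def)

lemma mpoly_vars_diff: "mpoly_vars (p - q :: cpoly) \<subseteq> mpoly_vars p \<union> mpoly_vars q"
  using keys_diff[of p q] by (auto simp: mpoly_vars_def)

lemma mpoly_vars_cvar_mult: "mpoly_vars (cvar u * cvar v) \<subseteq> {u, v}"
  using mpoly_vars_mult[of "cvar u" "cvar v"] by (auto simp: mpoly_vars_def cvar_def)

lemma peval_diff: "peval x (p - q :: cpoly) = peval x p - peval x q"
  using peval_add[of x "p - q" q] by simp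

definition bracket :: "nat \<Rightarrow> nat \<Rightarrow> cpoly" where
  "bracket i j = cvar (coefA i) * cvar (coefB j) - cvar (coefA j) * cvar (coefB i)"

definition form_value :: "nat \<Rightarrow> cpoly" where
  "form_value i = cvar (coefA i) * cvar vecX + cvar (coefB i) * cvar vecY"

lemma peval_bracket: "peval x (bracket i j) = x (coefA i) * x (coefB j) - x (coefA j) * x (coefB i)"
  by (simp add: bracket_def peval_diff peval_mult)

lemma peval_form_value: "peval x (form_value i) = x (coefA i) * x vecX + x (coefB i) * x vecY"
  by (simp add: form_value_def peval_add peval_mult)

lemma SL2_invariant_bracket: "SL2_invariant (bracket i j)"
  unfolding SL2_invariant_mat_act
proof (intro allI impI)
  fix a b c d :: complex and x assume *: "a * d - b * c = 1"
  have "peval (mat_act a b c d x) (bracket i j) = (a * d - b * c) * peval x (bracket i j)"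
    unfolding peval_bracket by (simp add: algebra_simps)
  then show "peval (mat_act a b c d x) (bracket i j) = peval x (bracket i j)" by (simp add: *)
qed

lemma SL2_invariant_form_value: "SL2_invariant (form_value i)"
  unfolding SL2_invariant_mat_act
proof (intro allI impI)
  fix a b c d :: complex and x assume *: "a * d - b * c = 1"
  have "peval (mat_act a b c d x) (form_value i) = (a * d - b * c) * peval x (form_value i)"
    unfolding peval_form_value by (simp add: algebra_simps)
  then show "peval (mat_act a b c d x) (form_value i) = peval x (form_value i)" by (simp add: *)
qed

lemma bracket_in_invariants:
  assumes "i < n" "j < n"
  shows "bracket i j \<in> joint_invariants n"
proof -
  have "mpoly_vars (bracket i j) \<subseteq> {coefA i, coefB j} \<union> {coefA j, coefB i}"
    unfolding bracket_def
    by (rule order_trans[OF mpoly_vars_diff Un_mono])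
       (rule mpoly_vars_cvar_mult)+
  then show ?thesis
    using assms SL2_invariant_bracket by (auto simp: joint_invariants_def form_coords_def)
qed

lemma form_value_in_covariants:
  assumes "i < n"
  shows "form_value i \<in> joint_covariants n"
proof -
  have "mpoly_vars (form_value i) \<subseteq> {coefA i, vecX} \<union> {coefB i, vecY}"
    unfolding form_value_def
    by (rule order_trans[OF mpoly_vars_add Un_mono])
       (rule mpoly_vars_cvar_mult)+
  then show ?thesis
    using assms SL2_invariant_form_value by (auto simp: joint_covariants_def form_coords_def)
qed

lemma joint_invariants_subset: "joint_invariants n \<subseteq> joint_covariants n"
  by (auto simp: joint_invariants_def joint_covariants_def)

lemma joint_invariants_mult: "p \<in> joint_invariants n \<Longrightarrow> q \<in> joint_invariants n \<Longrightarrow> p * q \<in> joint_invariants n"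
  using mpoly_vars_mult[of p q] by (auto simp: joint_invariants_def SL2_invariant_mult)

lemma joint_covariants_mult: "p \<in> joint_covariants n \<Longrightarrow> q \<in> joint_covariants n \<Longrightarrow> p * q \<in> joint_covariants n"
  using mpoly_vars_mult[of p q] by (auto simp: joint_covariants_def SL2_invariant_mult)

lemma one_in_joint_invariants: "1 \<in> joint_invariants n"
  by (simp add: joint_invariants_def SL2_invariant_1 mpoly_vars_def)

lemma sum_growth:
  fixes f :: "nat \<Rightarrow> nat"
  assumes f: "\<And>j. real (f j) \<le> C * real (j + 1) ^ r"
  shows "real (\<Sum>j\<le>M. f j) \<le> C * real (M + 1) ^ Suc r"
proof -
  have C: "C \<ge> 0" using f[of 0] by simp
  have "real (\<Sum>j\<le>M. f j) \<le> (\<Sum>j\<le>M. C * real (M + 1) ^ r)"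
    unfolding of_nat_sum
  proof (rule sum_mono)
    fix j assume "j \<in> {..M}"
    then have "C * real (j + 1) ^ r \<le> C * real (M + 1) ^ r"
      by (intro mult_left_mono power_mono C) auto
    with f[of j] show "real (f j) \<le> C * real (M + 1) ^ r" by linarith
  qed
  then show ?thesis by (simp add: mult_ac)
qed

lemma trdeg_invariants:
  assumes n: "n \<ge> 2" and growth: "\<And>j. real (inv_dim n j) \<le> C * real (j + 1) ^ (2 * n - 4)"
  shows "trdeg const_fract (quotient_field (joint_invariants n)) = 2 * n - 3"
proof -
  \<comment> \<open>All brackets with form 0, and the brackets of form 1 with forms of index at
    least 2.\<close>
  define I where "I = ({0 :: nat} \<times> {1..<n}) \<union> ({1} \<times> {2..<n})"
  have fin: "finite I" by (simp add: I_def)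
  have card: "card I = 2 * n - 3"
    unfolding I_def using n by (subst card_Un_disjoint) (auto simp: card_cartesian_product)
  have "trdeg const_fract (quotient_field (joint_invariants n)) = card I"
  proof (rule trdeg_eqI[where g = "\<lambda>(k, i). bracket k i" and C = C])
    show "(case i of (k, i) \<Rightarrow> bracket k i) \<in> joint_invariants n" if "i \<in> I" for i
      using that n by (auto simp: I_def intro: bracket_in_invariants)
    fix H M assume H: "mpoly.independent H" "H \<subseteq> joint_invariants n" "\<And>p. p \<in> H \<Longrightarrow> form_degree_le p M"
    have "real (card H) \<le> real (\<Sum>j\<le>M. inv_dim n j)"
      unfolding of_nat_le_iff using H by (intro card_independent_invariants) (auto simp: form_degree_le_def)
    also have "\<dots> \<le> C * real (M + 1) ^ Suc (2 * n - 4)"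
      by (rule sum_growth[OF growth])
    also have "Suc (2 * n - 4) = card I" using n by (simp add: card)
    finally show "real (card H) \<le> C * real (M + 1) ^ card I" .
  next
    fix c :: "nat \<times> nat \<Rightarrow> complex" assume c: "\<forall>i. c i \<noteq> 0"
    \<comment> \<open>Form 0 is normalized to (1, 0) and form 1 to \<open>(0, c (0, 1))\<close>;
      brackets with these two read off both coefficients of every later form.\<close>
    define x where "x v = (case v of coefA i \<Rightarrow> if i = 0 then 1 else if i = 1 then 0 else - c (1, i) / c (0, 1)
      | coefB i \<Rightarrow> if i = 0 then 0 else c (0, i) | _ \<Rightarrow> 0)" for v
    have "peval x (case i of (k, i) \<Rightarrow> bracket k i) = c i" if "i \<in> I" for i
      using that c by (auto simp: I_def peval_bracket x_def)
    then show "\<exists>x. \<forall>i\<in>I. peval x (case i of (k, i) \<Rightarrow> bracket k i) = c i" by blast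
  qed (auto intro: joint_invariants_mult one_in_joint_invariants fin)
  then show ?thesis by (simp add: card)
qed

lemma trdeg_covariants:
  assumes n: "n \<ge> 1" and growth: "\<And>j. real (cov_dim n j) \<le> C * real (j + 1) ^ (2 * n - 2)"
  shows "trdeg const_fract (quotient_field (joint_covariants n)) = 2 * n - 1"
proof -
  \<comment> \<open>The tag 0 marks brackets with form 0, the tag 1 values of forms.\<close>
  define I where "I = ({0 :: nat} \<times> {1..<n}) \<union> ({1} \<times> {..<n})"
  have fin: "finite I" by (simp add: I_def)
  have card: "card I = 2 * n - 1"
    unfolding I_def using n by (subst card_Un_disjoint) (auto simp: card_cartesian_product)
  let ?g = "\<lambda>(k :: nat, i). if k = 0 then bracket 0 i else form_value i"
  have "trdeg const_fract (quotient_field (joint_covariants n)) = card I"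
  proof (rule trdeg_eqI[where g = ?g and C = C])
    show "?g i \<in> joint_covariants n" if "i \<in> I" for i
      using that n bracket_in_invariants[of 0 n] subsetD[OF joint_invariants_subset[of n]]
      by (auto simp: I_def form_value_in_covariants)
    fix H M assume H: "mpoly.independent H" "H \<subseteq> joint_covariants n" "\<And>p. p \<in> H \<Longrightarrow> form_degree_le p M"
    have "real (card H) \<le> real (\<Sum>j\<le>M. cov_dim n j)"
      unfolding of_nat_le_iff using H by (intro card_independent_covariants) (auto simp: form_degree_le_def)
    also have "\<dots> \<le> C * real (M + 1) ^ Suc (2 * n - 2)"
      by (rule sum_growth[OF growth])
    also have "Suc (2 * n - 2) = card I" using n by (simp add: card)
    finally show "real (card H) \<le> C * real (M + 1) ^ card I" .
  next
    fix c :: "nat \<times> nat \<Rightarrow> complex" assume c: "\<forall>i. c i \<noteq> 0"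
    \<comment> \<open>At the vector (1, 0) the values of the forms are their first coefficients.
      Since form 0 is \<open>(c (1, 0), 0)\<close>, brackets with it give the second ones.\<close>
    define x where "x v = (case v of coefA i \<Rightarrow> c (1, i)
      | coefB i \<Rightarrow> if i = 0 then 0 else c (0, i) / c (1, 0) | vecX \<Rightarrow> 1 | vecY \<Rightarrow> 0)" for v
    have "peval x (?g i) = c i" if "i \<in> I" for i
      using that c by (auto simp: I_def peval_bracket peval_form_value x_def)
    then show "\<exists>x. \<forall>i\<in>I. peval x (?g i) = c i" by blast
  qed (use one_in_joint_invariants joint_invariants_subset in \<open>auto intro: joint_covariants_mult fin\<close>)
  then show ?thesis by (simp add: card)
qed

section \<open>Asymptotics\<close>

lemma binomial_power_sums:
  fixes z :: real
  assumes "0 \<le> z" "z < 1"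
  shows "(\<lambda>k. real ((m + k) choose k) * z ^ k) sums (1 / (1 - z) ^ (m + 1))"
proof (induction m)
  case 0
  then show ?case using assms geometric_sums[of z] by simp
next
  case (Suc m)
  have geo: "(\<lambda>k. z ^ k) sums (1 / (1 - z))" using assms geometric_sums[of z] by simp
  \<comment> \<open>Multiplying by the geometric series forms partial sums of coefficients, which
    the hockey-stick identity evaluates.\<close>
  have "(\<lambda>k. \<Sum>i\<le>k. (real ((m + i) choose i) * z ^ i) * z ^ (k - i)) sums
      (suminf (\<lambda>k. real ((m + k) choose k) * z ^ k) * (suminf (\<lambda>k. z ^ k)))"
    using assms sums_summable[OF Suc] sums_summable[OF geo]
    by (intro Cauchy_product_sums) (simp_all add: abs_mult)
  also have "suminf (\<lambda>k. real ((m + k) choose k) * z ^ k) * (suminf (\<lambda>k. z ^ k)) = 1 / (1 - z) ^ (Suc m + 1)"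
    unfolding sums_unique[OF Suc, symmetric] sums_unique[OF geo, symmetric] by simp
  also have "(\<lambda>k. \<Sum>i\<le>k. (real ((m + i) choose i) * z ^ i) * z ^ (k - i)) =
      (\<lambda>k. real ((Suc m + k) choose k) * z ^ k)"
  proof
    fix k
    have "(\<Sum>i\<le>k. (real ((m + i) choose i) * z ^ i) * z ^ (k - i)) = (\<Sum>i\<le>k. real ((m + i) choose i) * z ^ k)"
      by (intro sum.cong) (auto simp flip: power_add simp: mult.assoc)
    also have "\<dots> = real (\<Sum>i\<le>k. (m + i) choose i) * z ^ k"
      by (simp add: sum_distrib_right)
    finally show "(\<Sum>i\<le>k. (real ((m + i) choose i) * z ^ i) * z ^ (k - i)) = real ((Suc m + k) choose k) * z ^ k"
      by (simp only: sum_choose_lower add_Suc)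
  qed
  finally show ?case .
qed

lemma binomial_power_asymp:
  "(\<lambda>k. real ((m + k) choose k) / real k ^ m) \<longlonglongrightarrow> 1 / fact m"
proof (induction m)
  case 0
  then show ?case by simp
next
  case (Suc m)
  have "(\<lambda>k. real ((m + k) choose k) / real k ^ m * (real (Suc m + k) / real k / real (Suc m)))
      \<longlonglongrightarrow> 1 / fact m * (1 / real (Suc m))"
    by (intro tendsto_mult Suc tendsto_divide tendsto_const) (real_asymp | simp)+
  moreover have "real ((m + k) choose k) / real k ^ m * (real (Suc m + k) / real k / real (Suc m)) =
      real ((Suc m + k) choose k) / real k ^ Suc m" for k
  proof -
    have h: "real ((Suc m + k) choose k) * real (Suc m) = real (Suc (m + k)) * real ((m + k) choose k)"
    proof -
      have "Suc (m + k) * ((m + k) choose m) = (Suc (m + k) choose Suc m) * Suc m"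
        by (rule Suc_times_binomial_eq)
      moreover have "(m + k) choose k = (m + k) choose m" "(Suc m + k) choose k = Suc (m + k) choose Suc m"
        using binomial_symmetric[of k "m + k"] binomial_symmetric[of k "Suc m + k"] by auto
      ultimately show ?thesis by (simp only: flip: of_nat_mult)
    qed
    have "real (Suc m) \<noteq> 0" by simp
    then have "real ((Suc m + k) choose k) = real (Suc (m + k)) * real ((m + k) choose k) / real (Suc m)"
      by (rule iffD2[OF nonzero_eq_divide_eq h])
    then show ?thesis by (simp only: add_Suc power_Suc times_divide_times_eq divide_divide_eq_left times_divide_eq_right mult_ac)
  qed
  ultimately show ?case by (simp add: mult.commute)
qed

text \<open>The comparison sequence \<open>B\<close> grows like \<open>k ^ m / fact m\<close> and
  has the generating function \<open>1 / (1 - z) ^ (m + 1)\<close>. Subtracting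
  \<open>L * fact m\<close> times it leaves a sequence of smaller order than \<open>B\<close>, which
  does not contribute to the limit.\<close>

lemma abelian_limit:
  fixes f :: "nat \<Rightarrow> real"
  assumes f: "(\<lambda>k. f k / real k ^ m) \<longlonglongrightarrow> L"
  shows "\<And>z. 0 \<le> z \<Longrightarrow> z < 1 \<Longrightarrow> summable (\<lambda>k. f k * z ^ k)"
    and "((\<lambda>z. (1 - z) ^ (m + 1) * suminf (\<lambda>k. f k * z ^ k)) \<longlongrightarrow> L * fact m) (at_left 1)"
proof -
  define B where "B k = real ((m + k) choose k)" for k
  have Bpos: "B k > 0" for k by (simp add: B_def)
  define c where "c = L * fact m"
  define g where "g k = f k - c * B k" for k
  have "(\<lambda>k. f k / real k ^ m / (B k / real k ^ m) - c) \<longlonglongrightarrow> L / (1 / fact m) - c"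
    unfolding B_def by (intro tendsto_diff tendsto_divide f binomial_power_asymp tendsto_const) simp
  moreover have "\<forall>\<^sub>F k in sequentially. f k / real k ^ m / (B k / real k ^ m) - c = g k / B k"
    using eventually_gt_at_top[of 0]
  proof eventually_elim
    case (elim k)
    then show ?case using Bpos[of k] by (simp add: g_def field_simps)
  qed
  ultimately have g0: "(\<lambda>k. g k / B k) \<longlonglongrightarrow> 0"
    by (simp add: c_def tendsto_cong)
  have small: "\<exists>K. \<forall>k\<ge>K. \<bar>g k\<bar> \<le> e * B k" if "e > 0" for e
  proof -
    from tendstoD[OF g0 that] obtain K where K: "\<And>k. k \<ge> K \<Longrightarrow> \<bar>g k / B k\<bar> < e"
      by (auto simp: eventually_sequentially)
    show ?thesis
    proof (intro exI allI impI)
      fix k assume "k \<ge> K"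
      have "\<bar>g k\<bar> / B k < e" using K[OF \<open>k \<ge> K\<close>] by (simp only: abs_divide abs_of_pos[OF Bpos])
      then show "\<bar>g k\<bar> \<le> e * B k" by (simp only: pos_divide_less_eq[OF Bpos] less_imp_le)
    qed
  qed
  have Bs: "(\<lambda>k. B k * z ^ k) sums (1 / (1 - z) ^ (m + 1))" if "0 \<le> z" "z < 1" for z
    unfolding B_def by (rule binomial_power_sums[OF that])
  have gs: "summable (\<lambda>k. g k * z ^ k)" "summable (\<lambda>k. \<bar>g k * z ^ k\<bar>)" if z: "0 \<le> z" "z < 1" for z
  proof -
    from small[OF zero_less_one] obtain K where K: "\<forall>k\<ge>K. \<bar>g k\<bar> \<le> 1 * B k" ..
    have *: "norm (g k * z ^ k) \<le> B k * z ^ k" if "k \<ge> K" for k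
      using K that z by (auto simp: abs_mult intro!: mult_right_mono)
    show "summable (\<lambda>k. g k * z ^ k)"
      by (rule summable_comparison_test'[OF sums_summable[OF Bs[OF z]] *])
    show "summable (\<lambda>k. \<bar>g k * z ^ k\<bar>)"
      by (rule summable_comparison_test'[OF sums_summable[OF Bs[OF z]], of K]) (use * in simp)
  qed
  have fsums: "(\<lambda>k. f k * z ^ k) sums (c / (1 - z) ^ (m + 1) + suminf (\<lambda>k. g k * z ^ k))" if z: "0 \<le> z" "z < 1" for z
    using sums_add[OF sums_mult[OF Bs[OF z], of c] summable_sums[OF gs(1)[OF z]]]
    by (simp add: g_def algebra_simps)
  then show "summable (\<lambda>k. f k * z ^ k)" if "0 \<le> z" "z < 1" for z
    using that sums_summable by blast
  have lim0: "((\<lambda>z. (1 - z) ^ (m + 1) * suminf (\<lambda>k. g k * z ^ k)) \<longlongrightarrow> 0) (at_left 1)"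
  proof (rule tendstoI)
    fix e :: real assume e: "e > 0"
    have "e / 2 > 0" using e by simp
    from small[OF this] obtain K where K: "\<forall>k\<ge>K. \<bar>g k\<bar> \<le> e / 2 * B k" ..
    \<comment> \<open>Bounds the finitely many terms not dominated by \<open>e / 2 * B k\<close>;
      the factor \<open>(1 - z) ^ (m + 1)\<close> makes this part vanish in the limit.\<close>
    define M where "M = (\<Sum>k<K. \<bar>g k\<bar>)"
    have "((\<lambda>z. (1 - z) ^ (m + 1) * M) \<longlongrightarrow> (1 - 1) ^ (m + 1) * M) (at_left (1::real))"
      by (intro tendsto_intros)
    then have "\<forall>\<^sub>F z in at_left (1::real). (1 - z) ^ (m + 1) * M < e / 2"
      by (rule order_tendstoD(2)) (use e in simp)
    moreover have "\<forall>\<^sub>F z in at_left (1::real). z \<in> {0<..<1}"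
      by (rule eventually_at_left_real) simp
    ultimately show "\<forall>\<^sub>F z in at_left 1. dist ((1 - z) ^ (m + 1) * suminf (\<lambda>k. g k * z ^ k)) 0 < e"
    proof eventually_elim
      case (elim z)
      then have z: "0 \<le> z" "z < 1" and pos: "(1 - z) ^ (m + 1) > 0" by auto
      let ?h = "\<lambda>k. (if k < K then \<bar>g k\<bar> else 0) + e / 2 * (B k * z ^ k)"
      have "(\<lambda>k. if k < K then \<bar>g k\<bar> else 0) sums (\<Sum>k<K. \<bar>g k\<bar>)"
        using sums_If_finite_set[of "{..<K}" "\<lambda>k. \<bar>g k\<bar>"] by simp
      then have hs: "?h sums (M + e / 2 * (1 / (1 - z) ^ (m + 1)))"
        unfolding M_def by (intro sums_add sums_mult Bs z)
      have gh: "\<bar>g k * z ^ k\<bar> \<le> ?h k" for k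
      proof (cases "k < K")
        case True
        have "\<bar>g k\<bar> * z ^ k \<le> \<bar>g k\<bar> * 1" using z by (intro mult_left_mono power_le_one) auto
        moreover have "0 \<le> e / 2 * (B k * z ^ k)" using e z Bpos[of k] by simp
        ultimately show ?thesis using True z by (simp add: abs_mult)
      next
        case False
        then have "\<bar>g k\<bar> * z ^ k \<le> e / 2 * B k * z ^ k" using K z by (intro mult_right_mono) auto
        then show ?thesis using False z by (simp add: abs_mult mult.assoc)
      qed
      have "\<bar>suminf (\<lambda>k. g k * z ^ k)\<bar> \<le> suminf (\<lambda>k. \<bar>g k * z ^ k\<bar>)"
        by (rule summable_rabs[OF gs(2)[OF z]])
      also have "\<dots> \<le> suminf (\<lambda>k. ?h k)"
        by (intro suminf_le gh gs(2) z sums_summable[OF hs])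
      also have "\<dots> = M + e / 2 * (1 / (1 - z) ^ (m + 1))" using sums_unique[OF hs] by simp
      finally have "(1 - z) ^ (m + 1) * \<bar>suminf (\<lambda>k. g k * z ^ k)\<bar> \<le> (1 - z) ^ (m + 1) * (M + e / 2 * (1 / (1 - z) ^ (m + 1)))"
        using pos by (intro mult_left_mono) auto
      also have "\<dots> = (1 - z) ^ (m + 1) * M + e / 2"
      proof -
        have "P * (M + e / 2 * (1 / P)) = P * M + e / 2" if "P > 0" for P
          using that by (simp add: field_simps)
        from this[OF pos] show ?thesis .
      qed
      also have "\<dots> < e" using elim(1) by simp
      finally show ?case using pos by (simp add: abs_mult del: power_Suc)
    qed
  qed
  have "((\<lambda>z. c + (1 - z) ^ (m + 1) * suminf (\<lambda>k. g k * z ^ k)) \<longlongrightarrow> c + 0) (at_left 1)"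
    by (intro tendsto_add lim0 tendsto_const)
  moreover have "\<forall>\<^sub>F z in at_left (1::real). z \<in> {0<..<1}"
    by (rule eventually_at_left_real) simp
  then have "\<forall>\<^sub>F z in at_left 1. c + (1 - z) ^ (m + 1) * suminf (\<lambda>k. g k * z ^ k) = (1 - z) ^ (m + 1) * (suminf (\<lambda>k. f k * z ^ k))"
  proof eventually_elim
    case (elim z)
    then have "(1 - z) ^ (m + 1) \<noteq> 0" by simp
    then show ?case using sums_unique[OF fsums[of z]] elim
      by (simp add: distrib_left del: power_Suc flip: sums_unique[OF fsums[of z]])
  qed
  ultimately show "((\<lambda>z. (1 - z) ^ (m + 1) * suminf (\<lambda>k. f k * z ^ k)) \<longlongrightarrow> L * fact m) (at_left 1)"
    by (simp add: tendsto_cong c_def)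
qed

lemma interleave_sums:
  fixes F :: "nat \<Rightarrow> real" and z :: real
  assumes "(\<lambda>k. F (2 * k) * (z\<^sup>2) ^ k) sums s" "(\<lambda>k. F (2 * k + 1) * (z\<^sup>2) ^ k) sums t"
  shows "(\<lambda>j. F j * z ^ j) sums (s + z * t)"
proof -
  have "(\<lambda>j. if even j then F j * z ^ j else 0) sums s"
  proof (subst sums_mono_reindex[of "\<lambda>k. 2 * k", symmetric])
    show "(\<lambda>n. if even (2 * n) then F (2 * n) * z ^ (2 * n) else 0) sums s"
      using assms(1) by (simp add: power_mult)
  qed (auto simp: strict_mono_def elim!: evenE)
  moreover have "(\<lambda>j. if odd j then F j * z ^ j else 0) sums (z * t)"
  proof (subst sums_mono_reindex[of "\<lambda>k. 2 * k + 1", symmetric])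
    show "(\<lambda>n. if odd (2 * n + 1) then F (2 * n + 1) * z ^ (2 * n + 1) else 0) sums (z * t)"
      using sums_mult[OF assms(2), of z] by (simp add: mult.left_commute flip: power_mult)
  qed (auto simp: strict_mono_def elim!: oddE)
  ultimately have "(\<lambda>j. (if even j then F j * z ^ j else 0) + (if odd j then F j * z ^ j else 0)) sums (s + z * t)"
    by (rule sums_add)
  then show ?thesis by (rule sums_cong[THEN iffD1, rotated]) auto
qed

text \<open>Even and odd terms are two series in \<open>z ^ 2\<close>, each with its own limit. The
  denominator is \<open>(1 + z) ^ (m + 1)\<close> at 1, from factoring \<open>1 - z ^ 2\<close>.
  Both hypotheses are normalized by the half index \<open>k\<close>, not by the degree.\<close>

lemma abelian_limit_parity:
  fixes F :: "nat \<Rightarrow> real"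
  assumes e: "(\<lambda>k. F (2 * k) / real k ^ m) \<longlonglongrightarrow> L" and o: "(\<lambda>k. F (2 * k + 1) / real k ^ m) \<longlonglongrightarrow> L'"
  shows "((\<lambda>z. (1 - z) ^ (m + 1) * suminf (\<lambda>j. F j * z ^ j)) \<longlongrightarrow> (L + L') * fact m / 2 ^ (m + 1)) (at_left 1)"
proof -
  let ?s = "\<lambda>w. suminf (\<lambda>k. F (2 * k) * w ^ k)" and ?t = "\<lambda>w. suminf (\<lambda>k. F (2 * k + 1) * w ^ k)"
  have sq: "filterlim (\<lambda>z. z\<^sup>2) (at_left 1) (at_left (1::real))"
    by real_asymp
  have "((\<lambda>z. ((1 - z\<^sup>2) ^ (m + 1) * ?s (z\<^sup>2) + z * ((1 - z\<^sup>2) ^ (m + 1) * ?t (z\<^sup>2))) / (1 + z) ^ (m + 1))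
      \<longlongrightarrow> (L * fact m + 1 * (L' * fact m)) / (1 + 1) ^ (m + 1)) (at_left 1)"
    by (intro tendsto_intros filterlim_compose[OF abelian_limit(2)[OF e] sq]
        filterlim_compose[OF abelian_limit(2)[OF o] sq]) auto
  moreover have "\<forall>\<^sub>F z in at_left (1::real). z \<in> {0<..<1}"
    by (rule eventually_at_left_real) simp
  then have "\<forall>\<^sub>F z in at_left 1. ((1 - z\<^sup>2) ^ (m + 1) * ?s (z\<^sup>2) + z * ((1 - z\<^sup>2) ^ (m + 1) * ?t (z\<^sup>2))) / (1 + z) ^ (m + 1)
      = (1 - z) ^ (m + 1) * suminf (\<lambda>j. F j * z ^ j)"
  proof eventually_elim
    case (elim z)
    then have z: "0 \<le> z\<^sup>2" "z\<^sup>2 < 1" by (auto simp: power_less_one_iff abs_square_less_1)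
    have "(1 - z\<^sup>2) ^ (m + 1) = (1 - z) ^ (m + 1) * (1 + z) ^ (m + 1)"
      by (simp add: power2_eq_square algebra_simps flip: power_mult_distrib)
    moreover have "suminf (\<lambda>j. F j * z ^ j) = ?s (z\<^sup>2) + z * ?t (z\<^sup>2)"
      by (intro sums_unique[symmetric] interleave_sums summable_sums abelian_limit(1)[OF e] abelian_limit(1)[OF o] z)
    moreover have "(1 + z) ^ (m + 1) \<noteq> 0" using elim by simp
    ultimately show ?case by (simp add: field_simps del: power_Suc)
  qed
  ultimately show ?thesis by (simp add: tendsto_cong distrib_right)
qed

lemma polynomial_growth:
  fixes F :: "nat \<Rightarrow> real"
  assumes F: "(\<lambda>k. F k / real k ^ m) \<longlonglongrightarrow> L"
  obtains C where "C \<ge> 0" "\<And>k. F k \<le> C * real (k + 1) ^ m"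
proof -
  obtain K where K: "K > 0" "\<And>k. \<bar>F k / real k ^ m\<bar> \<le> K"
    using convergent_imp_Bseq[of "\<lambda>k. F k / real k ^ m"] F by (auto simp: convergent_def Bseq_def)
  \<comment> \<open>The summand \<open>\<bar>F 0\<bar>\<close> takes care of \<open>k = 0\<close>,
    where the bounded quotient may say nothing about \<open>F\<close>.\<close>
  have "F k \<le> (K + \<bar>F 0\<bar>) * real (k + 1) ^ m" for k
  proof (cases "k = 0")
    case False
    then have "F k / real k ^ m \<le> K" using K(2)[of k] by linarith
    then have "F k \<le> K * real k ^ m" using False by (simp add: field_simps)
    also have "\<dots> \<le> (K + \<bar>F 0\<bar>) * real (k + 1) ^ m"
      using K(1) by (intro mult_mono power_mono) auto
    finally show ?thesis .
  qed (use K(1) in simp)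
  then show thesis using K(1) by (intro that[of "K + \<bar>F 0\<bar>"]) auto
qed

lemma polynomial_growth_parity:
  fixes F :: "nat \<Rightarrow> real"
  assumes e: "(\<lambda>k. F (2 * k) / real k ^ m) \<longlonglongrightarrow> L" and o: "(\<lambda>k. F (2 * k + 1) / real k ^ m) \<longlonglongrightarrow> L'"
  obtains C where "\<And>j. F j \<le> C * real (j + 1) ^ m"
proof -
  obtain C where C: "C \<ge> 0" "\<And>k. F (2 * k) \<le> C * real (k + 1) ^ m"
    using polynomial_growth[OF e] by blast
  obtain C' where C': "C' \<ge> 0" "\<And>k. F (2 * k + 1) \<le> C' * real (k + 1) ^ m"
    using polynomial_growth[OF o] by blast
  have "F j \<le> (C + C') * real (j + 1) ^ m" for j
  proof -
    have "F j \<le> (C + C') * real (j div 2 + 1) ^ m"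
    proof (cases "even j")
      case True
      then show ?thesis using C(2)[of "j div 2"] C'(1)
        by (simp add: distrib_right add_increasing2)
    next
      case False
      then show ?thesis using C'(2)[of "j div 2"] C(1)
        by (simp add: distrib_right add_increasing)
    qed
    also have "\<dots> \<le> (C + C') * real (j + 1) ^ m"
      using C(1) C'(1) by (intro mult_left_mono power_mono) auto
    finally show ?thesis .
  qed
  then show thesis by (rule that)
qed

section \<open>Growth of the dimensions\<close>

lemma num_mons_Suc: "real (num_mons n (Suc k)) * real (Suc k) = real (num_mons n k) * real (k + n)"
  if "n \<ge> 1"
proof -
  have "Suc (k + n - 1) * ((k + n - 1) choose k) = (Suc (k + n - 1) choose Suc k) * Suc k"
    by (rule Suc_times_binomial_eq)
  with that have "num_mons n (Suc k) * Suc k = num_mons n k * (k + n)"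
    by (simp add: num_mons_def mult.commute)
  then show ?thesis by (simp only: flip: of_nat_mult)
qed

lemma num_mons_asymp:
  assumes "n \<ge> 1"
  shows "(\<lambda>k. real (num_mons n k) / real k ^ (n - 1)) \<longlonglongrightarrow> 1 / fact (n - 1)"
  using binomial_power_asymp[of "n - 1"] assms by (simp add: num_mons_def add.commute)

text \<open>The product of the neighbouring counts is \<open>num_mons n k ^ 2\<close> times a factor
  that differs from 1 by exactly \<open>(n - 1) / ((k + 1) * (n + k - 1))\<close>. This exhibits the
  cancellation of leading terms.\<close>

lemma inv_dim_even:
  assumes n: "n \<ge> 2"
  shows "real (inv_dim n (2 * k)) = real (num_mons n k) ^ 2 * real (n - 1) / (real (k + 1) * real (n + k - 1))"
proof (cases k)
  case 0
  then show ?thesis using n by (simp add: inv_dim_def num_mons_def)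
next
  case (Suc l)
  let ?N = "\<lambda>k. real (num_mons n k)"
  have 1: "?N (k + 1) = ?N k * real (k + n) / real (k + 1)"
    using num_mons_Suc[of n k] n by (simp add: field_simps del: of_nat_Suc)
  have 2: "?N (k - 1) = ?N k * real k / real (n + k - 1)"
    using num_mons_Suc[of n l] n Suc by (simp add: field_simps of_nat_diff)
  have prod: "?N (k + 1) * ?N (k - 1) = ?N k ^ 2 * (real (k + n) * real k / (real (k + 1) * real (n + k - 1)))"
    unfolding 1 2 by (simp add: power2_eq_square)
  have q: "real (k + n) * real k / (real (k + 1) * real (n + k - 1)) = 1 - real (n - 1) / (real (k + 1) * real (n + k - 1))"
  proof -
    have "real (k + n) * real k = real (k + 1) * real (n + k - 1) - real (n - 1)"
      using n by (simp add: algebra_simps of_nat_diff)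
    moreover have "real (k + 1) * real (n + k - 1) \<noteq> 0" using n by simp
    ultimately show ?thesis by (simp only: diff_divide_distrib divide_self simp_thms)
  qed
  \<comment> \<open>Log-concavity of the counts, which makes the natural subtraction in
    \<open>inv_dim\<close> exact.\<close>
  have "?N (k + 1) * ?N (k - 1) \<le> ?N k ^ 2"
    unfolding prod q by (intro mult_left_le) auto
  then have "num_mons n (k + 1) * num_mons n (k - 1) \<le> num_mons n k ^ 2"
    by (metis of_nat_le_iff of_nat_mult of_nat_power)
  then have "real (inv_dim n (2 * k)) = ?N k ^ 2 - ?N (k + 1) * ?N (k - 1)"
    using Suc by (simp add: inv_dim_def of_nat_diff)
  also have "\<dots> = ?N k ^ 2 * (real (n - 1) / (real (k + 1) * real (n + k - 1)))"
    unfolding prod q by (simp add: algebra_simps)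
  finally show ?thesis by simp
qed

lemma inv_dim_asymp:
  assumes n: "n \<ge> 2"
  shows "(\<lambda>k. real (inv_dim n (2 * k)) / real k ^ (2 * n - 4)) \<longlonglongrightarrow> real (n - 1) / fact (n - 1) ^ 2"
proof -
  have "(\<lambda>k. (real (num_mons n k) / real k ^ (n - 1)) ^ 2 * real (n - 1) * (real k ^ 2 / (real (k + 1) * (real n + real k - 1))))
      \<longlonglongrightarrow> (1 / fact (n - 1)) ^ 2 * real (n - 1) * 1"
    using n by (intro tendsto_mult tendsto_power num_mons_asymp tendsto_const) (simp, real_asymp)
  moreover have "\<forall>\<^sub>F k in sequentially. (real (num_mons n k) / real k ^ (n - 1)) ^ 2 * real (n - 1) * (real k ^ 2 / (real (k + 1) * (real n + real k - 1)))
      = real (inv_dim n (2 * k)) / real k ^ (2 * n - 4)"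
    using eventually_gt_at_top[of 0]
  proof eventually_elim
    case (elim k)
    have "(n - 1) * 2 = (2 * n - 4) + 2" using n by simp
    then have "(real k ^ (n - 1)) ^ 2 = real k ^ (2 * n - 4) * real k ^ 2"
      by (metis power_add power_mult)
    moreover have "real (n + k - 1) = real n + real k - 1" using n by (simp add: of_nat_diff)
    ultimately show ?case using elim
      by (simp add: inv_dim_even[OF n] power_divide)
  qed
  ultimately show ?thesis by (simp add: tendsto_cong power_divide)
qed

lemma cov_dim_asymp:
  assumes n: "n \<ge> 1"
  shows "(\<lambda>k. real (cov_dim n (2 * k)) / real k ^ (2 * n - 2)) \<longlonglongrightarrow> 1 / fact (n - 1) ^ 2"
    and "(\<lambda>k. real (cov_dim n (2 * k + 1)) / real k ^ (2 * n - 2)) \<longlonglongrightarrow> 1 / fact (n - 1) ^ 2"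
proof -
  have p: "real k ^ (2 * n - 2) = real k ^ (n - 1) * real k ^ (n - 1)" for k
  proof -
    have "2 * n - 2 = (n - 1) + (n - 1)" using n by simp
    then show ?thesis by (simp only: power_add)
  qed
  have "(\<lambda>k. real (num_mons n k) / real k ^ (n - 1) * (real (num_mons n k) / real k ^ (n - 1)))
      \<longlonglongrightarrow> 1 / fact (n - 1) * (1 / fact (n - 1))"
    by (intro tendsto_mult num_mons_asymp n)
  then show "(\<lambda>k. real (cov_dim n (2 * k)) / real k ^ (2 * n - 2)) \<longlonglongrightarrow> 1 / fact (n - 1) ^ 2"
    by (simp add: cov_dim_def p power2_eq_square)
  \<comment> \<open>The last factor is the quotient of consecutive counts; it tends to 1, so odd
    degrees grow like even ones.\<close>
  have "(\<lambda>k. real (num_mons n k) / real k ^ (n - 1) * (real (num_mons n k) / real k ^ (n - 1)) * (real (k + n) / real (k + 1)))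
      \<longlonglongrightarrow> 1 / fact (n - 1) * (1 / fact (n - 1)) * 1"
    by (intro tendsto_mult num_mons_asymp n) real_asymp
  moreover have "real (num_mons n k) / real k ^ (n - 1) * (real (num_mons n k) / real k ^ (n - 1)) * (real (k + n) / real (k + 1))
      = real (cov_dim n (2 * k + 1)) / real k ^ (2 * n - 2)" for k
  proof -
    have "real (num_mons n (Suc k)) = real (num_mons n k) * (real (k + n) / real (k + 1))"
      using num_mons_Suc[OF n, of k] by (simp add: field_simps del: of_nat_Suc)
    then show ?thesis unfolding p by (simp add: cov_dim_def mult_ac del: of_nat_Suc of_nat_add)
  qed
  ultimately show "(\<lambda>k. real (cov_dim n (2 * k + 1)) / real k ^ (2 * n - 2)) \<longlonglongrightarrow> 1 / fact (n - 1) ^ 2"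
    by (simp add: power2_eq_square)
qed

section \<open>The central binomial ratio \<open>(2 p choose p) / 4 ^ p\<close> and Wallis'
  product\<close>

definition central_ratio :: "nat \<Rightarrow> real" where
  "central_ratio p = fact (2 * p) / (fact p ^ 2 * 4 ^ p)"

lemma central_ratio_Suc: "central_ratio (Suc p) = central_ratio p * (2 * real p + 1) / (2 * real p + 2)"
proof -
  have f: "fact (2 * Suc p) = (2 * real p + 2) * (2 * real p + 1) * fact (2 * p)"
    by (simp add: algebra_simps)
  have d: "fact (Suc p) ^ 2 * 4 ^ Suc p = (2 * real p + 2) * (2 * real p + 2) * (fact p ^ 2 * 4 ^ p)"
    by (simp add: power2_eq_square algebra_simps)
  have "a * b * F / (a * a * X) = F / X * b / a" if "a \<noteq> 0" for a b F X :: real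
    using that by (cases "X = 0") (simp_all add: field_simps)
  then show ?thesis unfolding central_ratio_def f d by simp
qed

text \<open>\<open>central_ratio p\<close> is the product of the \<open>(2 k - 1) / (2 k)\<close>.
  Its square inverts the partial Wallis product up to the factor \<open>2 p + 1\<close>, left over
  because the denominators \<open>(2 k - 1) * (2 k + 1)\<close> overlap.\<close>

lemma central_ratio_wallis:
  "central_ratio p ^ 2 * (2 * real p + 1) * (\<Prod>k=1..p. (4 * real k ^ 2) / (4 * real k ^ 2 - 1)) = 1"
proof (induction p)
  case 0
  then show ?case by (simp add: central_ratio_def)
next
  case (Suc p)
  let ?W = "\<Prod>k=1..p. (4 * real k ^ 2) / (4 * real k ^ 2 - 1)"
  have nz: "2 * real p + 1 \<noteq> 0" "2 * real p + 2 \<noteq> 0" "2 * real (Suc p) + 1 \<noteq> 0" by auto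
  have 1: "4 * real (Suc p) ^ 2 - 1 = (2 * real p + 1) * (2 * real (Suc p) + 1)"
    "4 * real (Suc p) ^ 2 = (2 * real p + 2) ^ 2"
    by (simp_all add: power2_eq_square algebra_simps)
  have W: "(\<Prod>k=1..Suc p. (4 * real k ^ 2) / (4 * real k ^ 2 - 1)) =
      (2 * real p + 2) ^ 2 / ((2 * real p + 1) * (2 * real (Suc p) + 1)) * ?W"
    by (subst prod.nat_ivl_Suc', simp, simp only: 1(1), simp only: 1(2))
  have "(c * a / b) ^ 2 * d * (b ^ 2 / (a * d) * w) = c ^ 2 * a * w"
    if "a \<noteq> 0" "b \<noteq> 0" "d \<noteq> 0" for a b c d w :: real
    using that by (simp add: power2_eq_square field_simps)
  from this[OF nz, of "central_ratio p" ?W] show ?case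
    unfolding W central_ratio_Suc Suc .
qed

lemma central_ratio_asymp: "(\<lambda>p. central_ratio p * sqrt (real p)) \<longlonglongrightarrow> 1 / sqrt pi"
proof -
  have "(\<lambda>p. inverse (\<Prod>k=1..p. (4 * real k ^ 2) / (4 * real k ^ 2 - 1)) * (real p / (2 * real p + 1)))
      \<longlonglongrightarrow> inverse (pi / 2) * (1 / 2)"
    by (intro tendsto_mult tendsto_inverse wallis) (simp, real_asymp)
  moreover have "inverse (\<Prod>k=1..p. (4 * real k ^ 2) / (4 * real k ^ 2 - 1)) * (real p / (2 * real p + 1)) =
      central_ratio p ^ 2 * real p" for p
  proof -
    have "inverse (\<Prod>k=1..p. (4 * real k ^ 2) / (4 * real k ^ 2 - 1)) = central_ratio p ^ 2 * (2 * real p + 1)"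
      by (rule inverse_unique) (use central_ratio_wallis[of p] in \<open>simp only: mult.commute mult.left_commute\<close>)
    moreover have "2 * real p + 1 \<noteq> 0" by linarith
    ultimately show ?thesis by simp
  qed
  ultimately have "(\<lambda>p. sqrt (central_ratio p ^ 2 * real p)) \<longlonglongrightarrow> sqrt (1 / pi)"
    by (intro tendsto_real_sqrt) simp
  moreover have "central_ratio p \<ge> 0" for p by (simp add: central_ratio_def)
  ultimately show ?thesis by (simp add: real_sqrt_mult real_sqrt_divide)
qed

section \<open>The degrees of the two algebras and their asymptotics\<close>

lemma algebra_degree_invariants:
  assumes n: "n \<ge> 2"
  shows "algebra_degree (joint_invariants n) = central_ratio (n - 2) / (2 * (real n - 1))"
proof -
  let ?F = "\<lambda>j. real (inv_dim n j)"
  note e = inv_dim_asymp[OF n]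
  have o: "(\<lambda>k. ?F (2 * k + 1) / real k ^ (2 * n - 4)) \<longlonglongrightarrow> 0"
    by (simp add: inv_dim_def)
  obtain C where "\<And>j. ?F j \<le> C * real (j + 1) ^ (2 * n - 4)"
    using polynomial_growth_parity[of ?F, OF e o] by blast
  from trdeg_invariants[OF n this]
  have "trdeg const_fract (quotient_field (joint_invariants n)) = 2 * n - 4 + 1" using n by simp
  then have "algebra_degree (joint_invariants n) = Lim (at_left 1) (\<lambda>z. (1 - z) ^ (2 * n - 4 + 1) * suminf (\<lambda>j. ?F j * z ^ j))"
    by (simp only: algebra_degree_def poincare_series_def dim_graded_invariants)
  also have "\<dots> = (real (n - 1) / fact (n - 1) ^ 2 + 0) * fact (2 * n - 4) / 2 ^ (2 * n - 4 + 1)"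
    by (rule tendsto_Lim[OF trivial_limit_at_left_real abelian_limit_parity[of ?F, OF e o]])
  also have "\<dots> = central_ratio (n - 2) / (2 * (real n - 1))"
  proof -
    obtain m where m: "n = m + 2" using n le_Suc_ex by (metis add.commute)
    \<comment> \<open>To be read with \<open>s = n - 1\<close>, \<open>f = fact (n - 2)\<close>,
      \<open>F = fact (2 * n - 4)\<close> and \<open>g = 4 ^ (n - 2)\<close>.\<close>
    have "s / (s * f) ^ 2 * F / (2 * g) = F / (f ^ 2 * g) / (2 * s)" if "s \<noteq> 0" for s f F g :: real
      using that by (simp add: power2_eq_square field_simps)
    from this[of "real (Suc m)" "fact m" "fact (2 * m)" "4 ^ m"]
    have "real (Suc m) / fact (Suc m) ^ 2 * fact (2 * m) / 2 ^ Suc (2 * m) = central_ratio m / (2 * real (Suc m))"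
      by (simp only: central_ratio_def fact_Suc power_Suc power_mult) simp
    then show ?thesis by (simp add: m del: fact_Suc power_Suc)
  qed
  finally show ?thesis .
qed

lemma algebra_degree_covariants:
  assumes n: "n \<ge> 1"
  shows "algebra_degree (joint_covariants n) = central_ratio (n - 1)"
proof -
  let ?F = "\<lambda>j. real (cov_dim n j)"
  note lim = cov_dim_asymp[OF n]
  obtain C where "\<And>j. ?F j \<le> C * real (j + 1) ^ (2 * n - 2)"
    using polynomial_growth_parity[of ?F, OF lim] by blast
  from trdeg_covariants[OF n this]
  have "trdeg const_fract (quotient_field (joint_covariants n)) = 2 * n - 2 + 1" using n by simp
  then have "algebra_degree (joint_covariants n) = Lim (at_left 1) (\<lambda>z. (1 - z) ^ (2 * n - 2 + 1) * suminf (\<lambda>j. ?F j * z ^ j))"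
    by (simp only: algebra_degree_def poincare_series_def dim_graded_covariants)
  also have "\<dots> = (1 / fact (n - 1) ^ 2 + 1 / fact (n - 1) ^ 2) * fact (2 * n - 2) / 2 ^ (2 * n - 2 + 1)"
    by (rule tendsto_Lim[OF trivial_limit_at_left_real abelian_limit_parity[of ?F, OF lim]])
  also have "\<dots> = central_ratio (n - 1)"
  proof -
    obtain m where m: "n = m + 1" using n le_Suc_ex by (metis add.commute)
    have "(2::real) ^ (2 * m) = 4 ^ m" by (simp add: power_mult)
    then show ?thesis by (simp add: m central_ratio_def field_simps)
  qed
  finally show ?thesis .
qed

theorem mainTheorem4:
  shows "(\<lambda>n. algebra_degree (joint_invariants n)) \<sim>[at_top] (\<lambda>n. 1 / (2 * sqrt (pi * real n ^ 3)))
    \<and> (\<lambda>n. algebra_degree (joint_covariants n)) \<sim>[at_top] (\<lambda>n. 1 / sqrt (pi * real n))"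
proof
  have shift: "(\<lambda>n. central_ratio (n - d) * sqrt (real (n - d))) \<longlonglongrightarrow> 1 / sqrt pi" for d
    by (rule filterlim_compose[OF central_ratio_asymp filterlim_minus_const_nat_at_top])
  show "(\<lambda>n. algebra_degree (joint_invariants n)) \<sim>[at_top] (\<lambda>n. 1 / (2 * sqrt (pi * real n ^ 3)))"
  proof (rule asymp_equivI')
    \<comment> \<open>Wallis supplies \<open>sqrt (n - 2)\<close> and the degree formula another
      \<open>n - 1\<close>; the last square root compares their product with
      \<open>sqrt (n ^ 3)\<close> and tends to 1.\<close>
    have "(\<lambda>n. central_ratio (n - 2) * sqrt (real (n - 2)) * (sqrt pi * sqrt (real n ^ 3 / ((real n - 1) ^ 2 * (real n - 2)))))
        \<longlonglongrightarrow> 1 / sqrt pi * (sqrt pi * 1)"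
      by (intro tendsto_mult shift tendsto_const) real_asymp
    moreover have "\<forall>\<^sub>F n in sequentially. central_ratio (n - 2) * sqrt (real (n - 2)) * (sqrt pi * sqrt (real n ^ 3 / ((real n - 1) ^ 2 * (real n - 2)))) =
        algebra_degree (joint_invariants n) / (1 / (2 * sqrt (pi * real n ^ 3)))"
      using eventually_gt_at_top[of 2]
    proof eventually_elim
      case (elim n)
      have "sqrt (real n ^ 3 / ((real n - 1) ^ 2 * (real n - 2))) = sqrt (real n ^ 3) / ((real n - 1) * sqrt (real (n - 2)))"
        using elim by (simp add: real_sqrt_divide real_sqrt_mult of_nat_diff)
      then show ?case using elim
        by (simp add: algebra_degree_invariants real_sqrt_mult del: right_diff_distrib_numeral)
    qed
    ultimately show "(\<lambda>n. algebra_degree (joint_invariants n) / (1 / (2 * sqrt (pi * real n ^ 3)))) \<longlonglongrightarrow> 1"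
      by (simp add: tendsto_cong)
  qed
  show "(\<lambda>n. algebra_degree (joint_covariants n)) \<sim>[at_top] (\<lambda>n. 1 / sqrt (pi * real n))"
  proof (rule asymp_equivI')
    have "(\<lambda>n. central_ratio (n - 1) * sqrt (real (n - 1)) * (sqrt pi * sqrt (real n / (real n - 1))))
        \<longlonglongrightarrow> 1 / sqrt pi * (sqrt pi * 1)"
      by (intro tendsto_mult shift tendsto_const) real_asymp
    moreover have "\<forall>\<^sub>F n in sequentially. central_ratio (n - 1) * sqrt (real (n - 1)) * (sqrt pi * sqrt (real n / (real n - 1))) =
        algebra_degree (joint_covariants n) / (1 / sqrt (pi * real n))"
      using eventually_gt_at_top[of 1]
    proof eventually_elim
      case (elim n)
      have "sqrt (real n / (real n - 1)) = sqrt (real n) / sqrt (real (n - 1))"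
        using elim by (simp add: real_sqrt_divide of_nat_diff)
      then show ?case using elim
        by (simp add: algebra_degree_covariants real_sqrt_mult)
    qed
    ultimately show "(\<lambda>n. algebra_degree (joint_covariants n) / (1 / sqrt (pi * real n))) \<longlonglongrightarrow> 1"
      by (simp add: tendsto_cong)
  qed
qed

end
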